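(* Suppose that $$\overline G(x)\asymp x^{-2}\mu_2(x)\quad(x\to\infty),\qquad \limsup_{x\to\infty}\frac{\overline G(x)}{\overline F(x)}<\infty,\qquad \limsup_{n\to\infty}\frac{n|\mu_1(a_n)|}{a_n}<\infty .$$ Suppose moreover that $x\mapsto F(x+\Delta)$ is intermediate regularly varying at infinity and, if $T<\infty$, that the upper Matuszewska index of the ($O$-regularly varying) function $x\mapsto F(x+\Delta)$ is strictly smaller than $-1$. Then for any sequence $\{x_n\}$ with $n\overline F(x_n)=o(1)$, we have $\mathsf{P}\{S_n\in x+\Delta\}\sim nF(x+\Delta)$ as $n\to\infty$ uniformly for $x\ge x_n$, that is, $$\lim_{n\to\infty}\ \sup_{x\ge x_n}\left|\frac{\mathsf{P}\{S_n\in x+\Delta\}}{nF(x+\Delta)}-1\right|=0 .$$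
   Context: Let $\xi,\xi_1,\xi_2,\dots$ be i.i.d. real random variables with distribution $F$, and $S_n=\xi_1+\cdots+\xi_n$. Fix $T\in(0,\infty]$; put $\Delta=(0,T]$ if $T<\infty$ and $\Delta=(0,\infty)$ if $T=\infty$, and $F(x+\Delta)=\mathsf{P}\{\xi\in x+\Delta\}$ (so $F(x+\Delta)=\overline F(x)$ when $T=\infty$). Write $\overline F(x)=\mathsf{P}\{\xi>x\}$, $\overline G(x)=\mathsf{P}\{|\xi|>x\}$, $\mu_1(x)=\int_{|y|\le x}y\,F(dy)$, $\mu_2(x)=\int_{|y|\le x}y^2F(dy)$. Let $Q(x)=x^{-2}\mu_2(x)+\overline G(x)$, which is continuous, ultimately decreasing and tends to $0$; $a_n$ denotes the (for large $n$ unique) solution of $Q(a_n)=1/n$. $f\asymp g$ means $f=O(g)$ and $g=O(f)$. Let $f$ be a positive measurable function defined near infinity. It is $O$-regularly varying if $0<\liminf_{x\to\infty}f(xy)/f(x)\le\limsup_{x\to\infty}f(xy)/f(x)<\infty$ for every $y\ge1$; its upper Matuszewska index is then the infimum of those $\alpha\in\mathbb{R}$ for which there is $C=C(\alpha)$ such that for every $Y>1$, $f(xy)/f(x)\le C(1+o(1))y^\alpha$ as $x\to\infty$ uniformly in $y\in[1,Y]$. It is intermediate regularly varying if $\lim_{y\downarrow1}\liminf_{x\to\infty}f(xy)/f(x)=\lim_{y\downarrow1}\limsup_{x\to\infty}f(xy)/f(x)=1$ (this implies $O$-regular variation). *)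

theory Defs
  imports "HOL-Probability.Probability" "HOL-Library.Landau_Symbols"
begin

section \<open>Characteristics of a distribution \<open>F\<close> on the real line\<close>

definition tail :: "real measure \<Rightarrow> real \<Rightarrow> real" where
  "tail F x = measure F {y. y > x}"

definition abs_tail :: "real measure \<Rightarrow> real \<Rightarrow> real" where
  "abs_tail F x = measure F {y. \<bar>y\<bar> > x}"

definition trunc_mean :: "real measure \<Rightarrow> real \<Rightarrow> real" where
  "trunc_mean F x = (LINT y:{y. \<bar>y\<bar> \<le> x}|F. y)"

definition trunc_second_moment :: "real measure \<Rightarrow> real \<Rightarrow> real" where
  "trunc_second_moment F x = (LINT y:{y. \<bar>y\<bar> \<le> x}|F. y\<^sup>2)"

definition Q_fun :: "real measure \<Rightarrow> real \<Rightarrow> real" where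
  "Q_fun F x = trunc_second_moment F x / x\<^sup>2 + abs_tail F x"

text \<open>
  If \<open>F\<close> is not concentrated at \<open>0\<close>, then \<open>Q_fun F x\<close> is the integral of \<open>min 1 (y\<^sup>2 / x\<^sup>2)\<close>
  over \<open>F(dy)\<close>; it takes each value strictly between \<open>0\<close> and \<open>F(UNIV - {0})\<close> at exactly one
  \<open>x > 0\<close>. So the description below is proper for all large \<open>n\<close>; its values at the remaining
  \<open>n\<close> are irrelevant, as only the behaviour for \<open>n \<rightarrow> \<infinity>\<close> is used.
\<close>

definition norming_seq :: "real measure \<Rightarrow> nat \<Rightarrow> real" where
  "norming_seq F n = (THE x. 0 < x \<and> Q_fun F x = 1 / real n)"

text \<open>For \<open>T = \<infinity>\<close> the following is the open half-line of positive reals.\<close>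

definition Delta :: "ereal \<Rightarrow> real set" where
  "Delta T = {t. 0 < t \<and> ereal t \<le> T}"

definition shifted_Delta :: "ereal \<Rightarrow> real \<Rightarrow> real set" where
  "shifted_Delta T x = (\<lambda>t. x + t) ` Delta T"

definition local_prob :: "real measure \<Rightarrow> ereal \<Rightarrow> real \<Rightarrow> real" where
  "local_prob F T x = measure F (shifted_Delta T x)"


section \<open>Regular variation\<close>

definition pos_measurable_near_infinity :: "(real \<Rightarrow> real) \<Rightarrow> bool" where
  "pos_measurable_near_infinity f \<longleftrightarrow>
     (\<exists>x0. f \<in> borel_measurable (restrict_space borel {x0..}) \<and> (\<forall>x\<ge>x0. 0 < f x))"

definition intermediate_regularly_varying :: "(real \<Rightarrow> real) \<Rightarrow> bool" where
  "intermediate_regularly_varying f \<longleftrightarrow>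
     pos_measurable_near_infinity f \<and>
     ((\<lambda>y. Liminf at_top (\<lambda>x. ereal (f (x * y) / f x))) \<longlongrightarrow> 1) (at_right 1) \<and>
     ((\<lambda>y. Limsup at_top (\<lambda>x. ereal (f (x * y) / f x))) \<longlongrightarrow> 1) (at_right 1)"

text \<open>
  The term \<open>o(1)\<close>, uniform in \<open>y \<in> [1,Y]\<close>, is the function \<open>\<epsilon>\<close>; it may depend on \<open>Y\<close>, the
  constant \<open>C\<close> may not. The infimum is taken in the extended reals.
\<close>

definition upper_Matuszewska_index :: "(real \<Rightarrow> real) \<Rightarrow> ereal" where
  "upper_Matuszewska_index f =
     Inf {ereal \<alpha> | \<alpha>. \<exists>C::real. \<forall>Y>1. \<exists>\<epsilon>. (\<epsilon> \<longlongrightarrow> 0) at_top \<and>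
            (\<forall>\<^sub>F x in at_top. \<forall>y\<in>{1..Y}. f (x * y) / f x \<le> C * (1 + \<epsilon> x) * y powr \<alpha>)}"

end

theory Submission
  imports Defs
begin

text \<open>
  The function \<open>Q x\<close> is the expectation of \<open>min 1 (\<xi>\<^sup>2 / x\<^sup>2)\<close>, so \<open>Q\<close> decreases and \<open>x\<^sup>2 Q x\<close> increases;
  the first two hypotheses make \<open>Q\<close>, the two-sided tail and the right tail comparable and force \<open>Q\<close> to
  decay at least like a power. Hence \<open>n tail (x\<^sub>n) \<rightarrow> 0\<close> means that \<open>n Q (x\<^sub>n) \<rightarrow> 0\<close>, i.e. \<open>x\<^sub>n / a\<^sub>n \<rightarrow> \<infinity>\<close>,
  and every error below is controlled by the single small quantity \<open>n Q x\<close>.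

  If exactly one step \<open>\<xi>\<^sub>i\<close> is large and the rest of the sum is \<open>o(x)\<close>, conditioning on the rest and
  the uniform form of intermediate regular variation give the main term \<open>n F(x + \<Delta>)\<close>. A large step together
  with a rest of order \<open>x\<close> is negligible by Chebyshev's inequality. If all steps are at most \<open>\<delta> x\<close>,
  an exponential moment bound gives \<open>P(S\<^sub>n > x / 2) \<le> C (n Q x)\<^sup>p\<close> with \<open>p\<close> large for \<open>\<delta>\<close> small. For
  \<open>T < \<infinity>\<close> this is combined with the concentration bound \<open>P(S\<^sub>m \<in> w + \<Delta>) \<le> C / a\<^sub>n\<close> on one half of the steps,
  while the condition on the Matuszewska index shows that the tail is at most of order \<open>x F(x + \<Delta>)\<close>.
\<close>

section \<open>The truncated second moment function\<close>

text \<open>For \<open>T < \<infinity>\<close> the obstacle is that \<open>F(x + \<Delta>)\<close>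
  is bounded below only by a multiple of \<open>tail F x / x\<close>, while powers of
  \<open>n Q x\<close> yield no factor \<open>1 / x\<close>, since \<open>x / a\<^sub>n\<close> may
  tend to infinity arbitrarily slowly. Concentration supplies \<open>1 / a\<^sub>n\<close>, and the
  power decay of \<open>Q\<close> gives \<open>(n Q x) ^ k \<le> C a\<^sub>n / x\<close> for large
  \<open>k\<close>, which turns it into \<open>1 / x\<close>. Two further powers are spent: one is
  comparable with \<open>n tail F x\<close>, the other is small. Only an upper bound is wanted
  there, so a concentration inequality takes the place of a local limit theorem. Of the two halves
  of the steps, one carries an excess over \<open>x / 2\<close>; the other, independent of it,
  spreads the mass.

  The bound on the truncated mean at \<open>a\<^sub>n\<close> acts through its consequence at the
  levels \<open>y\<close> beyond \<open>a\<^sub>n\<close>, where the drift of \<open>n\<close> steps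
  is small compared with \<open>y\<close>.

  Uniformity in \<open>x\<close> is built in: the estimates hold for all triples \<open>n\<close>,
  \<open>a\<close>, \<open>x\<close> with \<open>n Q x\<close> below and \<open>x\<close> above
  thresholds that are fixed in advance.\<close>

context real_distribution
begin

lemma truncated_integrable:
  fixes f :: "real \<Rightarrow> real"
  assumes "f \<in> borel_measurable borel" "\<And>y. \<bar>y\<bar> \<le> x \<Longrightarrow> \<bar>f y\<bar> \<le> B"
  shows "integrable M (\<lambda>y. indicator {y. \<bar>y\<bar> \<le> x} y * f y)"
proof (rule integrable_const_bound[where B = "max B 0"])
  show "AE y in M. norm (indicator {y. \<bar>y\<bar> \<le> x} y * f y) \<le> max B 0"
    using assms(2) by (auto simp: indicator_def le_max_iff_disj)
qed (use assms(1) in measurable)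

lemma trunc_second_moment_eq:
  "trunc_second_moment M x = (LINT y|M. indicator {y. \<bar>y\<bar> \<le> x} y * y\<^sup>2)"
  by (simp add: trunc_second_moment_def set_lebesgue_integral_def)

lemma trunc_mean_eq: "trunc_mean M x = (LINT y|M. indicator {y. \<bar>y\<bar> \<le> x} y * y)"
  by (simp add: trunc_mean_def set_lebesgue_integral_def)

lemma integrable_trunc_square: "integrable M (\<lambda>y. indicator {y. \<bar>y\<bar> \<le> x} y * y\<^sup>2)"
  by (rule truncated_integrable[where B = "x\<^sup>2"]) (auto simp: abs_le_square_iff[symmetric])

lemma integrable_trunc_id: "integrable M (\<lambda>y. indicator {y. \<bar>y\<bar> \<le> x} y * y)"
  by (rule truncated_integrable[where B = x]) auto

lemma abs_tail_eq: "abs_tail M x = (LINT y|M. indicator {y. \<bar>y\<bar> > x} y)"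
  by (simp add: abs_tail_def)

lemma integrable_abs_tail: "integrable M (indicat_real {y. \<bar>y\<bar> > x})"
  by (rule integrable_const_bound[where B = 1]) auto

lemma Q_fun_eq:
  assumes "0 < x"
  shows "Q_fun M x = (LINT y|M. min 1 (y\<^sup>2 / x\<^sup>2))"
proof -
  have "Q_fun M x = (LINT y|M. indicator {y. \<bar>y\<bar> \<le> x} y * y\<^sup>2 / x\<^sup>2 + indicator {y. \<bar>y\<bar> > x} y)"
    unfolding Q_fun_def trunc_second_moment_eq abs_tail_eq
    using integrable_trunc_square integrable_abs_tail
    by (subst Bochner_Integration.integral_add) auto
  also have "\<dots> = (LINT y|M. min 1 (y\<^sup>2 / x\<^sup>2))"
  proof (rule Bochner_Integration.integral_cong[OF refl])
    fix y :: real
    have "\<bar>y\<bar> \<le> x \<longleftrightarrow> y\<^sup>2 \<le> x\<^sup>2"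
      using assms by (simp add: abs_le_square_iff[symmetric])
    then show "indicator {y. \<bar>y\<bar> \<le> x} y * y\<^sup>2 / x\<^sup>2 + indicator {y. \<bar>y\<bar> > x} y = min 1 (y\<^sup>2 / x\<^sup>2)"
      using assms by (cases "\<bar>y\<bar> \<le> x") (auto simp: indicator_def min_def field_simps)
  qed
  finally show ?thesis .
qed

lemma integrable_min_square: "integrable M (\<lambda>y. min 1 (y\<^sup>2 / x\<^sup>2))"
  by (rule integrable_const_bound[where B = 1]) (auto simp: min_def)

lemma Q_fun_antimono:
  assumes "0 < x" "x \<le> y"
  shows "Q_fun M y \<le> Q_fun M x"
proof -
  have "z\<^sup>2 / y\<^sup>2 \<le> z\<^sup>2 / x\<^sup>2" for z :: real
    using assms by (intro divide_left_mono power_mono) auto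
  then show ?thesis
    using assms unfolding Q_fun_eq[OF assms(1)] Q_fun_eq[OF less_le_trans[OF assms]]
    by (intro integral_mono integrable_min_square min.mono) auto
qed

lemma abs_tail_nonneg: "0 \<le> abs_tail M x"
  by (simp add: abs_tail_def)

lemma trunc_second_moment_nonneg: "0 \<le> trunc_second_moment M x"
  by (simp add: trunc_second_moment_eq)

lemma trunc_second_moment_mono:
  assumes "x \<le> y"
  shows "trunc_second_moment M x \<le> trunc_second_moment M y"
  unfolding trunc_second_moment_eq using assms
  by (intro integral_mono integrable_trunc_square) (auto simp: indicator_def)

lemma abs_tail_le_Q_fun: "abs_tail M x \<le> Q_fun M x"
  by (simp add: Q_fun_def trunc_second_moment_nonneg)

lemma tail_le_abs_tail: "tail M x \<le> abs_tail M x"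
  unfolding tail_def abs_tail_def by (rule finite_measure_mono) auto

lemma trunc_second_moment_le: "0 < x \<Longrightarrow> trunc_second_moment M x \<le> x\<^sup>2 * Q_fun M x"
  using abs_tail_nonneg[of x] by (simp add: Q_fun_def field_simps)

text \<open>\<open>x\<^sup>2 * min 1 (z\<^sup>2 / x\<^sup>2)\<close> is
  \<open>min (x\<^sup>2) (z\<^sup>2)\<close>, so the inequality is pointwise in \<open>z\<close>,
  with equality beyond \<open>y\<close>. The term with \<open>abs_tail M y\<close>, which mere
  monotonicity of \<open>x\<^sup>2 * Q\<close> would drop, is what later forces growth.\<close>

lemma Q_fun_scale:
  assumes "0 < x" "x \<le> y"
  shows "x\<^sup>2 * Q_fun M x + (y\<^sup>2 - x\<^sup>2) * abs_tail M y \<le> y\<^sup>2 * Q_fun M y"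
proof -
  have y: "0 < y" using assms by simp
  have "x\<^sup>2 * Q_fun M x + (y\<^sup>2 - x\<^sup>2) * abs_tail M y
      = (LINT z|M. x\<^sup>2 * min 1 (z\<^sup>2 / x\<^sup>2) + (y\<^sup>2 - x\<^sup>2) * indicator {z. \<bar>z\<bar> > y} z)"
    using assms integrable_min_square integrable_abs_tail
    by (subst Bochner_Integration.integral_add) (auto simp: Q_fun_eq abs_tail_eq)
  also have "\<dots> \<le> (LINT z|M. y\<^sup>2 * min 1 (z\<^sup>2 / y\<^sup>2))"
  proof (rule integral_mono)
    show "integrable M (\<lambda>z. x\<^sup>2 * min 1 (z\<^sup>2 / x\<^sup>2) + (y\<^sup>2 - x\<^sup>2) * indicator {z. \<bar>z\<bar> > y} z)"
      by (intro Bochner_Integration.integrable_add integrable_mult_right integrable_min_square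
          integrable_abs_tail)
    fix z :: real
    have "\<bar>z\<bar> > y \<longleftrightarrow> z\<^sup>2 > y\<^sup>2"
      using y by (simp add: abs_le_square_iff[symmetric] not_le[symmetric])
    moreover have "x\<^sup>2 \<le> y\<^sup>2" using assms by (intro power_mono) auto
    moreover have "x\<^sup>2 * min 1 (z\<^sup>2 / x\<^sup>2) = min (x\<^sup>2) (z\<^sup>2)" "y\<^sup>2 * min 1 (z\<^sup>2 / y\<^sup>2) = min (y\<^sup>2) (z\<^sup>2)"
      using assms y by (simp_all add: min_mult_distrib_left)
    ultimately show "x\<^sup>2 * min 1 (z\<^sup>2 / x\<^sup>2) + (y\<^sup>2 - x\<^sup>2) * indicator {z. \<bar>z\<bar> > y} z \<le> y\<^sup>2 * min 1 (z\<^sup>2 / y\<^sup>2)"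
      by (auto simp: indicator_def min_def)
  qed (intro integrable_mult_right integrable_min_square)
  also have "\<dots> = y\<^sup>2 * Q_fun M y"
    using y by (simp add: Q_fun_eq)
  finally show ?thesis .
qed

lemma Q_fun_le_scale:
  assumes "0 < x" "x \<le> y"
  shows "Q_fun M x \<le> (y / x)\<^sup>2 * Q_fun M y"
proof -
  have "0 \<le> (y\<^sup>2 - x\<^sup>2) * abs_tail M y"
    using assms by (intro mult_nonneg_nonneg abs_tail_nonneg) (auto intro: power_mono)
  then have "x\<^sup>2 * Q_fun M x \<le> y\<^sup>2 * Q_fun M y"
    using Q_fun_scale[OF assms] by linarith
  then show ?thesis
    using assms by (simp add: power_divide field_simps)
qed

text \<open>For \<open>\<bar>z\<bar> \<le> x\<close> the integrand loses exactly the fraction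
  \<open>1 - x\<^sup>2 / y\<^sup>2\<close> of \<open>z\<^sup>2 / x\<^sup>2\<close>; elsewhere
  monotonicity suffices. For comparable tails this becomes geometric decay of
  \<open>Q\<close>.\<close>

lemma Q_fun_decrease:
  assumes "0 < x" "x \<le> y"
  shows "(1 - x\<^sup>2 / y\<^sup>2) * (trunc_second_moment M x / x\<^sup>2) \<le> Q_fun M x - Q_fun M y"
proof -
  have y: "0 < y" using assms by simp
  have le: "x\<^sup>2 \<le> y\<^sup>2" using assms by (intro power_mono) auto
  have "Q_fun M y + (1 - x\<^sup>2 / y\<^sup>2) * (trunc_second_moment M x / x\<^sup>2)
     = (LINT z|M. min 1 (z\<^sup>2 / y\<^sup>2) + (1 - x\<^sup>2 / y\<^sup>2) * (indicator {z. \<bar>z\<bar> \<le> x} z * z\<^sup>2 / x\<^sup>2))"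
    using y unfolding trunc_second_moment_eq Q_fun_eq[OF y]
    by (subst Bochner_Integration.integral_add) (auto intro!: integrable_min_square integrable_trunc_square)
  also have "\<dots> \<le> (LINT z|M. min 1 (z\<^sup>2 / x\<^sup>2))"
  proof (rule integral_mono)
    show "integrable M (\<lambda>z. min 1 (z\<^sup>2 / y\<^sup>2) + (1 - x\<^sup>2 / y\<^sup>2) * (indicator {z. \<bar>z\<bar> \<le> x} z * z\<^sup>2 / x\<^sup>2))"
      by (intro Bochner_Integration.integrable_add integrable_mult_right integrable_min_square
          integrable_divide integrable_trunc_square)
    fix z :: real
    have iff: "\<bar>z\<bar> \<le> x \<longleftrightarrow> z\<^sup>2 \<le> x\<^sup>2"
      using assms by (simp add: abs_le_square_iff[symmetric])
    have mono: "z\<^sup>2 / y\<^sup>2 \<le> z\<^sup>2 / x\<^sup>2"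
      using assms le by (intro divide_left_mono) auto
    show "min 1 (z\<^sup>2 / y\<^sup>2) + (1 - x\<^sup>2 / y\<^sup>2) * (indicator {z. \<bar>z\<bar> \<le> x} z * z\<^sup>2 / x\<^sup>2) \<le> min 1 (z\<^sup>2 / x\<^sup>2)"
    proof (cases "\<bar>z\<bar> \<le> x")
      case True
      then have "z\<^sup>2 / x\<^sup>2 \<le> 1" "z\<^sup>2 / y\<^sup>2 \<le> 1"
        using iff le assms y by (auto intro: order_trans)
      then have mins: "min 1 (z\<^sup>2 / x\<^sup>2) = z\<^sup>2 / x\<^sup>2" "min 1 (z\<^sup>2 / y\<^sup>2) = z\<^sup>2 / y\<^sup>2"
        by (simp_all only: min_absorb2)
      have eq: "z\<^sup>2 / y\<^sup>2 + (1 - x\<^sup>2 / y\<^sup>2) * (z\<^sup>2 / x\<^sup>2) = z\<^sup>2 / x\<^sup>2"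
        using assms y by (simp add: field_simps)
      have "indicator {z. \<bar>z\<bar> \<le> x} z = (1 :: real)" using True by simp
      then show ?thesis
        unfolding mins by (simp only: mult_1_left eq order_refl)
    next
      case False
      then show ?thesis using mono by (auto simp: min_def)
    qed
  qed (rule integrable_min_square)
  also have "\<dots> = Q_fun M x" using assms by (simp add: Q_fun_eq)
  finally show ?thesis by simp
qed

text \<open>\<open>Q\<close> decreases and \<open>x\<^sup>2 * Q\<close> increases, which squeezes
  \<open>Q y\<close> between the minimum and the maximum of \<open>Q x\<close> and
  \<open>(x / y)\<^sup>2 * Q x\<close>; atoms of the distribution therefore cause no jump.\<close>

lemma continuous_on_Q_fun: "continuous_on {0<..} (Q_fun M)"
proof -
  have "isCont (Q_fun M) x" if x: "0 < x" for x
  proof -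
    let ?l = "\<lambda>y. min (Q_fun M x) ((x / y)\<^sup>2 * Q_fun M x)"
    let ?u = "\<lambda>y. max (Q_fun M x) ((x / y)\<^sup>2 * Q_fun M x)"
    have ev: "\<forall>\<^sub>F y in at x. 0 < y"
      by (rule order_tendstoD(1)[OF tendsto_ident_at x])
    have bounds: "?l y \<le> Q_fun M y \<and> Q_fun M y \<le> ?u y" if y: "0 < y" for y
    proof (cases "x \<le> y")
      case True
      then show ?thesis
        using Q_fun_antimono[OF x True] Q_fun_le_scale[OF x True] x y
        by (auto simp: min_le_iff_disj le_max_iff_disj power_divide field_simps)
    next
      case False
      then have "y \<le> x" by simp
      then show ?thesis
        using Q_fun_antimono[OF y \<open>y \<le> x\<close>] Q_fun_le_scale[OF y \<open>y \<le> x\<close>]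
        by (auto simp: min_le_iff_disj le_max_iff_disj)
    qed
    have "?l \<midarrow>x\<rightarrow> min (Q_fun M x) ((x / x)\<^sup>2 * Q_fun M x)"
      using x by (intro tendsto_intros) auto
    moreover have "?u \<midarrow>x\<rightarrow> max (Q_fun M x) ((x / x)\<^sup>2 * Q_fun M x)"
      using x by (intro tendsto_intros) auto
    ultimately have lims: "?l \<midarrow>x\<rightarrow> Q_fun M x" "?u \<midarrow>x\<rightarrow> Q_fun M x"
      using x by simp_all
    have "Q_fun M \<midarrow>x\<rightarrow> Q_fun M x"
      by (rule tendsto_sandwich[OF _ _ lims]) (rule eventually_mono[OF ev], simp add: bounds)+
    then show ?thesis by (simp add: isCont_def)
  qed
  then show ?thesis by (intro continuous_at_imp_continuous_on) auto
qed

end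

text \<open>The asymptotic comparisons of the theorem with a single constant \<open>K\<close>, valid
  from \<open>x0\<close> on, so that later bounds hold at every level from \<open>x0\<close> on and
  not just eventually.\<close>

locale balanced_tails = real_distribution F for F +
  fixes K x0 :: real
  assumes x0_pos: "0 < x0" and K_ge_1: "1 \<le> K"
    and abs_tail_le: "x0 \<le> x \<Longrightarrow> abs_tail F x \<le> K * (trunc_second_moment F x / x\<^sup>2)"
    and second_moment_le: "x0 \<le> x \<Longrightarrow> trunc_second_moment F x / x\<^sup>2 \<le> K * abs_tail F x"
    and abs_tail_le_tail: "x0 \<le> x \<Longrightarrow> abs_tail F x \<le> K * tail F x"
    and tail_pos: "0 < tail F x"
begin

section \<open>Decay of \<open>Q\<close> and growth of \<open>x\<^sup>2 * Q\<close> under comparable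
  tails\<close>

lemma abs_tail_pos: "0 < abs_tail F x"
  using tail_pos tail_le_abs_tail by (rule less_le_trans)

lemma Q_fun_pos: "0 < Q_fun F x"
  using abs_tail_pos abs_tail_le_Q_fun by (rule less_le_trans)

lemma Q_fun_ge_0 [simp]: "0 \<le> Q_fun F x"
  by (rule less_imp_le[OF Q_fun_pos])

lemma Q_fun_le_second_moment:
  "x0 \<le> x \<Longrightarrow> Q_fun F x \<le> (K + 1) * (trunc_second_moment F x / x\<^sup>2)"
  using abs_tail_le[of x] unfolding Q_fun_def distrib_right by linarith

lemma Q_fun_le_abs_tail: "x0 \<le> x \<Longrightarrow> Q_fun F x \<le> (K + 1) * abs_tail F x"
  using second_moment_le[of x] unfolding Q_fun_def distrib_right by linarith

lemma Q_fun_le_tail: 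
  assumes "x0 \<le> x"
  shows "Q_fun F x \<le> (K + 1) * K * tail F x"
proof -
  have "Q_fun F x \<le> (K + 1) * (K * tail F x)"
    using Q_fun_le_abs_tail[OF assms] mult_left_mono[OF abs_tail_le_tail[OF assms], of "K + 1"] K_ge_1
    by linarith
  then show ?thesis by (simp add: mult.assoc)
qed

lemma Q_fun_strict_antimono:
  assumes "x0 \<le> x" "x < y"
  shows "Q_fun F y < Q_fun F x"
proof -
  have x: "0 < x" using assms x0_pos by simp
  have "0 < K * (trunc_second_moment F x / x\<^sup>2)"
    using abs_tail_le[OF assms(1)] abs_tail_pos[of x] by linarith
  then have "0 < trunc_second_moment F x / x\<^sup>2"
    using K_ge_1 by (metis zero_less_mult_pos less_le_trans zero_less_one)
  moreover have "x\<^sup>2 < y\<^sup>2" using x assms by (intro power_strict_mono) auto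
  then have "0 < 1 - x\<^sup>2 / y\<^sup>2" using x assms by (simp add: divide_less_eq)
  ultimately have "0 < (1 - x\<^sup>2 / y\<^sup>2) * (trunc_second_moment F x / x\<^sup>2)" by (rule mult_pos_pos[rotated])
  then show ?thesis using Q_fun_decrease[of x y] x assms by linarith
qed

text \<open>\<open>3 / 4\<close> is \<open>1 - x\<^sup>2 / y\<^sup>2\<close> at
  \<open>y = 2 * x\<close>, and comparability makes the truncated second moment at least the
  fraction \<open>1 / (K + 1)\<close> of \<open>Q\<close>.\<close>

lemma Q_fun_double:
  assumes "x0 \<le> x"
  shows "Q_fun F (2 * x) \<le> (1 - 3 / (4 * (K + 1))) * Q_fun F x"
proof -
  have x: "0 < x" using assms x0_pos by simp
  have "3 / 4 * (trunc_second_moment F x / x\<^sup>2) \<le> Q_fun F x - Q_fun F (2 * x)"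
    using Q_fun_decrease[of x "2 * x"] x by (simp add: power_mult_distrib)
  moreover have "Q_fun F x / (K + 1) \<le> trunc_second_moment F x / x\<^sup>2"
    using Q_fun_le_second_moment[OF assms] K_ge_1 by (simp add: field_simps)
  moreover have "(1 - 3 / (4 * (K + 1))) * Q_fun F x = Q_fun F x - 3 / 4 * (Q_fun F x / (K + 1))"
    using K_ge_1 by (simp add: field_simps)
  ultimately show ?thesis by linarith
qed

text \<open>Each doubling contracts \<open>Q\<close> by a factor \<open>r\<close>, which gives the
  exponent \<open>log 2 (1 / r)\<close>; rounding the number of doublings down costs one factor,
  whence \<open>\<theta> = 1 / r\<close>.\<close>

lemma Q_fun_decay:
  obtains \<theta> \<gamma> :: real where "0 < \<theta>" "0 < \<gamma>"
    "\<And>x y. x0 \<le> x \<Longrightarrow> x \<le> y \<Longrightarrow> Q_fun F y \<le> \<theta> * (x / y) powr \<gamma> * Q_fun F x"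
proof -
  define r where "r = 1 - 3 / (4 * (K + 1))"
  have "3 / (4 * (K + 1)) < 1" "0 < 3 / (4 * (K + 1))"
    using K_ge_1 by (simp_all add: field_simps)
  then have r: "0 < r" "r < 1" by (simp_all add: r_def)
  have pow: "Q_fun F (2 ^ k * x) \<le> r ^ k * Q_fun F x" if "x0 \<le> x" for k x
  proof (induction k)
    case (Suc k)
    have "x0 \<le> 2 ^ k * x"
      using that x0_pos mult_mono[of 1 "2 ^ k" x0 x] by simp
    then have "Q_fun F (2 * (2 ^ k * x)) \<le> r * Q_fun F (2 ^ k * x)"
      unfolding r_def by (rule Q_fun_double)
    also have "\<dots> \<le> r * (r ^ k * Q_fun F x)" using r Suc by (intro mult_left_mono) auto
    finally show ?case by (simp add: mult.assoc)
  qed simp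
  define \<gamma> where "\<gamma> = log 2 (1 / r)"
  have \<gamma>: "0 < \<gamma>" using r by (simp add: \<gamma>_def)
  show ?thesis
  proof (rule that[of "1 / r" \<gamma>])
    fix x y assume xy: "x0 \<le> x" "x \<le> y"
    have x: "0 < x" using x0_pos xy by simp
    define k where "k = nat \<lfloor>log 2 (y / x)\<rfloor>"
    have l: "0 \<le> log 2 (y / x)" using x xy by simp
    then have k: "real k \<le> log 2 (y / x)" "log 2 (y / x) \<le> real k + 1"
      unfolding k_def by linarith+
    have "2 powr real k \<le> 2 powr log 2 (y / x)" using k by (intro powr_mono) auto
    then have "2 ^ k * x \<le> y" using x xy by (simp add: powr_realpow field_simps)
    then have "Q_fun F y \<le> Q_fun F (2 ^ k * x)" using x by (intro Q_fun_antimono) auto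
    also have "\<dots> \<le> r ^ k * Q_fun F x" by (rule pow[OF xy(1)])
    also have "\<dots> \<le> 1 / r * (x / y) powr \<gamma> * Q_fun F x"
    proof (rule mult_right_mono)
      have "(x / y) powr \<gamma> = (2 powr (- log 2 (y / x))) powr \<gamma>"
        using x xy by (simp add: powr_minus)
      also have "\<dots> = (2 powr \<gamma>) powr (- log 2 (y / x))"
        by (simp add: powr_powr mult.commute)
      also have "2 powr \<gamma> = 1 / r" using r by (simp add: \<gamma>_def)
      also have "(1 / r) powr (- log 2 (y / x)) = r powr (log 2 (y / x))"
        using r by (simp add: powr_minus_divide powr_divide)
      finally have "(x / y) powr \<gamma> \<ge> r powr (real k + 1)"
        using k r by (simp add: powr_mono')
      then show "r ^ k \<le> 1 / r * (x / y) powr \<gamma>"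
        using r by (simp add: powr_add powr_realpow field_simps)
    qed (rule less_imp_le[OF Q_fun_pos])
    finally show "Q_fun F y \<le> 1 / r * (x / y) powr \<gamma> * Q_fun F x" .
  qed (use r \<gamma> in auto)
qed

lemma Q_fun_tendsto_0: "(Q_fun F \<longlongrightarrow> 0) at_top"
proof -
  obtain \<theta> \<gamma> where *: "0 < \<theta>" "0 < \<gamma>"
    "\<And>x y. x0 \<le> x \<Longrightarrow> x \<le> y \<Longrightarrow> Q_fun F y \<le> \<theta> * (x / y) powr \<gamma> * Q_fun F x"
    using Q_fun_decay by blast
  have "((\<lambda>y. \<theta> * (x0 / y) powr \<gamma> * Q_fun F x0) \<longlongrightarrow> \<theta> * 0 * Q_fun F x0) at_top"
    using * x0_pos
    by (intro tendsto_intros tendsto_zero_powrI[where b = \<gamma>])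
       (auto intro!: tendsto_divide_0[OF tendsto_const] filterlim_at_top_imp_at_infinity filterlim_ident
             eventually_mono[OF eventually_ge_at_top[of 0]])
  then have lim: "((\<lambda>y. \<theta> * (x0 / y) powr \<gamma> * Q_fun F x0) \<longlongrightarrow> 0) at_top" by simp
  show ?thesis
    by (rule tendsto_sandwich[OF _ _ tendsto_const lim])
       (auto intro!: eventually_mono[OF eventually_ge_at_top[of x0]] *(3) less_imp_le[OF Q_fun_pos])
qed

text \<open>\<open>V x = x\<^sup>2 * Q x\<close> gains a fixed fraction at every doubling, because a
  definite share of \<open>Q\<close> is tail. The unboundedness allows the contribution of any
  bounded set to be discarded in the estimate of the characteristic function.\<close>

lemma trunc_second_moment_unbounded: "\<exists>x\<ge>x0. B < trunc_second_moment F x"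
proof -
  define c where "c = 3 / (4 * (K + 1))"
  have c: "0 < c" using K_ge_1 by (simp add: c_def)
  define V where "V x = x\<^sup>2 * Q_fun F x" for x
  have V_double: "(1 + c) * V x \<le> V (2 * x)" if "x0 \<le> x" for x
  proof -
    have x: "0 < x" using that x0_pos by simp
    have "V x + 3 * x\<^sup>2 * abs_tail F (2 * x) \<le> V (2 * x)"
      using Q_fun_scale[of x "2 * x"] x by (simp add: V_def power_mult_distrib)
    moreover have "Q_fun F (2 * x) / (K + 1) \<le> abs_tail F (2 * x)"
      using Q_fun_le_abs_tail[of "2 * x"] that x K_ge_1 by (simp add: field_simps)
    then have "3 * x\<^sup>2 * (Q_fun F (2 * x) / (K + 1)) \<le> 3 * x\<^sup>2 * abs_tail F (2 * x)"
      by (intro mult_left_mono) auto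
    moreover have "3 * x\<^sup>2 * (Q_fun F (2 * x) / (K + 1)) = c * V (2 * x)"
      using K_ge_1 by (simp add: V_def c_def field_simps)
    moreover have "0 \<le> 3 * x\<^sup>2 * abs_tail F (2 * x)"
      by (intro mult_nonneg_nonneg abs_tail_nonneg) auto
    ultimately have "V x + c * V (2 * x) \<le> V (2 * x)" "V x \<le> V (2 * x)" by linarith+
    then have "c * V x \<le> c * V (2 * x)" using c by (intro mult_left_mono) auto
    with \<open>V x + c * V (2 * x) \<le> V (2 * x)\<close> show ?thesis by (simp add: algebra_simps)
  qed
  have V_pow: "(1 + c) ^ k * V x0 \<le> V (2 ^ k * x0)" for k
  proof (induction k)
    case (Suc k)
    have "(1 + c) * ((1 + c) ^ k * V x0) \<le> (1 + c) * V (2 ^ k * x0)"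
      using Suc c by (intro mult_left_mono) auto
    also have "\<dots> \<le> V (2 * (2 ^ k * x0))"
      using x0_pos by (intro V_double) auto
    finally show ?case by (simp add: mult.assoc)
  qed simp
  have V0: "0 < V x0" using x0_pos Q_fun_pos by (simp add: V_def)
  obtain k where k: "(K + 1) * (\<bar>B\<bar> + 1) / V x0 < (1 + c) ^ k"
    using real_arch_pow[of "1 + c"] c by auto
  define x where "x = 2 ^ k * x0"
  have x: "x0 \<le> x" using x0_pos by (simp add: x_def)
  then have "0 < x" using x0_pos by simp
  have "(K + 1) * (\<bar>B\<bar> + 1) < V x"
    using k V_pow[of k] V0 by (simp add: x_def field_simps)
  also have "V x \<le> (K + 1) * trunc_second_moment F x"
    using Q_fun_le_second_moment[OF x] \<open>0 < x\<close> by (simp add: V_def field_simps)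
  finally have "\<bar>B\<bar> + 1 < trunc_second_moment F x" using K_ge_1 by simp
  then show ?thesis using x by (intro exI[of _ x]) auto
qed

text \<open>This justifies the definite description: existence comes from continuity and decay of
  \<open>Q\<close>, uniqueness from strict decrease. As \<open>X\<close> is arbitrary, it also
  contains \<open>a\<^sub>n \<rightarrow> \<infinity>\<close>.\<close>

lemma norming_seq_eventually:
  "\<forall>\<^sub>F n in sequentially. X < norming_seq F n \<and> Q_fun F (norming_seq F n) = 1 / real n"
proof -
  define X' where "X' = max X x0"
  have "X' > 0" using x0_pos by (simp add: X'_def)
  have "\<forall>\<^sub>F n in sequentially. 1 / real n < Q_fun F X'"
    by (rule order_tendstoD(2)[OF lim_1_over_n Q_fun_pos])
  then show ?thesis using eventually_gt_at_top[of 0]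
  proof eventually_elim
    case (elim n)
    obtain b where "X' \<le> b" "Q_fun F b < 1 / real n"
    proof -
      have "\<forall>\<^sub>F x in at_top. Q_fun F x < 1 / real n"
        using order_tendstoD(2)[OF Q_fun_tendsto_0] elim by simp
      then have "\<forall>\<^sub>F x in at_top. X' \<le> x \<and> Q_fun F x < 1 / real n"
        using eventually_ge_at_top[of X'] by eventually_elim auto
      then have "\<exists>x. X' \<le> x \<and> Q_fun F x < 1 / real n"
        by (rule eventually_happens'[OF trivial_limit_at_top_linorder])
      then show ?thesis using that by blast
    qed
    have "continuous_on {X'..b} (Q_fun F)"
      by (rule continuous_on_subset[OF continuous_on_Q_fun]) (use \<open>X' > 0\<close> in auto)
    then obtain a where a: "X' \<le> a" "a \<le> b" "Q_fun F a = 1 / real n"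
      using IVT2'[of "Q_fun F" b "1 / real n" X'] elim \<open>X' \<le> b\<close> \<open>Q_fun F b < _\<close> by force
    have "norming_seq F n = a"
      unfolding norming_seq_def
    proof (rule the_equality)
      show "0 < a \<and> Q_fun F a = 1 / real n" using a \<open>X' > 0\<close> by auto
      fix z assume z: "0 < z \<and> Q_fun F z = 1 / real n"
      \<comment> \<open>Strict decrease is known only from \<open>x0\<close> on. A competing
        solution below \<open>X'\<close> is impossible because \<open>Q\<close> is there at least
        \<open>Q_fun F X'\<close>, which exceeds \<open>1 / n\<close>.\<close>
      have "X' < z"
      proof (rule ccontr)
        assume "\<not> X' < z"
        then have "Q_fun F X' \<le> Q_fun F z" using z by (intro Q_fun_antimono) auto
        then show False using elim z by simp
      qed
      then show "z = a"
        using Q_fun_strict_antimono[of z a] Q_fun_strict_antimono[of a z] a z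
        by (cases z a rule: linorder_cases) (auto simp: X'_def)
    qed
    moreover have "a \<noteq> X'" using a elim by auto
    ultimately show ?case using a by (auto simp: X'_def)
  qed
qed

end

section \<open>Uniformity in regular variation\<close>

text \<open>
  A Steinhaus argument: for large \<open>n\<close> the \<open>y\<close> with small increment from \<open>u\<^sub>n\<close> and those with small
  increment from \<open>u\<^sub>n + y\<^sub>n\<close> each fill almost all of an interval of length \<open>2\<delta>\<close>, so they overlap.
\<close>

lemma uniform_increments:
  fixes h :: "real \<Rightarrow> real"
  assumes [measurable]: "h \<in> borel_measurable borel" and \<delta>: "0 < \<delta>"
    and incr: "\<And>y. 0 \<le> y \<Longrightarrow> y \<le> 2 * \<delta> \<Longrightarrow> \<forall>\<^sub>F u in at_top. \<bar>h (u + y) - h u\<bar> < \<eta>"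
  shows "\<exists>U. \<forall>u\<ge>U. \<forall>y\<in>{0..\<delta>}. \<bar>h (u + y) - h u\<bar> \<le> 2 * \<eta>"
proof (rule ccontr)
  assume "\<not> ?thesis"
  then have "\<forall>n. \<exists>p. real n \<le> fst p \<and> snd p \<in> {0..\<delta>} \<and> 2 * \<eta> < \<bar>h (fst p + snd p) - h (fst p)\<bar>"
    by (metis (no_types, lifting) fst_conv snd_conv not_le)
  then obtain p where p: "\<And>n. real n \<le> fst (p n)" "\<And>n. snd (p n) \<in> {0..\<delta>}"
    "\<And>n. 2 * \<eta> < \<bar>h (fst (p n) + snd (p n)) - h (fst (p n))\<bar>"
    by metis
  define good where "good s n = {y \<in> {0..2 * \<delta>}. \<forall>m\<ge>n. \<bar>h (s m + y) - h (s m)\<bar> < \<eta>}"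
    for s :: "nat \<Rightarrow> real" and n :: nat
  have good_sets [measurable]: "good s n \<in> sets borel" for s n
    unfolding good_def by measurable
  have good_lebesgue: "good s n \<in> sets lebesgue" for s n
    using good_sets by (auto intro: sets_completionI_sets)
  \<comment> \<open>Any bound above \<open>3 / 2 * \<delta>\<close> would serve: after translation
    by at most \<open>\<delta>\<close> both sets lie in an interval of length
    \<open>3 * \<delta>\<close>, so their measures may not add up to more than that if they are
    disjoint.\<close>
  have large: "\<forall>\<^sub>F n in sequentially. 7 / 4 * \<delta> < measure lebesgue (good s n)"
    if s: "\<And>n. real n \<le> s n" for s
  proof -
    have s_top: "filterlim s at_top sequentially"
      by (rule filterlim_at_top_mono[OF filterlim_real_sequentially]) (use s in auto)
    have "incseq (good s)"
      by (auto simp: incseq_def good_def)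
    moreover have "(\<Union>n. good s n) = {0..2 * \<delta>}"
    proof (intro equalityI subsetI)
      fix y assume y: "y \<in> {0..2 * \<delta>}"
      then have "\<forall>\<^sub>F m in sequentially. \<bar>h (s m + y) - h (s m)\<bar> < \<eta>"
        using eventually_compose_filterlim[OF incr s_top, of y] by simp
      then show "y \<in> (\<Union>n. good s n)"
        using y by (auto simp: good_def eventually_sequentially)
    qed (auto simp: good_def)
    ultimately have "(\<lambda>n. measure lebesgue (good s n)) \<longlonglongrightarrow> 2 * \<delta>"
      using Lim_measure_incseq[of "good s" lebesgue] good_lebesgue \<delta> by (auto simp: image_subset_iff)
    then show ?thesis
      using \<delta> by (intro order_tendstoD(1)) auto
  qed
  define u y where "u n = fst (p n)" and "y n = snd (p n)" for n
  have "real n \<le> u n" "real n \<le> u n + y n" for n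
    using p(1)[of n] p(2)[of n] by (auto simp: u_def y_def)
  then have "\<forall>\<^sub>F n in sequentially. 7 / 4 * \<delta> < measure lebesgue (good u n)
      \<and> 7 / 4 * \<delta> < measure lebesgue (good (\<lambda>m. u m + y m) n)"
    by (intro eventually_conj large) auto
  then obtain n where n: "7 / 4 * \<delta> < measure lebesgue (good u n)"
      "7 / 4 * \<delta> < measure lebesgue (good (\<lambda>m. u m + y m) n)"
    by (auto simp: eventually_sequentially)
  define A B where "A = good u n" and "B = (+) (y n) ` good (\<lambda>m. u m + y m) n"
  have A: "A \<in> lmeasurable" and B: "B \<in> lmeasurable"
    unfolding A_def B_def
    by (intro measurable_translation bounded_set_imp_lmeasurable good_lebesgue
        bounded_subset[OF bounded_closed_interval[of 0 "2 * \<delta>"]]; auto simp: good_def)+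
  have "A \<inter> B \<noteq> {}"
  proof
    assume disj: "A \<inter> B = {}"
    have "measure lebesgue A + measure lebesgue B = measure lebesgue (A \<union> B)"
      using A B disj by (simp add: measure_Un3)
    also have "\<dots> \<le> measure lebesgue {0..3 * \<delta>}"
    proof (rule measure_mono_fmeasurable)
      show "A \<union> B \<subseteq> {0..3 * \<delta>}"
        using p(2)[of n] \<delta> by (auto simp: A_def B_def good_def y_def)
    qed (use A B in auto)
    also have "\<dots> = 3 * \<delta>" using \<delta> by simp
    finally show False
      using n \<delta> by (simp add: A_def B_def measure_translation)
  qed
  then obtain w where "w \<in> good (\<lambda>m. u m + y m) n" "y n + w \<in> good u n"
    by (auto simp: A_def B_def)
  then have "\<bar>h (u n + y n + w) - h (u n + y n)\<bar> < \<eta>" "\<bar>h (u n + (y n + w)) - h (u n)\<bar> < \<eta>"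
    by (auto simp: good_def)
  moreover have "2 * \<eta> < \<bar>h (u n + y n) - h (u n)\<bar>"
    using p(3) by (simp add: u_def y_def)
  ultimately show False by (simp add: add.assoc)
qed

text \<open>On the logarithmic scale \<open>h u = ln (f (exp u))\<close> ratios become increments,
  to which \<open>uniform_increments\<close> applies; passing from pointwise to uniform bounds
  doubles \<open>\<kappa>\<close>.\<close>

lemma intermediate_regularly_varying_uniform_scaling:
  assumes irv: "intermediate_regularly_varying f" and \<kappa>: "0 < \<kappa>"
  obtains \<delta> X where "0 < \<delta>" "0 < X" "\<And>x. X \<le> x \<Longrightarrow> 0 < f x"
    "\<And>x y. X \<le> x \<Longrightarrow> 1 \<le> y \<Longrightarrow> y \<le> exp \<delta> \<Longrightarrow>
      exp (- 2 * \<kappa>) * f x \<le> f (x * y) \<and> f (x * y) \<le> exp (2 * \<kappa>) * f x"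
proof -
  obtain x0 where meas: "f \<in> borel_measurable (restrict_space borel {x0..})"
    and pos: "\<And>x. x0 \<le> x \<Longrightarrow> 0 < f x"
    using irv unfolding intermediate_regularly_varying_def pos_measurable_near_infinity_def by auto
  have "\<forall>\<^sub>F y in at_right 1. ereal (exp (- \<kappa>)) < Liminf at_top (\<lambda>x. ereal (f (x * y) / f x)) \<and>
      Limsup at_top (\<lambda>x. ereal (f (x * y) / f x)) < ereal (exp \<kappa>)"
    using irv \<kappa> unfolding intermediate_regularly_varying_def
    by (intro eventually_conj order_tendstoD(1)[of _ 1] order_tendstoD(2)[of _ 1]) auto
  then obtain b where b: "1 < b" and lims: "\<And>y. 1 < y \<Longrightarrow> y < b \<Longrightarrow>
      ereal (exp (- \<kappa>)) < Liminf at_top (\<lambda>x. ereal (f (x * y) / f x)) \<and>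
      Limsup at_top (\<lambda>x. ereal (f (x * y) / f x)) < ereal (exp \<kappa>)"
    by (auto simp: eventually_at_right_field)
  \<comment> \<open>The value 1 below \<open>x0\<close> makes the function positive and Borel
    measurable on the whole line without changing it at large arguments.\<close>
  define f' where "f' x = (if x0 \<le> x then f x else 1)" for x
  have f'_meas [measurable]: "f' \<in> borel_measurable borel"
    unfolding f'_def
  proof -
    have scaled: "(\<lambda>x. indicator {x0..} x *\<^sub>R f x) \<in> borel_measurable borel"
      using meas by (subst (asm) borel_measurable_restrict_space_iff) auto
    have "(\<lambda>x. if x0 \<le> x then f x else 1)
        = (\<lambda>x. if x0 \<le> x then indicator {x0..} x *\<^sub>R f x else 1)"
      by auto
    also have "\<dots> \<in> borel_measurable borel"
      by (rule measurable_If[OF scaled]) auto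
    finally show "(\<lambda>x. if x0 \<le> x then f x else 1) \<in> borel_measurable borel" .
  qed
  define h where "h u = ln (f' (exp u))" for u
  have [measurable]: "h \<in> borel_measurable borel"
    unfolding h_def by measurable
  \<comment> \<open>Increments up to \<open>2 * \<delta>\<close> are required, and
    \<open>exp (2 * \<delta>)\<close> is the square root of \<open>b\<close>, hence below
    \<open>b\<close>.\<close>
  define \<delta> where "\<delta> = ln b / 4"
  have \<delta>: "0 < \<delta>" using b by (simp add: \<delta>_def)
  have incr: "\<forall>\<^sub>F u in at_top. \<bar>h (u + v) - h u\<bar> < \<kappa>" if v: "0 \<le> v" "v \<le> 2 * \<delta>" for v
  proof (cases "v = 0")
    case True
    then show ?thesis using \<kappa> by simp
  next
    case False
    have "exp v < exp (ln b)" using v \<delta> by (intro exp_less_mono) (simp add: \<delta>_def)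
    then have "1 < exp v" "exp v < b" using v False b by auto
    note l = lims[OF this]
    have "\<forall>\<^sub>F x in at_top. exp (- \<kappa>) < f (x * exp v) / f x \<and> f (x * exp v) / f x < exp \<kappa> \<and> max 1 x0 \<le> x"
      using less_LiminfD[OF conjunct1[OF l]] Limsup_lessD[OF conjunct2[OF l]]
        eventually_ge_at_top[of "max 1 x0"]
      by eventually_elim auto
    then have "\<forall>\<^sub>F u in at_top. exp (- \<kappa>) < f (exp u * exp v) / f (exp u)
        \<and> f (exp u * exp v) / f (exp u) < exp \<kappa> \<and> max 1 x0 \<le> exp u"
      by (rule eventually_compose_filterlim[OF _ exp_at_top])
    then show ?thesis
    proof eventually_elim
      case (elim u)
      have "exp u \<le> exp u * exp v" using v by simp
      moreover have "x0 \<le> exp u" using elim by simp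
      ultimately have ge: "x0 \<le> exp u" "x0 \<le> exp u * exp v" by linarith+
      then have fpos: "0 < f (exp u)" "0 < f (exp u * exp v)" using pos by auto
      have "h (u + v) - h u = ln (f (exp u * exp v) / f (exp u))"
        using ge fpos by (simp add: h_def f'_def exp_add ln_div)
      moreover have "ln (exp (- \<kappa>)) < ln (f (exp u * exp v) / f (exp u))"
        using elim fpos by (subst ln_less_cancel_iff) auto
      moreover have "ln (f (exp u * exp v) / f (exp u)) < ln (exp \<kappa>)"
        using elim fpos by (subst ln_less_cancel_iff) auto
      ultimately show ?case by simp
    qed
  qed
  have "\<exists>U. \<forall>u\<ge>U. \<forall>y\<in>{0..\<delta>}. \<bar>h (u + y) - h u\<bar> \<le> 2 * \<kappa>"
    by (rule uniform_increments) (use \<delta> incr in auto)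
  then obtain U where "\<forall>u\<ge>U. \<forall>y\<in>{0..\<delta>}. \<bar>h (u + y) - h u\<bar> \<le> 2 * \<kappa>"
    by blast
  then have U: "\<bar>h (u + y) - h u\<bar> \<le> 2 * \<kappa>" if "U \<le> u" "0 \<le> y" "y \<le> \<delta>" for u y
    using that by simp
  define X where "X = max (max 1 x0) (exp U)"
  show ?thesis
  proof (rule that[of \<delta> X])
    fix x y assume x: "X \<le> x" and y: "1 \<le> y" "y \<le> exp \<delta>"
    have x': "1 \<le> x" "x0 \<le> x" "exp U \<le> x" using x by (auto simp: X_def)
    have "x \<le> x * y" using x' y by simp
    with x'(2) have xy: "x0 \<le> x * y" by (rule order_trans)
    have "U \<le> ln x" using x' by (simp add: ln_ge_iff)
    moreover have "0 \<le> ln y" "ln y \<le> \<delta>" using y by (auto simp: ln_le_cancel_iff[of y "exp \<delta>", simplified])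
    ultimately have "\<bar>h (ln x + ln y) - h (ln x)\<bar> \<le> 2 * \<kappa>" by (rule U)
    moreover have "h (ln x + ln y) - h (ln x) = ln (f (x * y) / f x)"
      using x' y xy pos[of x] pos[of "x * y"] by (simp add: h_def f'_def exp_add ln_div)
    ultimately have "- 2 * \<kappa> \<le> ln (f (x * y) / f x)" "ln (f (x * y) / f x) \<le> 2 * \<kappa>" by auto
    moreover have "0 < f (x * y) / f x" using pos[of x] pos[of "x * y"] x' xy by simp
    ultimately have "exp (- 2 * \<kappa>) \<le> f (x * y) / f x" "f (x * y) / f x \<le> exp (2 * \<kappa>)"
      by (metis exp_le_cancel_iff exp_ln)+
    then show "exp (- 2 * \<kappa>) * f x \<le> f (x * y) \<and> f (x * y) \<le> exp (2 * \<kappa>) * f x"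
      using pos[of x] x' by (simp add: field_simps)
  qed (use \<delta> pos in \<open>auto simp: X_def\<close>)
qed

text \<open>A shift by at most \<open>\<epsilon> * x\<close> changes the argument by a factor at
  most \<open>exp \<delta>\<close> in either direction. This additive form fits a window that is
  displaced by the remaining steps.\<close>

lemma intermediate_regularly_varying_uniform:
  assumes irv: "intermediate_regularly_varying f" and \<eta>: "0 < \<eta>"
  obtains \<epsilon> X where "0 < \<epsilon>" "\<epsilon> < 1" "0 < X" "\<And>x. X \<le> x \<Longrightarrow> 0 < f x"
    "\<And>x z. X \<le> x \<Longrightarrow> \<bar>z\<bar> \<le> \<epsilon> * x \<Longrightarrow> (1 - \<eta>) * f x \<le> f (x - z) \<and> f (x - z) \<le> (1 + \<eta>) * f x"
proof -
  define \<kappa> where "\<kappa> = ln (1 + \<eta>) / 2"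
  have \<kappa>: "0 < \<kappa>" "exp (2 * \<kappa>) = 1 + \<eta>" using \<eta> by (simp_all add: \<kappa>_def)
  obtain \<delta> X where \<delta>: "0 < \<delta>" and X: "0 < X" "\<And>x. X \<le> x \<Longrightarrow> 0 < f x"
    and scale: "\<And>x y. X \<le> x \<Longrightarrow> 1 \<le> y \<Longrightarrow> y \<le> exp \<delta> \<Longrightarrow>
      exp (- 2 * \<kappa>) * f x \<le> f (x * y) \<and> f (x * y) \<le> exp (2 * \<kappa>) * f x"
    using intermediate_regularly_varying_uniform_scaling[OF irv \<kappa>(1)] by blast
  have "exp (- 2 * \<kappa>) = 1 / (1 + \<eta>)" using \<kappa> by (simp add: exp_minus inverse_eq_divide)
  moreover have "(1 - \<eta>) * (1 + \<eta>) \<le> 1" by (simp add: algebra_simps)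
  ultimately have lower: "1 - \<eta> \<le> exp (- 2 * \<kappa>)" using \<eta> by (simp only: pos_le_divide_eq)
  define \<epsilon> where "\<epsilon> = 1 - exp (- \<delta>)"
  have \<epsilon>: "0 < \<epsilon>" "\<epsilon> < 1" using \<delta> by (simp_all add: \<epsilon>_def)
  have "1 + \<delta> \<le> exp \<delta>" "1 - \<delta> \<le> exp (- \<delta>)"
    using exp_ge_add_one_self[of \<delta>] exp_ge_add_one_self[of "- \<delta>"] by simp_all
  then have \<epsilon>_exp: "1 + \<epsilon> \<le> exp \<delta>" unfolding \<epsilon>_def by linarith
  show ?thesis
  proof (rule that[of \<epsilon> "X * exp \<delta>"])
    have ge: "X \<le> x" "X \<le> x * exp (- \<delta>)" if "X * exp \<delta> \<le> x" for x
    proof -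
      show *: "X \<le> x * exp (- \<delta>)" using that by (simp add: exp_minus field_simps)
      have "X * 1 \<le> X * exp \<delta>" using X \<delta> by (intro mult_left_mono) auto
      then show "X \<le> x" using that by simp
    qed
    show "0 < f x" if "X * exp \<delta> \<le> x" for x using X ge that by blast
    fix x z assume x: "X * exp \<delta> \<le> x" and z: "\<bar>z\<bar> \<le> \<epsilon> * x"
    have x': "X \<le> x" "0 < x" "0 < f x" using ge[OF x] X less_le_trans[of 0 X x] by auto
    have "exp (- 2 * \<kappa>) * f x \<le> f (x - z) \<and> f (x - z) \<le> exp (2 * \<kappa>) * f x"
    proof (cases "z \<le> 0")
      case True
      have "(x - z) / x \<le> 1 + \<epsilon>" using x' z True by (simp add: field_simps)
      then have "(x - z) / x \<le> exp \<delta>" using \<epsilon>_exp by linarith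
      then have "exp (- 2 * \<kappa>) * f x \<le> f (x * ((x - z) / x)) \<and> f (x * ((x - z) / x)) \<le> exp (2 * \<kappa>) * f x"
        using x' True by (intro scale) (auto simp: le_divide_eq)
      then show ?thesis using x' by simp
    next
      case False
      \<comment> \<open>The scaling estimate moves only upwards, so for positive \<open>z\<close> it
        is applied from \<open>x - z\<close> to \<open>x\<close> and then inverted. The threshold
        \<open>X * exp \<delta>\<close> keeps \<open>x - z\<close> above \<open>X\<close>.\<close>
      have "x * exp (- \<delta>) \<le> x - z" using z False by (simp add: \<epsilon>_def algebra_simps)
      then have w: "X \<le> x - z" "0 < x - z"
        using ge(2)[OF x] X by linarith+
      have "x * exp (- \<delta>) * exp \<delta> \<le> (x - z) * exp \<delta>"
        using \<open>x * exp (- \<delta>) \<le> x - z\<close> by (intro mult_right_mono) auto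
      then have "x \<le> (x - z) * exp \<delta>"
        by (simp add: mult.assoc flip: exp_add)
      then have "x / (x - z) \<le> exp \<delta>"
        using w by (simp add: pos_divide_le_eq mult.commute)
      note w = w this
      then have "exp (- 2 * \<kappa>) * f (x - z) \<le> f ((x - z) * (x / (x - z))) \<and>
          f ((x - z) * (x / (x - z))) \<le> exp (2 * \<kappa>) * f (x - z)"
        using False w by (intro scale) (auto simp: le_divide_eq)
      then have "exp (- 2 * \<kappa>) * f (x - z) \<le> f x" "f x \<le> exp (2 * \<kappa>) * f (x - z)"
        using w by auto
      then show ?thesis using \<eta> unfolding \<kappa>(2) mult_minus_left exp_minus
        by (simp add: field_simps)
    qed
    moreover have "(1 - \<eta>) * f x \<le> exp (- 2 * \<kappa>) * f x"
      using lower x' by (intro mult_right_mono) auto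
    ultimately show "(1 - \<eta>) * f x \<le> f (x - z) \<and> f (x - z) \<le> (1 + \<eta>) * f x"
      using \<kappa> by auto
  qed (use \<epsilon> X in auto)
qed

text \<open>By the uniform estimate with tolerance 1, shrinking the argument by a factor in
  \<open>[r, 1]\<close> at most doubles \<open>f\<close>; if \<open>r ^ k < \<delta>\<close>, then
  \<open>k\<close> such shrinkages reach \<open>\<delta> * x\<close> at the cost of
  \<open>2 ^ k\<close>.\<close>

lemma intermediate_regularly_varying_shrink:
  assumes irv: "intermediate_regularly_varying f" and \<delta>: "0 < \<delta>" "\<delta> \<le> 1"
  obtains C X where "0 < C" "0 < X" "\<And>x. X \<le> x \<Longrightarrow> f (\<delta> * x) \<le> C * f x"
proof -
  obtain \<epsilon> X where \<epsilon>: "0 < \<epsilon>" "\<epsilon> < 1" and X: "0 < X" "\<And>x. X \<le> x \<Longrightarrow> 0 < f x"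
    and unif: "\<And>x z. X \<le> x \<Longrightarrow> \<bar>z\<bar> \<le> \<epsilon> * x \<Longrightarrow> (1 - 1) * f x \<le> f (x - z) \<and> f (x - z) \<le> (1 + 1) * f x"
    using intermediate_regularly_varying_uniform[OF irv, of 1] by auto
  define r where "r = 1 - \<epsilon>"
  have r: "0 < r" "r < 1" using \<epsilon> by (auto simp: r_def)
  have iter: "f (y * x) \<le> 2 ^ k * f x" if "X / r ^ k \<le> x" "r ^ k \<le> y" "y \<le> 1" for k x y
    using that
  proof (induction k arbitrary: x y)
    case (Suc k)
    \<comment> \<open>One admissible shrinkage is split off: by \<open>y\<close> itself if it is at
      least \<open>r\<close>, by \<open>r\<close> otherwise. The remaining factor
      \<open>y / y1\<close> is then at least \<open>r ^ k\<close>.\<close>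
    define y1 where "y1 = max y r"
    have y: "0 < y" using Suc.prems r by (auto intro: less_le_trans[of 0 "r ^ Suc k" y])
    have y1: "0 < y1" "r \<le> y1" "y1 \<le> 1" "y \<le> y1" using y r Suc.prems by (auto simp: y1_def)
    have "r ^ k \<le> y / y1"
    proof (cases "y \<le> r")
      case True
      then show ?thesis using r Suc.prems by (simp add: y1_def max_def field_simps split: if_splits)
    next
      case False
      then show ?thesis using y r by (simp add: y1_def max_def power_le_one)
    qed
    have "0 < X / r ^ Suc k" using X r by simp
    then have x: "0 < x" using Suc.prems(1) by linarith
    have "X / r ^ k \<le> r * x" using Suc.prems(1) r by (simp add: field_simps)
    also have "\<dots> \<le> y1 * x" using y1 x by (intro mult_right_mono) auto
    finally have "f (y / y1 * (y1 * x)) \<le> 2 ^ k * f (y1 * x)"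
      using \<open>r ^ k \<le> y / y1\<close> y1 by (intro Suc.IH) auto
    moreover have "f (y1 * x) \<le> 2 * f x"
    proof -
      have "X * r ^ Suc k \<le> X * 1" using X r by (intro mult_left_mono power_le_one) auto
      then have "X \<le> X / r ^ Suc k" using X r by (simp add: field_simps)
      then have "X \<le> x" using Suc.prems(1) by linarith
      moreover have "\<bar>(1 - y1) * x\<bar> \<le> \<epsilon> * x"
        using y1 x by (auto simp: abs_mult r_def intro!: mult_right_mono)
      ultimately show ?thesis using unif[of x "(1 - y1) * x"] by (simp add: algebra_simps)
    qed
    ultimately have "f (y / y1 * (y1 * x)) \<le> 2 ^ k * (2 * f x)"
      by (meson mult_left_mono order_trans zero_le_numeral zero_le_power)
    then show ?case using y1 by simp
  qed simp
  obtain k where k: "r ^ k < \<delta>" using real_arch_pow_inv[OF \<delta>(1) r(2)] by auto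
  show ?thesis
    by (rule that[of "2 ^ k" "X / r ^ k"]) (use X r k \<delta> in \<open>auto intro: iter\<close>)
qed

text \<open>An exponent \<open>\<alpha> < -1\<close> gives
  \<open>Y * f (Y * x) \<le> D * Y powr (\<alpha> + 1) * f x\<close>, and a large \<open>Y\<close>
  makes the factor at most \<open>1 / 2\<close>. Thus \<open>Y ^ k * f (Y ^ k * x)\<close> decreases
  geometrically in \<open>k\<close>, and interpolation between these points yields the almost
  monotonicity with constant \<open>B\<close>.\<close>

lemma upper_Matuszewska_index_less_minus_one:
  assumes pos: "\<And>x. x0 \<le> x \<Longrightarrow> 0 < f x" and index: "upper_Matuszewska_index f < -1"
  obtains B X Y where "0 < B" "0 < X" "1 < Y"
    "\<And>x w. X \<le> x \<Longrightarrow> x \<le> w \<Longrightarrow> f w \<le> B * f x"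
    "\<And>x. X \<le> x \<Longrightarrow> Y * f (Y * x) \<le> f x / 2"
proof -
  obtain \<alpha> C where \<alpha>: "\<alpha> < -1" and C: "\<forall>Y>1. \<exists>\<epsilon>. (\<epsilon> \<longlongrightarrow> 0) at_top \<and>
            (\<forall>\<^sub>F x in at_top. \<forall>y\<in>{1..Y}. f (x * y) / f x \<le> C * (1 + \<epsilon> x) * y powr \<alpha>)"
    using index unfolding upper_Matuszewska_index_def Inf_less_iff
    by (auto simp: one_ereal_def uminus_ereal.simps simp del: ereal_uminus_eq_reorder)
  \<comment> \<open>The 2 absorbs \<open>1 + \<epsilon> x\<close>, the maximum covers a nonpositive
    \<open>C\<close>. Choosing \<open>Y\<close> after \<open>D\<close> is legitimate because one
    \<open>C\<close> serves every \<open>Y\<close>.\<close>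
  define D where "D = 2 * max C 1"
  have D: "0 < D" by (simp add: D_def)
  have "((\<lambda>Y. D * Y powr (\<alpha> + 1)) \<longlongrightarrow> D * 0) at_top"
    using \<alpha> by (intro tendsto_intros tendsto_neg_powr filterlim_ident) auto
  then have "\<forall>\<^sub>F Y in at_top. D * Y powr (\<alpha> + 1) < 1 / 2"
    by (intro order_tendstoD(2)[of _ "D * 0"]) auto
  then have "\<forall>\<^sub>F Y in at_top. 1 < Y \<and> D * Y powr (\<alpha> + 1) < 1 / 2"
    using eventually_gt_at_top[of 1] by eventually_elim auto
  then obtain Y where Y: "1 < Y" "D * Y powr (\<alpha> + 1) < 1 / 2"
    using eventually_happens'[OF trivial_limit_at_top_linorder] by blast
  obtain \<epsilon> where \<epsilon>: "(\<epsilon> \<longlongrightarrow> 0) at_top"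
    "\<forall>\<^sub>F x in at_top. \<forall>y\<in>{1..Y}. f (x * y) / f x \<le> C * (1 + \<epsilon> x) * y powr \<alpha>"
    using C Y by blast
  have "\<forall>\<^sub>F x in at_top. \<bar>\<epsilon> x\<bar> < 1"
    using tendstoD[OF \<epsilon>(1), of 1] by (simp add: dist_real_def)
  then have "\<forall>\<^sub>F x in at_top. \<bar>\<epsilon> x\<bar> < 1 \<and> (\<forall>y\<in>{1..Y}. f (x * y) / f x \<le> C * (1 + \<epsilon> x) * y powr \<alpha>)"
    using \<epsilon>(2) by eventually_elim auto
  then obtain X1 where X1: "\<And>x. X1 \<le> x \<Longrightarrow> \<bar>\<epsilon> x\<bar> < 1"
    "\<And>x y. X1 \<le> x \<Longrightarrow> y \<in> {1..Y} \<Longrightarrow> f (x * y) / f x \<le> C * (1 + \<epsilon> x) * y powr \<alpha>"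
    unfolding eventually_at_top_linorder by blast
  define X where "X = max (max X1 x0) 1"
  have step: "f (x * y) \<le> D * y powr \<alpha> * f x" if x: "X \<le> x" and y: "1 \<le> y" "y \<le> Y" for x y
  proof -
    have x': "X1 \<le> x" "x0 \<le> x" using x by (auto simp: X_def)
    have "C * (1 + \<epsilon> x) \<le> max C 1 * (1 + \<epsilon> x)"
      using X1(1)[OF x'(1)] by (intro mult_right_mono) auto
    also have "\<dots> \<le> max C 1 * 2"
      using X1(1)[OF x'(1)] by (intro mult_left_mono) auto
    finally have "C * (1 + \<epsilon> x) * y powr \<alpha> \<le> D * y powr \<alpha>"
      by (intro mult_right_mono) (auto simp: D_def)
    then have "f (x * y) / f x \<le> D * y powr \<alpha>"
      using y by (intro order_trans[OF X1(2)[OF x'(1), of y]]) auto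
    then show ?thesis using pos[OF x'(2)] by (simp add: field_simps)
  qed
  have X: "0 < X" by (simp add: X_def)
  have fpos: "0 < f x" if "X \<le> x" for x using that by (intro pos) (auto simp: X_def)
  have halve: "Y * f (Y * x) \<le> f x / 2" if "X \<le> x" for x
  proof -
    have "Y * f (x * Y) \<le> Y * (D * Y powr \<alpha> * f x)"
      using step[OF that, of Y] Y by (intro mult_left_mono) auto
    also have "\<dots> = D * Y powr (\<alpha> + 1) * f x"
      using Y by (simp add: powr_add)
    also have "\<dots> \<le> 1 / 2 * f x"
      using Y fpos[OF that] by (intro mult_right_mono) auto
    finally show ?thesis by (simp add: mult.commute)
  qed
  have iter: "f (Y ^ k * x) \<le> f x \<and> X \<le> Y ^ k * x" if "X \<le> x" for k x
  proof (induction k)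
    case (Suc k)
    have "Y * f (Y * (Y ^ k * x)) \<le> f (Y ^ k * x) / 2" using Suc by (intro halve) auto
    also have "\<dots> \<le> f (Y ^ k * x)" using Suc fpos[of "Y ^ k * x"] by auto
    also have "\<dots> \<le> f x" using Suc by simp
    finally have *: "Y * f (Y * (Y ^ k * x)) \<le> f x" .
    have "1 * X \<le> Y * (Y ^ k * x)" using Suc Y X by (intro mult_mono) auto
    then have ge: "X \<le> Y ^ Suc k * x" by (simp add: mult.assoc)
    have "1 * f (Y ^ Suc k * x) \<le> Y * f (Y ^ Suc k * x)"
      using Y fpos[OF ge] by (intro mult_right_mono) auto
    then show ?case using * ge by (simp add: mult.assoc)
  qed (use that in simp)
  have bound: "f w \<le> D * f x" if x: "X \<le> x" and w: "x \<le> w" for x w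
  proof -
    have x': "0 < x" using x X by simp
    define k where "k = nat \<lfloor>log Y (w / x)\<rfloor>"
    have "0 \<le> log Y (w / x)" using Y x' w by simp
    then have k: "real k \<le> log Y (w / x)" "log Y (w / x) \<le> real k + 1"
      unfolding k_def by linarith+
    have "Y powr real k \<le> w / x" "w / x \<le> Y powr (real k + 1)"
      using k Y x' w by (simp_all add: le_log_iff log_le_iff)
    then have s: "1 \<le> w / (Y ^ k * x)" "w / (Y ^ k * x) \<le> Y"
      using Y x' by (simp_all add: powr_add powr_realpow field_simps)
    have "f (Y ^ k * x * (w / (Y ^ k * x))) \<le> D * (w / (Y ^ k * x)) powr \<alpha> * f (Y ^ k * x)"
      using iter[OF x, of k] s by (intro step) auto
    also have "\<dots> \<le> D * 1 * f (Y ^ k * x)"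
      using s \<alpha> D fpos[of "Y ^ k * x"] iter[OF x, of k] powr_mono[of \<alpha> 0 "w / (Y ^ k * x)"] x' w
      by (intro mult_right_mono mult_left_mono) auto
    also have "\<dots> \<le> D * 1 * f x" using D iter[OF x, of k] by (intro mult_left_mono) auto
    finally show ?thesis using Y x' by simp
  qed
  show ?thesis by (rule that[of D X Y]) (use D X Y halve bound in auto)
qed

section \<open>Concentration of sums\<close>

lemma one_minus_cos_ge:
  fixes u :: real
  assumes "\<bar>u\<bar> \<le> 1"
  shows "u\<^sup>2 / 4 \<le> 1 - cos u"
proof -
  have *: "u\<^sup>2 / 4 \<le> 1 - cos u" if u: "0 \<le> u" "u \<le> 1" for u :: real
  proof -
    \<comment> \<open>\<open>[0, 1]\<close> lies in \<open>[0, pi / 3]\<close>, where the cosine is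
      at least \<open>1 / 2\<close>; integrating twice from 0 gives \<open>sin v \<ge> v / 2\<close>
      and then the claim.\<close>
    have cos: "1 \<le> cos v * 2" if "0 \<le> v" "v \<le> 1" for v :: real
      using that pi_gt3 cos_monotone_0_pi_le[of v "pi / 3"] by (simp add: cos_60)
    have sin: "v \<le> sin v * 2" if v: "0 \<le> v" "v \<le> 1" for v :: real
    proof -
      have "sin 0 - 0 / 2 \<le> sin v - v / 2"
        using v by (intro DERIV_nonneg_imp_nondecreasing[of 0 v "\<lambda>v. sin v - v / 2"])
          (auto intro!: exI[of _ "cos _ - 1 / 2"] derivative_eq_intros simp: cos)
      then show ?thesis by simp
    qed
    have "1 - cos 0 - 0\<^sup>2 / 4 \<le> 1 - cos u - u\<^sup>2 / 4"
      using u by (intro DERIV_nonneg_imp_nondecreasing[of 0 u "\<lambda>u. 1 - cos u - u\<^sup>2 / 4"])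
        (auto intro!: exI[of _ "sin _ - _ / 2"] derivative_eq_intros sin)
    then show ?thesis by simp
  qed
  show ?thesis using *[of "\<bar>u\<bar>"] assms by (cases "0 \<le> u") auto
qed

lemma power_le_exp:
  fixes u :: real
  assumes "0 \<le> u" "0 < k"
  shows "(u / real k) ^ k \<le> exp u"
proof -
  have "u / real k \<le> exp (u / real k)" using exp_ge_add_one_self[of "u / real k"] by linarith
  then have "(u / real k) ^ k \<le> exp (u / real k) ^ k" using assms by (intro power_mono) auto
  also have "\<dots> = exp u" using assms by (simp flip: exp_of_nat_mult)
  finally show ?thesis .
qed

text \<open>The exponential dominates the power of order \<open>k\<close> of
  \<open>s powr \<gamma>\<close>, and \<open>\<gamma> * k \<ge> 2\<close>. The shape
  \<open>1 / (1 + s\<^sup>2)\<close> is convenient because its primitive is the arctangent.\<close>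

lemma exp_powr_decay:
  fixes c \<gamma> :: real
  assumes "0 < c" "0 < \<gamma>"
  obtains B where "0 < B" "\<And>s. 1 \<le> s \<Longrightarrow> exp (- c * s powr \<gamma>) \<le> B / (1 + s\<^sup>2)"
proof -
  define k where "k = Suc (nat \<lceil>2 / \<gamma>\<rceil>)"
  have k: "0 < k" "2 / \<gamma> \<le> real k" unfolding k_def by (auto, linarith)
  show ?thesis
  proof (rule that[of "2 * (real k / c) ^ k"])
    fix s :: real assume s: "1 \<le> s"
    have "s\<^sup>2 \<le> s powr (\<gamma> * real k)"
    proof -
      have "s powr 2 \<le> s powr (\<gamma> * real k)"
        using s k assms by (intro powr_mono) (auto simp: field_simps)
      then show ?thesis using s by (simp add: powr_numeral)
    qed
    also have "s powr (\<gamma> * real k) = (s powr \<gamma>) ^ k"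
      using s by (simp add: powr_powr flip: powr_realpow)
    finally have "(c / real k) ^ k * s\<^sup>2 \<le> (c / real k) ^ k * (s powr \<gamma>) ^ k"
      using assms k by (intro mult_left_mono) auto
    also have "\<dots> = (c * s powr \<gamma> / real k) ^ k"
      by (simp add: power_mult_distrib power_divide)
    also have "\<dots> \<le> exp (c * s powr \<gamma>)"
      using assms k by (intro power_le_exp) auto
    finally have "(c / real k) ^ k * s\<^sup>2 \<le> exp (c * s powr \<gamma>)" .
    moreover have "(c / real k) ^ k * (1 + s\<^sup>2) \<le> (c / real k) ^ k * (2 * s\<^sup>2)"
      using one_le_power[OF s, of 2] assms k by (intro mult_left_mono) auto
    ultimately have "(c / real k) ^ k * (1 + s\<^sup>2) \<le> 2 * exp (c * s powr \<gamma>)" by linarith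
    then have "(c / real k) ^ k * (1 + s\<^sup>2) * exp (- c * s powr \<gamma>)
        \<le> 2 * exp (c * s powr \<gamma>) * exp (- c * s powr \<gamma>)"
      by (intro mult_right_mono) auto
    then have "(c / real k) ^ k * (1 + s\<^sup>2) * exp (- c * s powr \<gamma>) \<le> 2"
      by (simp add: mult.assoc flip: exp_add)
    moreover have "0 < (c / real k) ^ k" "0 < 1 + s\<^sup>2"
      using assms k by (auto intro: add_pos_nonneg)
    ultimately have "exp (- c * s powr \<gamma>) \<le> 2 / ((c / real k) ^ k * (1 + s\<^sup>2))"
      by (simp add: pos_le_divide_eq mult.commute)
    also have "\<dots> = 2 * (real k / c) ^ k / (1 + s\<^sup>2)"
      by (simp add: power_divide)
    finally show "exp (- c * s powr \<gamma>) \<le> 2 * (real k / c) ^ k / (1 + s\<^sup>2)" .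
  qed (use assms k in auto)
qed

text \<open>A multiple of the Fejer kernel, as an average of cosines with compactly supported frequencies.\<close>

definition fejer_kernel :: "real \<Rightarrow> real" where
  "fejer_kernel v = (\<integral>s. ((1 - s) * cos (s * v)) * indicator {0..1} s \<partial>lborel)"

lemma fejer_kernel_eq: "v \<noteq> 0 \<Longrightarrow> fejer_kernel v = (1 - cos v) / v\<^sup>2"
  unfolding fejer_kernel_def
  by (subst integral_FTC_Icc_real[where F = "\<lambda>s. (1 - s) * sin (s * v) / v - cos (s * v) / v\<^sup>2"])
     (auto intro!: derivative_eq_intros continuous_intros simp: field_simps power2_eq_square)

lemma fejer_kernel_0: "fejer_kernel 0 = 1 / 2"
  unfolding fejer_kernel_def
  by (subst integral_FTC_Icc_real[where F = "\<lambda>s. s - s\<^sup>2 / 2"])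
     (auto intro!: derivative_eq_intros continuous_intros simp: field_simps)

lemma fejer_kernel_nonneg: "0 \<le> fejer_kernel v"
  by (cases "v = 0") (auto simp: fejer_kernel_eq fejer_kernel_0)

lemma fejer_kernel_ge:
  assumes "\<bar>v\<bar> \<le> 1"
  shows "1 / 4 \<le> fejer_kernel v"
  using one_minus_cos_ge[OF assms]
  by (cases "v = 0") (auto simp: fejer_kernel_eq fejer_kernel_0 field_simps)

lemma fejer_kernel_integrand_bound:
  fixes s v :: real
  shows "\<bar>(1 - s) * cos (s * v) * indicator {0..1} s\<bar> \<le> indicator {0..1} s"
proof -
  have "\<bar>(1 - s) * cos (s * v)\<bar> \<le> 1 * 1" if "s \<in> {0..1}"
    unfolding abs_mult using that by (intro mult_mono) auto
  then show ?thesis by (auto simp: indicator_def)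
qed

section \<open>Concentration in terms of the characteristic function\<close>

context real_distribution
begin

lemma integral_cos_le_norm_char: "(LINT y|M. cos (t * (y - w))) \<le> norm (char M t)"
proof -
  have "(LINT y|M. cos (t * (y - w))) = (LINT y|M. Re (iexp (- t * w) * iexp (t * y)))"
    by (simp add: cis_conv_exp[symmetric] cis_mult exp_eq_polar algebra_simps)
  also have "\<dots> = Re (LINT y|M. iexp (- t * w) * iexp (t * y))"
    by (intro integral_Re integrable_mult_right integrable_iexp) auto
  also have "(LINT y|M. iexp (- t * w) * iexp (t * y)) = iexp (- t * w) * char M t"
    unfolding char_def by (rule integral_mult_right_zero)
  also have "Re (iexp (- t * w) * char M t) \<le> norm (iexp (- t * w) * char M t)"
    by (rule complex_Re_le_cmod)
  also have "\<dots> = norm (char M t)"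
    by (simp add: norm_mult)
  finally show ?thesis .
qed

text \<open>A form of Esseen's inequality: four times the kernel is nonnegative and at least 1 on
  \<open>[-1, 1]\<close>, and it averages cosines with frequencies in \<open>[0, 1]\<close>, so that
  Fubini's theorem turns its mean into an integral over low frequencies.\<close>

lemma concentration_le_char:
  assumes \<tau>: "0 < \<tau>"
  shows "prob {y. \<bar>y - w\<bar> \<le> 1 / \<tau>} \<le> 4 * (\<integral>s. norm (char M (s * \<tau>)) * indicator {0..1} s \<partial>lborel)"
proof -
  interpret P: pair_sigma_finite M lborel
    by (intro pair_sigma_finite.intro sigma_finite_measure_axioms lborel.sigma_finite_measure_axioms)
  let ?f = "\<lambda>y s. ((1 - s) * cos (s * (\<tau> * (y - w)))) * indicator {0..1::real} s"
  have ind_int: "integrable lborel (indicat_real {0..1::real})"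
    by (rule integrable_real_indicator) auto
  have f_int: "integrable lborel (?f y)" for y
    by (rule Bochner_Integration.integrable_bound[OF ind_int])
       (auto simp: fejer_kernel_integrand_bound[simplified] intro!: AE_I2 fejer_kernel_integrand_bound)
  have int: "integrable (M \<Otimes>\<^sub>M lborel) (\<lambda>(y, s). ?f y s)"
  proof (rule P.Fubini_integrable)
    show "integrable M (\<lambda>y. LINT s|lborel. norm (case (y, s) of (y, s) \<Rightarrow> ?f y s))"
    proof (rule integrable_const_bound[where B = 1])
      have "(LINT s|lborel. \<bar>?f y s\<bar>) \<le> 1" for y
        using integral_mono[OF integrable_abs[OF f_int[of y]] ind_int fejer_kernel_integrand_bound]
        by simp
      then show "AE y in M. norm (LINT s|lborel. norm (case (y, s) of (y, s) \<Rightarrow> ?f y s)) \<le> 1"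
        by (simp add: abs_of_nonneg)
    qed measurable
  qed (use f_int in auto)
  have k_int: "integrable M (\<lambda>y. fejer_kernel (\<tau> * (y - w)))"
    using P.integrable_fst'[OF int] by (simp add: fejer_kernel_def)
  have "prob {y. \<bar>y - w\<bar> \<le> 1 / \<tau>} = (LINT y|M. indicator {y. \<bar>y - w\<bar> \<le> 1 / \<tau>} y)"
    by simp
  also have "\<dots> \<le> (LINT y|M. 4 * fejer_kernel (\<tau> * (y - w)))"
  proof (rule integral_mono)
    show "integrable M (indicat_real {y. \<bar>y - w\<bar> \<le> 1 / \<tau>})"
      by (rule integrable_const_bound[where B = 1]) auto
    fix y
    show "indicator {y. \<bar>y - w\<bar> \<le> 1 / \<tau>} y \<le> 4 * fejer_kernel (\<tau> * (y - w))"
    proof (cases "\<bar>y - w\<bar> \<le> 1 / \<tau>")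
      case True
      then have "\<tau> * \<bar>y - w\<bar> \<le> 1" using \<tau> by (simp add: field_simps)
      then have "\<bar>\<tau> * (y - w)\<bar> \<le> 1" using \<tau> by (simp add: abs_mult)
      then show ?thesis using fejer_kernel_ge True by fastforce
    qed (simp add: fejer_kernel_nonneg)
  qed (use k_int in simp)
  also have "\<dots> = 4 * (LINT y|M. LINT s|lborel. ?f y s)"
    by (simp add: fejer_kernel_def)
  also have "(LINT y|M. LINT s|lborel. ?f y s) = (LINT s|lborel. LINT y|M. ?f y s)"
    using P.Fubini_integral[of ?f] int by simp
  also have "\<dots> \<le> (\<integral>s. norm (char M (s * \<tau>)) * indicator {0..1} s \<partial>lborel)"
  proof (rule integral_mono)
    show "integrable lborel (\<lambda>s. LINT y|M. ?f y s)"
      using P.integrable_snd[of ?f] int by simp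
    show "integrable lborel (\<lambda>s. norm (char M (s * \<tau>)) * indicator {0..1} s)"
      by (rule Bochner_Integration.integrable_bound[OF ind_int])
         (auto intro!: AE_I2 simp: indicator_def cmod_char_le_1)
    fix s :: real
    show "(LINT y|M. ?f y s) \<le> norm (char M (s * \<tau>)) * indicator {0..1} s"
    proof (cases "s \<in> {0..1}")
      case True
      have "(LINT y|M. ?f y s) = (1 - s) * (LINT y|M. cos (s * \<tau> * (y - w)))"
        using True by (simp add: mult.assoc)
      also have "\<dots> \<le> (1 - s) * norm (char M (s * \<tau>))"
        using True by (intro mult_left_mono integral_cos_le_norm_char) auto
      also have "\<dots> \<le> 1 * norm (char M (s * \<tau>))"
        using True by (intro mult_right_mono) auto
      finally show ?thesis using True by simp
    qed simp
  qed
  finally show ?thesis by simp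
qed

text \<open>Symmetrisation: the squared modulus is the characteristic function of the difference of
  two independent copies. The iterated integral allows one of the copies to be held fixed.\<close>

lemma norm_char_squared:
  "(norm (char M t))\<^sup>2 = (LINT v|M. LINT x|M. cos (t * (x - v)))"
proof -
  let ?C = "LINT x|M. cos (t * x)" and ?S = "LINT x|M. sin (t * x)"
  have int: "integrable M (\<lambda>x. cos (t * x))" "integrable M (\<lambda>x. sin (t * x))"
    by (auto intro!: integrable_const_bound[where B = 1])
  have "char M t = Complex ?C ?S"
  proof (rule complex_eqI)
    show "Re (char M t) = Re (Complex ?C ?S)"
      unfolding char_def by (subst integral_Re[symmetric]) (auto simp: integrable_iexp Re_exp)
    show "Im (char M t) = Im (Complex ?C ?S)"
      unfolding char_def by (subst integral_Im[symmetric]) (auto simp: integrable_iexp Im_exp)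
  qed
  then have "(norm (char M t))\<^sup>2 = ?C\<^sup>2 + ?S\<^sup>2" by (simp add: cmod_power2)
  also have "\<dots> = (LINT v|M. cos (t * v) * ?C + sin (t * v) * ?S)"
    using int by (simp add: power2_eq_square)
  also have "\<dots> = (LINT v|M. LINT x|M. cos (t * (x - v)))"
    using int by (simp add: right_diff_distrib cos_diff mult.commute)
  finally show ?thesis .
qed

end

section \<open>Decay of powers of the characteristic function on the scale
  \<open>1 / a\<^sub>n\<close>\<close>

context balanced_tails
begin

text \<open>
  The squared modulus of the characteristic function is the mean over \<open>v\<close> of \<open>\<psi> v = E cos (t (\<xi> - v))\<close>.
  It suffices to bound \<open>1 - \<psi> v\<close> from below for \<open>v\<close> in a bounded set of probability at least \<open>1/2\<close>, where
  the shift by \<open>v\<close> is harmless because the truncated second moment is unbounded.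
\<close>

lemma norm_char_bound:
  obtains c t0 where "0 < c" "0 < t0"
    "\<And>t. 0 < \<bar>t\<bar> \<Longrightarrow> \<bar>t\<bar> \<le> t0 \<Longrightarrow> (norm (char F t))\<^sup>2 \<le> 1 - c * Q_fun F (1 / \<bar>t\<bar>)"
proof -
  have "\<forall>\<^sub>F x in at_top. Q_fun F x < 1 / 2"
    using order_tendstoD(2)[OF Q_fun_tendsto_0, of "1 / 2"] by simp
  then have "\<exists>m. Q_fun F m < 1 / 2"
    by (rule eventually_happens'[OF trivial_limit_at_top_linorder])
  then obtain m where m: "Q_fun F m < 1 / 2" by blast
  \<comment> \<open>The factor 2 ensures that, for \<open>y \<ge> x1\<close>, at most half of the
    truncated second moment at \<open>y\<close> stems from
    \<open>\<bar>x\<bar> \<le> 2 * m\<close>.\<close>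
  obtain x1 where x1: "x0 \<le> x1" "2 * trunc_second_moment F (2 * m) < trunc_second_moment F x1"
    using trunc_second_moment_unbounded by blast
  have x1_pos: "0 < x1" using x1 x0_pos by simp
  have K: "0 < K + 1" using K_ge_1 by simp
  have half: "1 / 2 \<le> prob {v. \<bar>v\<bar> \<le> m}"
  proof -
    have "abs_tail F m = 1 - prob {v. \<bar>v\<bar> \<le> m}"
      unfolding abs_tail_def
      by (subst prob_compl[symmetric]) (auto intro!: arg_cong[where f = prob])
    then show ?thesis using m abs_tail_le_Q_fun[of m] by linarith
  qed
  show ?thesis
  proof (rule that[of "1 / (256 * (K + 1))" "1 / (2 * x1)"])
    fix t :: real assume t: "0 < \<bar>t\<bar>" "\<bar>t\<bar> \<le> 1 / (2 * x1)"
    \<comment> \<open>For \<open>2 * m < \<bar>x\<bar> \<le> y\<close> and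
      \<open>\<bar>v\<bar> \<le> m\<close> the shift by \<open>v\<close> alters \<open>x\<close> by
      at most half its size, so \<open>\<bar>t * (x - v)\<bar> \<le> 3 / 4\<close> and the quadratic
      lower bound for \<open>1 - cos\<close> is available.\<close>
    define y where "y = 1 / (2 * \<bar>t\<bar>)"
    have y: "x1 \<le> y" "0 < y" using t x1 x1_pos by (auto simp: y_def field_simps)
    have y': "x0 \<le> y" using y x1 by linarith
    have "Q_fun F (1 / \<bar>t\<bar>) \<le> Q_fun F y"
      using t by (intro Q_fun_antimono) (auto simp: y_def field_simps)
    also have "\<dots> \<le> (K + 1) * (trunc_second_moment F y / y\<^sup>2)"
      by (rule Q_fun_le_second_moment[OF y'])
    also have "\<dots> = (K + 1) * 4 * (t\<^sup>2 * trunc_second_moment F y)"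
      using t by (simp add: y_def power_divide power_mult_distrib)
    finally have Q_le: "Q_fun F (1 / \<bar>t\<bar>) / (4 * (K + 1)) \<le> t\<^sup>2 * trunc_second_moment F y"
      using K by (simp add: field_simps)
    define \<psi> where "\<psi> v = (LINT x|F. cos (t * (x - v)))" for v
    have cos_int: "integrable F (\<lambda>x. cos (t * (x - v)))" for v
      by (rule integrable_const_bound[where B = 1]) auto
    have \<psi>_le_1: "\<psi> v \<le> 1" for v
      unfolding \<psi>_def using integral_mono[OF cos_int integrable_const, of v 1] prob_space by simp
    have \<psi>_meas [measurable]: "\<psi> \<in> borel_measurable borel"
      unfolding \<psi>_def by measurable
    have \<psi>_int: "integrable F \<psi>"
    proof (rule integrable_const_bound[where B = 1])
      have "\<bar>\<psi> v\<bar> \<le> 1" for v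
      proof -
        have "\<bar>\<psi> v\<bar> \<le> (LINT x|F. \<bar>cos (t * (x - v))\<bar>)"
          unfolding \<psi>_def by (rule integral_abs_bound)
        also have "\<dots> \<le> (LINT x|F. 1)"
          using cos_int by (intro integral_mono) auto
        finally show ?thesis using prob_space by simp
      qed
      then show "AE v in F. norm (\<psi> v) \<le> 1" by simp
    qed simp
    let ?q = "Q_fun F (1 / \<bar>t\<bar>) / (128 * (K + 1))"
    have lower: "?q \<le> 1 - \<psi> v" if v: "\<bar>v\<bar> \<le> m" for v
    proof -
      have "t\<^sup>2 / 16 * (trunc_second_moment F y - trunc_second_moment F (2 * m))
          = (LINT x|F. t\<^sup>2 / 16 * (indicator {x. \<bar>x\<bar> \<le> y} x * x\<^sup>2 - indicator {x. \<bar>x\<bar> \<le> 2 * m} x * x\<^sup>2))"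
        unfolding trunc_second_moment_eq
        by (simp add: integrable_trunc_square)
      also have "\<dots> \<le> (LINT x|F. 1 - cos (t * (x - v)))"
      proof (rule integral_mono)
        show "integrable F (\<lambda>x. 1 - cos (t * (x - v)))" using cos_int by simp
        show "integrable F (\<lambda>x. t\<^sup>2 / 16 * (indicator {x. \<bar>x\<bar> \<le> y} x * x\<^sup>2 - indicator {x. \<bar>x\<bar> \<le> 2 * m} x * x\<^sup>2))"
          by (intro integrable_mult_right Bochner_Integration.integrable_diff integrable_trunc_square)
        fix x
        show "t\<^sup>2 / 16 * (indicator {x. \<bar>x\<bar> \<le> y} x * x\<^sup>2 - indicator {x. \<bar>x\<bar> \<le> 2 * m} x * x\<^sup>2) \<le> 1 - cos (t * (x - v))"
        proof (cases "\<bar>x\<bar> \<le> y \<and> 2 * m < \<bar>x\<bar>")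
          case True
          have "\<bar>x - v\<bar> \<le> 3 / 2 * \<bar>x\<bar>" "\<bar>x\<bar> / 2 \<le> \<bar>x - v\<bar>" using True v by linarith+
          then have "\<bar>x - v\<bar> \<le> 3 / 2 * y" using True by linarith
          then have "\<bar>t\<bar> * \<bar>x - v\<bar> \<le> \<bar>t\<bar> * (3 / 2 * y)" by (intro mult_left_mono) auto
          also have "\<dots> \<le> 1" using t by (simp add: y_def)
          finally have "(t * (x - v))\<^sup>2 / 4 \<le> 1 - cos (t * (x - v))"
            by (intro one_minus_cos_ge) (simp add: abs_mult)
          moreover have "(\<bar>x\<bar> / 2)\<^sup>2 \<le> \<bar>x - v\<bar>\<^sup>2"
            using \<open>\<bar>x\<bar> / 2 \<le> \<bar>x - v\<bar>\<close> by (intro power_mono) auto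
          then have "t\<^sup>2 / 4 * (x\<^sup>2 / 4) \<le> t\<^sup>2 / 4 * (x - v)\<^sup>2"
            by (intro mult_left_mono) (auto simp: power_divide)
          ultimately show ?thesis using True by (simp add: power_mult_distrib)
        next
          case False
          then have "indicator {x. \<bar>x\<bar> \<le> y} x * x\<^sup>2 \<le> indicator {x. \<bar>x\<bar> \<le> 2 * m} x * x\<^sup>2"
            by (auto simp: indicator_def)
          then have "t\<^sup>2 / 16 * (indicator {x. \<bar>x\<bar> \<le> y} x * x\<^sup>2 - indicator {x. \<bar>x\<bar> \<le> 2 * m} x * x\<^sup>2) \<le> 0"
            by (intro mult_nonneg_nonpos) auto
          then show ?thesis using cos_le_one[of "t * (x - v)"] by linarith
        qed
      qed
      also have "\<dots> = 1 - \<psi> v"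
        using cos_int prob_space by (simp add: \<psi>_def)
      finally have 1: "t\<^sup>2 / 16 * (trunc_second_moment F y - trunc_second_moment F (2 * m)) \<le> 1 - \<psi> v" .
      have "trunc_second_moment F y / 2 \<le> trunc_second_moment F y - trunc_second_moment F (2 * m)"
        using x1 trunc_second_moment_mono[OF y(1)] by linarith
      then have "t\<^sup>2 / 16 * (trunc_second_moment F y / 2) \<le>
          t\<^sup>2 / 16 * (trunc_second_moment F y - trunc_second_moment F (2 * m))"
        by (intro mult_left_mono) auto
      moreover have "?q \<le> t\<^sup>2 / 16 * (trunc_second_moment F y / 2)"
        using divide_right_mono[OF Q_le, of 32] by simp
      ultimately show ?thesis using 1 by linarith
    qed
    have q_pos: "0 \<le> ?q" using K Q_fun_pos[of "1 / \<bar>t\<bar>"] by simp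
    have "?q / 2 \<le> ?q * prob {v. \<bar>v\<bar> \<le> m}"
      using mult_left_mono[OF half q_pos] by simp
    also have "\<dots> = (LINT v|F. ?q * indicator {v. \<bar>v\<bar> \<le> m} v)" by simp
    also have "\<dots> \<le> (LINT v|F. 1 - \<psi> v)"
    proof (rule integral_mono)
      show "integrable F (\<lambda>v. ?q * indicator {v. \<bar>v\<bar> \<le> m} v)"
        by (intro integrable_mult_right integrable_const_bound[where B = 1]) auto
      show "integrable F (\<lambda>v. 1 - \<psi> v)" using \<psi>_int by simp
      show "?q * indicator {v. \<bar>v\<bar> \<le> m} v \<le> 1 - \<psi> v" for v
        using lower[of v] \<psi>_le_1[of v] by (cases "\<bar>v\<bar> \<le> m") auto
    qed
    also have "\<dots> = 1 - (norm (char F t))\<^sup>2"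
      using \<psi>_int prob_space by (simp add: norm_char_squared \<psi>_def[symmetric])
    finally show "(norm (char F t))\<^sup>2 \<le> 1 - 1 / (256 * (K + 1)) * Q_fun F (1 / \<bar>t\<bar>)"
      by simp
  qed (use K x1_pos in auto)
qed

text \<open>For \<open>s = a * \<bar>t\<bar> \<ge> 1\<close>, the decay of \<open>Q\<close> from
  \<open>1 / \<bar>t\<bar>\<close> to \<open>a\<close> and \<open>n * Q a = 1\<close> give
  \<open>n * Q (1 / \<bar>t\<bar>) \<ge> s powr \<gamma> / \<theta>\<close>, so the power is at most
  \<open>exp (- d * s powr \<gamma>)\<close>. For \<open>s < 1\<close> the bound 1 suffices, whence
  \<open>max B 2\<close>. The condition \<open>n \<le> 3 * k\<close> prepares for using about half
  of the steps.\<close>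

lemma norm_char_power_bound:
  obtains B \<tau> where "0 < B" "0 < \<tau>"
    "\<And>n k a t. x0 \<le> a \<Longrightarrow> real n * Q_fun F a = 1 \<Longrightarrow> n \<le> 3 * k \<Longrightarrow> \<bar>t\<bar> \<le> \<tau>
      \<Longrightarrow> norm (char F t) ^ k \<le> B / (1 + (a * t)\<^sup>2)"
proof -
  obtain c t0 where c: "0 < c" and t0: "0 < t0" and
    char: "\<And>t. 0 < \<bar>t\<bar> \<Longrightarrow> \<bar>t\<bar> \<le> t0 \<Longrightarrow> (norm (char F t))\<^sup>2 \<le> 1 - c * Q_fun F (1 / \<bar>t\<bar>)"
    using norm_char_bound by blast
  obtain \<theta> \<gamma> where \<theta>: "0 < \<theta>" and \<gamma>: "0 < \<gamma>" and
    decay: "\<And>x y. x0 \<le> x \<Longrightarrow> x \<le> y \<Longrightarrow> Q_fun F y \<le> \<theta> * (x / y) powr \<gamma> * Q_fun F x"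
    using Q_fun_decay by blast
  \<comment> \<open>The 6 is 2, from taking the root of the bound on the squared modulus, times 3,
    from \<open>n \<le> 3 * k\<close>.\<close>
  define d where "d = c / (6 * \<theta>)"
  have d: "0 < d" using c \<theta> by (simp add: d_def)
  obtain B where B: "0 < B" "\<And>s. 1 \<le> s \<Longrightarrow> exp (- d * s powr \<gamma>) \<le> B / (1 + s\<^sup>2)"
    using exp_powr_decay[OF d \<gamma>] by blast
  show ?thesis
  proof (rule that[of "max B 2" "min t0 (1 / x0)"])
    fix n k :: nat and a t :: real
    assume a: "x0 \<le> a" "real n * Q_fun F a = 1" and n: "n \<le> 3 * k" and t: "\<bar>t\<bar> \<le> min t0 (1 / x0)"
    have a_pos: "0 < a" using a x0_pos by simp
    have den: "0 < 1 + (a * t)\<^sup>2" by (intro add_pos_nonneg) auto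
    show "norm (char F t) ^ k \<le> max B 2 / (1 + (a * t)\<^sup>2)"
    proof (cases "a * \<bar>t\<bar> < 1")
      case True
      then have "\<bar>a * t\<bar> \<le> 1" using a_pos by (simp add: abs_mult)
      then have "(a * t)\<^sup>2 \<le> 1" by (simp add: abs_square_le_1)
      then have "1 \<le> max B 2 / (1 + (a * t)\<^sup>2)" using den by (simp add: le_divide_eq)
      moreover have "norm (char F t) ^ k \<le> 1" by (intro power_le_one cmod_char_le_1) auto
      ultimately show ?thesis by linarith
    next
      case False
      then have t_pos: "0 < \<bar>t\<bar>" by (cases "t = 0") auto
      define z where "z = 1 / \<bar>t\<bar>"
      have z: "x0 \<le> z" "z \<le> a" using t t_pos False x0_pos by (auto simp: z_def field_simps)
      define s where "s = a * \<bar>t\<bar>"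
      have s: "1 \<le> s" "z / a = 1 / s" using False by (auto simp: s_def z_def)
      have "1 \<le> real n * (\<theta> * (z / a) powr \<gamma> * Q_fun F z)"
        using a(2) mult_left_mono[OF decay[OF z], of "real n"] by simp
      then have "s powr \<gamma> \<le> \<theta> * (real n * Q_fun F z)"
        using s by (simp add: powr_divide field_simps)
      also have "\<dots> \<le> \<theta> * (3 * real k * Q_fun F z)"
        using n \<theta> Q_fun_pos[of z] by (intro mult_left_mono mult_right_mono) auto
      finally have nQ: "s powr \<gamma> / (3 * \<theta>) \<le> real k * Q_fun F z"
        using \<theta> by (simp add: field_simps)
      have "(norm (char F t))\<^sup>2 \<le> 1 - c * Q_fun F z"
        unfolding z_def using t t_pos by (intro char) auto
      also have "\<dots> \<le> exp (- c * Q_fun F z)"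
        using exp_ge_add_one_self[of "- c * Q_fun F z"] by simp
      also have "\<dots> = (exp (- c * Q_fun F z / 2))\<^sup>2"
        by (simp add: power2_eq_square flip: exp_add)
      finally have "norm (char F t) \<le> exp (- c * Q_fun F z / 2)"
        by (rule power2_le_imp_le) simp
      then have "norm (char F t) ^ k \<le> exp (- c * Q_fun F z / 2) ^ k"
        by (intro power_mono) auto
      also have "\<dots> = exp (- c / 2 * (real k * Q_fun F z))"
        by (simp add: algebra_simps flip: exp_of_nat_mult)
      also have "\<dots> \<le> exp (- c / 2 * (s powr \<gamma> / (3 * \<theta>)))"
        using mult_left_mono_neg[OF nQ, of "- c / 2"] c by (subst exp_le_cancel_iff) simp
      also have "\<dots> = exp (- d * s powr \<gamma>)" by (simp add: d_def)
      also have "\<dots> \<le> B / (1 + s\<^sup>2)" by (rule B(2)[OF s(1)])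
      also have "\<dots> \<le> max B 2 / (1 + (a * t)\<^sup>2)"
        using den by (auto simp: s_def power_mult_distrib intro!: divide_right_mono)
      finally show ?thesis .
    qed
  qed (use B t0 x0_pos in auto)
qed

text \<open>Integrating \<open>B / (1 + (a * t)\<^sup>2)\<close> over low frequencies gives the
  order \<open>1 / a\<close>. \<open>H\<close> stands for the law of a sum of \<open>k\<close>
  steps, of which only the characteristic function matters; \<open>\<tau> \<le> 1 / T\<close> makes
  the window of radius \<open>T\<close> fit into the radius \<open>1 / \<tau>\<close>.\<close>

lemma concentration_bound:
  assumes T: "0 < T"
  obtains C where "0 < C"
    "\<And>H n k a w. real_distribution H \<Longrightarrow> (\<And>t. char H t = char F t ^ k) \<Longrightarrow> x0 \<le> a
      \<Longrightarrow> real n * Q_fun F a = 1 \<Longrightarrow> n \<le> 3 * k \<Longrightarrow> measure H {y. \<bar>y - w\<bar> \<le> T} \<le> C / a"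
proof -
  obtain B \<tau>0 where B: "0 < B" and \<tau>0: "0 < \<tau>0" and
    power: "\<And>n k a t. x0 \<le> a \<Longrightarrow> real n * Q_fun F a = 1 \<Longrightarrow> n \<le> 3 * k \<Longrightarrow> \<bar>t\<bar> \<le> \<tau>0
      \<Longrightarrow> norm (char F t) ^ k \<le> B / (1 + (a * t)\<^sup>2)"
    using norm_char_power_bound by blast
  define \<tau> where "\<tau> = min \<tau>0 (1 / T)"
  have \<tau>: "0 < \<tau>" "\<tau> \<le> \<tau>0" "T \<le> 1 / \<tau>" using \<tau>0 T by (auto simp: \<tau>_def field_simps min_def)
  show ?thesis
  proof (rule that[of "4 * B * pi / \<tau>"])
    fix H :: "real measure" and n k :: nat and a w :: real
    assume H: "real_distribution H" and char: "\<And>t. char H t = char F t ^ k"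
      and a: "x0 \<le> a" "real n * Q_fun F a = 1" "n \<le> 3 * k"
    interpret H: real_distribution H by (rule H)
    have a_pos: "0 < a" using a x0_pos by simp
    have den: "0 < 1 + (a * \<tau> * s)\<^sup>2" for s by (intro add_pos_nonneg) auto
    have "H.prob {y. \<bar>y - w\<bar> \<le> T} \<le> H.prob {y. \<bar>y - w\<bar> \<le> 1 / \<tau>}"
      using \<tau> by (intro H.finite_measure_mono) auto
    also have "\<dots> \<le> 4 * (\<integral>s. norm (char H (s * \<tau>)) * indicator {0..1} s \<partial>lborel)"
      by (rule H.concentration_le_char[OF \<tau>(1)])
    also have "(\<integral>s. norm (char H (s * \<tau>)) * indicator {0..1} s \<partial>lborel)
        \<le> (\<integral>s. B / (1 + (a * \<tau> * s)\<^sup>2) * indicator {0..1} s \<partial>lborel)"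
    proof (rule integral_mono)
      have ind_int: "integrable lborel (indicat_real {0..1::real})"
    by (rule integrable_real_indicator) auto
      show "integrable lborel (\<lambda>s. norm (char H (s * \<tau>)) * indicator {0..1} s)"
        by (rule Bochner_Integration.integrable_bound[OF ind_int])
           (auto intro!: AE_I2 simp: indicator_def H.cmod_char_le_1)
      show "integrable lborel (\<lambda>s. B / (1 + (a * \<tau> * s)\<^sup>2) * indicator {0..1} s)"
        using den by (intro borel_integrable_atLeastAtMost) (auto intro!: continuous_intros simp: less_imp_neq[symmetric])
      fix s :: real
      have "norm (char H (s * \<tau>)) \<le> B / (1 + (a * (s * \<tau>))\<^sup>2)" if "s \<in> {0..1}"
      proof -
        have "s * \<tau> \<le> 1 * \<tau>" using that \<tau> by (intro mult_right_mono) auto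
        then have "s * \<tau> \<le> \<tau>0" using \<tau> by linarith
        then show ?thesis
          unfolding char norm_power using that \<tau> by (intro power[OF a]) auto
      qed
      then show "norm (char H (s * \<tau>)) * indicator {0..1} s \<le> B / (1 + (a * \<tau> * s)\<^sup>2) * indicator {0..1} s"
        by (auto simp: indicator_def mult_ac)
    qed
    also have "(\<integral>s. B / (1 + (a * \<tau> * s)\<^sup>2) * indicator {0..1} s \<partial>lborel)
        = B / (a * \<tau>) * arctan (a * \<tau> * 1) - B / (a * \<tau>) * arctan (a * \<tau> * 0)"
    proof (rule integral_FTC_Icc_real)
      fix s :: real
      have b: "a * \<tau> \<noteq> 0" using a_pos \<tau> by simp
      have "((\<lambda>s. arctan (a * \<tau> * s)) has_real_derivative a * \<tau> / (1 + (a * \<tau> * s)\<^sup>2)) (at s)"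
        by (auto intro!: derivative_eq_intros simp: divide_inverse)
      from DERIV_cmult[OF this, of "B / (a * \<tau>)"] b
      show "((\<lambda>s. B / (a * \<tau>) * arctan (a * \<tau> * s)) has_real_derivative B / (1 + (a * \<tau> * s)\<^sup>2)) (at s)"
        by simp
      show "isCont (\<lambda>s. B / (1 + (a * \<tau> * s)\<^sup>2)) s"
        using den by (auto intro!: continuous_intros simp: less_imp_neq[symmetric])
    qed simp
    also have "\<dots> \<le> B / (a * \<tau>) * pi"
      using a_pos \<tau> B less_trans[OF arctan_ubound[of "a * \<tau>"] pi_half_less_two] pi_gt3
      by (auto intro!: mult_left_mono simp del: times_divide_eq_left)
    finally show "H.prob {y. \<bar>y - w\<bar> \<le> T} \<le> 4 * B * pi / \<tau> / a"
      by (simp add: field_simps)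
  qed (use B \<tau> in auto)
qed

end

section \<open>Truncated means and local probabilities\<close>

lemma mem_shifted_Delta: "w \<in> shifted_Delta T x \<longleftrightarrow> x < w \<and> ereal (w - x) \<le> T"
proof
  assume "x < w \<and> ereal (w - x) \<le> T"
  then have "w - x \<in> Delta T" "w = x + (w - x)" by (auto simp: Delta_def)
  then show "w \<in> shifted_Delta T x" unfolding shifted_Delta_def by blast
qed (auto simp: shifted_Delta_def Delta_def)

lemma shifted_Delta_infinity: "shifted_Delta \<infinity> x = {x<..}"
  by (auto simp: mem_shifted_Delta)

lemma shifted_Delta_ereal: "shifted_Delta (ereal t) x = {x<..x + t}"
  by (auto simp: mem_shifted_Delta)

lemma shifted_Delta_cut: "w \<in> shifted_Delta T x \<Longrightarrow> v < w \<Longrightarrow> w \<in> shifted_Delta T (max x v)"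
  by (auto simp: mem_shifted_Delta max_def intro: order_trans[of "ereal (w - v)" "ereal (w - x)"])

lemma add_mem_shifted_Delta: "w + z \<in> shifted_Delta T x \<longleftrightarrow> w \<in> shifted_Delta T (x - z)"
  by (simp add: mem_shifted_Delta diff_less_eq algebra_simps)

lemma shifted_Delta_sets [measurable]: "shifted_Delta T x \<in> sets borel"
proof -
  have "shifted_Delta T x = {w \<in> space borel. x < w \<and> ereal (w - x) \<le> T}"
    by (auto simp: mem_shifted_Delta)
  also have "\<dots> \<in> sets borel" by measurable
  finally show ?thesis .
qed

lemma local_prob_infinity: "local_prob F \<infinity> = tail F"
  by (simp add: fun_eq_iff local_prob_def tail_def shifted_Delta_infinity greaterThan_def)

context real_distribution
begin

lemma tail_antimono: "x \<le> y \<Longrightarrow> tail M y \<le> tail M x"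
  unfolding tail_def by (rule finite_measure_mono) auto

lemma local_prob_nonneg: "0 \<le> local_prob M T x"
  by (simp add: local_prob_def)

text \<open>Only \<open>a < \<bar>z\<bar> \<le> y\<close> contributes, and such a \<open>z\<close>
  is at most \<open>\<epsilon> * y\<close> in absolute value unless it exceeds
  \<open>\<epsilon> * y\<close>, where \<open>y\<close> bounds it.\<close>

lemma trunc_mean_diff:
  assumes "a \<le> y" "0 < \<epsilon>" "0 < y"
  shows "\<bar>trunc_mean M y - trunc_mean M a\<bar> \<le> \<epsilon> * y * abs_tail M a + y * abs_tail M (\<epsilon> * y)"
proof -
  let ?f = "\<lambda>z. indicator {z. \<bar>z\<bar> \<le> y} z * z - indicator {z. \<bar>z\<bar> \<le> a} z * z"
  have int: "integrable M ?f" by (intro Bochner_Integration.integrable_diff integrable_trunc_id)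
  have "\<bar>trunc_mean M y - trunc_mean M a\<bar> = \<bar>LINT z|M. ?f z\<bar>"
    by (simp add: trunc_mean_eq integrable_trunc_id)
  also have "\<dots> \<le> (LINT z|M. \<bar>?f z\<bar>)" by (rule integral_abs_bound)
  also have "\<dots> \<le> (LINT z|M. \<epsilon> * y * indicator {z. \<bar>z\<bar> > a} z + y * indicator {z. \<bar>z\<bar> > \<epsilon> * y} z)"
  proof (rule integral_mono)
    show "integrable M (\<lambda>z. \<bar>?f z\<bar>)" using int by (rule integrable_abs)
    show "integrable M (\<lambda>z. \<epsilon> * y * indicator {z. \<bar>z\<bar> > a} z + y * indicator {z. \<bar>z\<bar> > \<epsilon> * y} z)"
      by (intro Bochner_Integration.integrable_add integrable_mult_right integrable_abs_tail)
    fix z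
    define p where "p = \<epsilon> * y"
    have "0 < p" using assms by (simp add: p_def)
    then show "\<bar>?f z\<bar> \<le> \<epsilon> * y * indicator {z. \<bar>z\<bar> > a} z + y * indicator {z. \<bar>z\<bar> > \<epsilon> * y} z"
      using assms unfolding p_def[symmetric] by (auto simp: indicator_def)
  qed
  also have "\<dots> = \<epsilon> * y * abs_tail M a + y * abs_tail M (\<epsilon> * y)"
    by (simp add: abs_tail_eq integrable_abs_tail)
  finally show ?thesis .
qed

end

section \<open>Truncated means beyond the norming level; tails bounded by local
  probabilities\<close>

context balanced_tails
begin

lemma norming_less:
  assumes "real n * Q_fun F a = 1" "0 < y" "real n * Q_fun F y < 1"
  shows "a < y"
proof (rule ccontr)
  assume "\<not> a < y"
  then have "Q_fun F a \<le> Q_fun F y" using assms by (intro Q_fun_antimono) auto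
  then have "real n * Q_fun F a \<le> real n * Q_fun F y" by (intro mult_left_mono) auto
  then show False using assms by simp
qed

text \<open>Since \<open>x\<^sup>2 * Q\<close> increases,
  \<open>a\<^sup>2 = n * a\<^sup>2 * Q a\<close> is at most
  \<open>n * y\<^sup>2 * Q y\<close>.\<close>

lemma norming_le_sqrt:
  assumes "real n * Q_fun F a = 1" "0 < a" "0 < y" "real n * Q_fun F y < 1"
  shows "a \<le> y * sqrt (real n * Q_fun F y)"
proof -
  have "a < y" by (rule norming_less[OF assms(1,3,4)])
  then have "real n * Q_fun F a \<le> real n * ((y / a)\<^sup>2 * Q_fun F y)"
    using assms by (intro mult_left_mono Q_fun_le_scale) auto
  then have "a\<^sup>2 * 1 \<le> a\<^sup>2 * (real n * ((y / a)\<^sup>2 * Q_fun F y))"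
    unfolding assms(1) by (rule mult_left_mono) simp
  also have "\<dots> = y\<^sup>2 * (real n * Q_fun F y)"
    using assms(2) by (simp add: power_divide)
  finally have "a\<^sup>2 \<le> y\<^sup>2 * (real n * Q_fun F y)" by simp
  then have "a\<^sup>2 \<le> (y * sqrt (real n * Q_fun F y))\<^sup>2"
    by (simp add: power_mult_distrib)
  then show ?thesis
    by (rule power2_le_imp_le) (use assms(3) in simp)
qed

lemma trunc_mean_bound:
  assumes n: "real n * Q_fun F a = 1" and a: "0 < a" and y: "0 < y" "real n * Q_fun F y < 1"
    and L: "real n * \<bar>trunc_mean F a\<bar> \<le> L * a" "0 \<le> L" and \<epsilon>: "0 < \<epsilon>" "\<epsilon> \<le> 1"
  shows "real n * \<bar>trunc_mean F y\<bar> \<le> (L * sqrt (real n * Q_fun F y) + \<epsilon> + real n * Q_fun F y / \<epsilon>\<^sup>2) * y"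
proof -
  have "a < y" by (rule norming_less[OF n y])
  have "\<epsilon> * y \<le> y" using \<epsilon> y by simp
  have "real n * \<bar>trunc_mean F y - trunc_mean F a\<bar>
      \<le> real n * (\<epsilon> * y * abs_tail F a + y * abs_tail F (\<epsilon> * y))"
    using \<open>a < y\<close> \<epsilon> y by (intro mult_left_mono trunc_mean_diff) auto
  also have "\<dots> \<le> real n * (\<epsilon> * y * Q_fun F a + y * (Q_fun F y / \<epsilon>\<^sup>2))"
  proof (intro mult_left_mono add_mono abs_tail_le_Q_fun)
    have "abs_tail F (\<epsilon> * y) \<le> Q_fun F (\<epsilon> * y)" by (rule abs_tail_le_Q_fun)
    also have "\<dots> \<le> (y / (\<epsilon> * y))\<^sup>2 * Q_fun F y"
      using \<epsilon> y \<open>\<epsilon> * y \<le> y\<close> by (intro Q_fun_le_scale) auto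
    also have "\<dots> = Q_fun F y / \<epsilon>\<^sup>2" using y by (simp add: power_divide)
    finally show "abs_tail F (\<epsilon> * y) \<le> Q_fun F y / \<epsilon>\<^sup>2" .
  qed (use \<epsilon> y in auto)
  also have "\<dots> = \<epsilon> * y * (real n * Q_fun F a) + real n * Q_fun F y / \<epsilon>\<^sup>2 * y"
    by (simp add: algebra_simps)
  finally have "real n * \<bar>trunc_mean F y - trunc_mean F a\<bar> \<le> (\<epsilon> + real n * Q_fun F y / \<epsilon>\<^sup>2) * y"
    unfolding n by (simp add: algebra_simps)
  moreover have "real n * \<bar>trunc_mean F a\<bar> \<le> L * (y * sqrt (real n * Q_fun F y))"
    using L(1) mult_left_mono[OF norming_le_sqrt[OF n a y] L(2)] by linarith
  moreover have "\<bar>trunc_mean F y\<bar> \<le> \<bar>trunc_mean F y - trunc_mean F a\<bar> + \<bar>trunc_mean F a\<bar>" by linarith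
  then have "real n * \<bar>trunc_mean F y\<bar> \<le> real n * (\<bar>trunc_mean F y - trunc_mean F a\<bar> + \<bar>trunc_mean F a\<bar>)"
    by (rule mult_left_mono) simp
  ultimately have "real n * \<bar>trunc_mean F y\<bar>
      \<le> (\<epsilon> + real n * Q_fun F y / \<epsilon>\<^sup>2) * y + L * (y * sqrt (real n * Q_fun F y))"
    unfolding distrib_left by linarith
  then show ?thesis by (simp add: algebra_simps)
qed

text \<open>Control of the truncated mean is carried from \<open>a\<close> to every level
  \<open>y\<close> with \<open>n * Q y\<close> small. \<open>\<epsilon>\<close> is fixed before
  \<open>\<rho>\<close>, and each of the three summands of \<open>trunc_mean_bound\<close> is made
  at most \<open>\<kappa> / 3\<close>.\<close>

lemma trunc_mean_small:
  assumes "0 \<le> L" "0 < \<kappa>"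
  obtains \<rho> where "0 < \<rho>" "\<And>n a y. real n * Q_fun F a = 1 \<Longrightarrow> 0 < a \<Longrightarrow> real n * \<bar>trunc_mean F a\<bar> \<le> L * a
    \<Longrightarrow> 0 < y \<Longrightarrow> real n * Q_fun F y \<le> \<rho> \<Longrightarrow> real n * \<bar>trunc_mean F y\<bar> \<le> \<kappa> * y"
proof -
  define \<epsilon> where "\<epsilon> = min (\<kappa> / 3) 1"
  have \<epsilon>: "0 < \<epsilon>" "\<epsilon> \<le> 1" "\<epsilon> \<le> \<kappa> / 3" using assms by (auto simp: \<epsilon>_def)
  define \<rho> where "\<rho> = min (1 / 2) (min ((\<kappa> / (3 * (L + 1)))\<^sup>2) (\<kappa> / 3 * \<epsilon>\<^sup>2))"
  have \<rho>: "0 < \<rho>" "\<rho> < 1" "\<rho> \<le> (\<kappa> / (3 * (L + 1)))\<^sup>2" "\<rho> \<le> \<kappa> / 3 * \<epsilon>\<^sup>2"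
    unfolding \<rho>_def using assms \<epsilon> by (auto simp: min_less_iff_disj)
  show ?thesis
  proof (rule that[OF \<rho>(1)])
    fix n :: nat and a y :: real
    assume n: "real n * Q_fun F a = 1" and a: "0 < a" "real n * \<bar>trunc_mean F a\<bar> \<le> L * a"
      and y: "0 < y" "real n * Q_fun F y \<le> \<rho>"
    have "sqrt (real n * Q_fun F y) \<le> sqrt ((\<kappa> / (3 * (L + 1)))\<^sup>2)"
      using y \<rho> by (intro real_sqrt_le_mono) linarith
    also have "\<dots> = \<kappa> / (3 * (L + 1))" using assms by simp
    finally have "L * sqrt (real n * Q_fun F y) \<le> (L + 1) * (\<kappa> / (3 * (L + 1)))"
      using assms by (intro mult_mono) auto
    also have "\<dots> = \<kappa> / 3" using assms by (simp add: field_simps)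
    finally have 1: "L * sqrt (real n * Q_fun F y) \<le> \<kappa> / 3" .
    have 2: "real n * Q_fun F y / \<epsilon>\<^sup>2 \<le> \<kappa> / 3"
      using y \<rho> \<epsilon> by (simp add: divide_le_eq)
    have "real n * \<bar>trunc_mean F y\<bar> \<le> (L * sqrt (real n * Q_fun F y) + \<epsilon> + real n * Q_fun F y / \<epsilon>\<^sup>2) * y"
      using y \<rho> by (intro trunc_mean_bound[OF n a(1) y(1) _ a(2) assms(1) \<epsilon>(1,2)]) auto
    also have "\<dots> \<le> \<kappa> * y"
    proof (rule mult_right_mono)
      show "L * sqrt (real n * Q_fun F y) + \<epsilon> + real n * Q_fun F y / \<epsilon>\<^sup>2 \<le> \<kappa>"
        using 1 2 \<epsilon>(3) by linarith
    qed (use y in simp)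
    finally show "real n * \<bar>trunc_mean F y\<bar> \<le> \<kappa> * y" .
  qed
qed

text \<open>\<open>(x, Y * x]\<close> is covered by at most \<open>(Y - 1) * x / t + 1\<close>
  windows, each of mass at most \<open>B\<close> times the first one. By the halving property the
  bounds for the successive intervals from \<open>Y ^ k * x\<close> to
  \<open>Y ^ (k + 1) * x\<close> decrease geometrically, which doubles the constant.\<close>

lemma tail_le_local_prob:
  assumes t: "0 < t" and B: "0 < B" and X: "0 < X" and Y: "1 < Y"
    and bound: "\<And>x w. X \<le> x \<Longrightarrow> x \<le> w \<Longrightarrow> local_prob F (ereal t) w \<le> B * local_prob F (ereal t) x"
    and halve: "\<And>x. X \<le> x \<Longrightarrow> Y * local_prob F (ereal t) (Y * x) \<le> local_prob F (ereal t) x / 2"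
  obtains D where "0 < D" "\<And>x. X \<le> x \<Longrightarrow> tail F x \<le> D * x * local_prob F (ereal t) x"
proof -
  let ?g = "local_prob F (ereal t)"
  \<comment> \<open>\<open>1 / X\<close> pays for rounding up the number of windows, because
    \<open>1 \<le> x / X\<close>.\<close>
  define D where "D = B * ((Y - 1) / t + 1 / X)"
  have D: "0 < D" using B X Y t by (simp add: D_def add_pos_pos)
  have interval: "prob {x<..x + real k * t} \<le> real k * (B * ?g x)" if x: "X \<le> x" for k x
  proof (induction k)
    case (Suc k)
    define d where "d = real k * t"
    have "0 \<le> d" "real (Suc k) * t = d + t" using t by (simp_all add: d_def algebra_simps)
    then have "{x<..x + real (Suc k) * t} = {x<..x + real k * t} \<union> shifted_Delta (ereal t) (x + real k * t)"
      unfolding d_def[symmetric] using t by (auto simp: shifted_Delta_ereal)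
    then have "prob {x<..x + real (Suc k) * t} \<le> prob {x<..x + real k * t} + ?g (x + real k * t)"
      unfolding local_prob_def by (simp add: measure_Un_le)
    moreover have "?g (x + real k * t) \<le> B * ?g x"
      using x t by (intro bound) auto
    ultimately show ?case using Suc by (simp add: algebra_simps)
  qed simp
  have step: "tail F x \<le> D * x * ?g x + tail F (Y * x)" if x: "X \<le> x" for x
  proof -
    have x': "0 < x" using x X by simp
    define k where "k = nat \<lceil>(Y - 1) * x / t\<rceil>"
    have "0 \<le> (Y - 1) * x / t" using Y x' t by simp
    then have k: "(Y - 1) * x / t \<le> real k" "real k \<le> (Y - 1) * x / t + 1"
      unfolding k_def by linarith+
    have "(Y - 1) * x \<le> real k * t" using k(1) t by (simp add: field_simps)
    then have "{y. x < y} \<subseteq> {x<..x + real k * t} \<union> {y. Y * x < y}"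
      by (auto simp: algebra_simps)
    then have "tail F x \<le> prob ({x<..x + real k * t} \<union> {y. Y * x < y})"
      unfolding tail_def by (rule finite_measure_mono) auto
    also have "\<dots> \<le> prob {x<..x + real k * t} + tail F (Y * x)"
      unfolding tail_def by (rule measure_Un_le) auto
    also have "prob {x<..x + real k * t} \<le> real k * (B * ?g x)" by (rule interval[OF x])
    also have "real k * (B * ?g x) \<le> (x * ((Y - 1) / t + 1 / X)) * (B * ?g x)"
    proof (rule mult_right_mono)
      have "1 \<le> x / X" using x X by simp
      then show "real k \<le> x * ((Y - 1) / t + 1 / X)" using k(2) by (simp add: algebra_simps)
    qed (use B local_prob_nonneg in simp)
    finally show ?thesis by (simp add: D_def mult_ac)
  qed
  have iter: "tail F x \<le> 2 * D * x * ?g x + tail F (Y ^ k * x)" if "X \<le> x" for k x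
    using that
  proof (induction k arbitrary: x)
    case 0
    then show ?case using D X local_prob_nonneg[of "ereal t" x] by simp
  next
    case (Suc k)
    have x': "0 < x" using Suc.prems X by simp
    have "1 * x \<le> Y * x" using Y x' by (intro mult_right_mono) auto
    then have "X \<le> Y * x" using Suc.prems by simp
    then have "tail F (Y * x) \<le> 2 * D * (Y * x) * ?g (Y * x) + tail F (Y ^ k * (Y * x))"
      by (rule Suc.IH)
    moreover have "2 * D * x * (Y * ?g (Y * x)) \<le> 2 * D * x * (?g x / 2)"
      using D x' by (intro mult_left_mono halve Suc.prems) auto
    ultimately show ?case using step[OF Suc.prems] by (simp add: mult_ac)
  qed
  show ?thesis
  proof (rule that[of "2 * D"])
    fix x assume x: "X \<le> x"
    have x': "0 < x" using x X by simp
    show "tail F x \<le> 2 * D * x * ?g x"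
    \<comment> \<open>The iteration leaves the remainder \<open>tail F (Y ^ k * x)\<close>, which
      falls below any \<open>e\<close> since \<open>Q\<close> tends to 0.\<close>
    proof (rule field_le_epsilon)
      fix e :: real assume "0 < e"
      then have "\<forall>\<^sub>F y in at_top. Q_fun F y < e"
        by (rule order_tendstoD(2)[OF Q_fun_tendsto_0])
      then obtain y0 where y0: "\<And>y. y0 \<le> y \<Longrightarrow> Q_fun F y < e"
        unfolding eventually_at_top_linorder by blast
      obtain k where "y0 / x < Y ^ k" using real_arch_pow[OF Y] by blast
      then have "Q_fun F (Y ^ k * x) < e" using x' by (intro y0) (simp add: field_simps)
      then show "tail F x \<le> 2 * D * x * ?g x + e"
        using iter[OF x, of k] tail_le_abs_tail[of "Y ^ k * x"] abs_tail_le_Q_fun[of "Y ^ k * x"] by linarith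
    qed
  qed (use D in simp)
qed

end

section \<open>Sums of independent steps\<close>

text \<open>Conditioning on \<open>X\<close> in Fubini form: independence enters as the product form
  of the joint law, and a uniform bound on the sections over \<open>Z\<close> is integrated over
  \<open>Z\<close>.\<close>

lemma (in prob_space)
  fixes Y :: "'a \<Rightarrow> real"
  assumes X [measurable]: "X \<in> measurable M N" and Y [measurable]: "Y \<in> borel_measurable M"
    and pair: "distr M N X \<Otimes>\<^sub>M distr M borel Y = distr M (N \<Otimes>\<^sub>M borel) (\<lambda>\<omega>. (X \<omega>, Y \<omega>))"
    and Z: "Z \<in> sets N" and A: "A \<in> sets (N \<Otimes>\<^sub>M borel)"
  shows prob_sections_le: "\<lbrakk>0 \<le> c; \<And>x. x \<in> Z \<Longrightarrow> measure (distr M borel Y) (Pair x -` A) \<le> c\<rbrakk> \<Longrightarrow>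
      prob {\<omega> \<in> space M. X \<omega> \<in> Z \<and> (X \<omega>, Y \<omega>) \<in> A} \<le> c * prob {\<omega> \<in> space M. X \<omega> \<in> Z}"
    and prob_sections_ge: "\<lbrakk>0 \<le> c; \<And>x. x \<in> Z \<Longrightarrow> c \<le> measure (distr M borel Y) (Pair x -` A)\<rbrakk> \<Longrightarrow>
      c * prob {\<omega> \<in> space M. X \<omega> \<in> Z} \<le> prob {\<omega> \<in> space M. X \<omega> \<in> Z \<and> (X \<omega>, Y \<omega>) \<in> A}"
proof -
  interpret R: prob_space "distr M borel Y" by (rule prob_space_distr) fact
  define A' where "A' = A \<inter> Z \<times> UNIV"
  have A' [measurable]: "A' \<in> sets (N \<Otimes>\<^sub>M borel)" unfolding A'_def by (rule sets.Int[OF A pair_measureI[OF Z]]) simp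
  have sets_eq: "sets (distr M N X \<Otimes>\<^sub>M distr M borel Y) = sets (N \<Otimes>\<^sub>M borel)"
    by (intro sets_pair_measure_cong) auto
  let ?E = "{\<omega> \<in> space M. X \<omega> \<in> Z \<and> (X \<omega>, Y \<omega>) \<in> A}"
  have "emeasure M ?E = emeasure (distr M (N \<Otimes>\<^sub>M borel) (\<lambda>\<omega>. (X \<omega>, Y \<omega>))) A'"
    using A' by (subst emeasure_distr) (auto simp: A'_def intro!: arg_cong[where f = "emeasure M"])
  also have "\<dots> = (\<integral>\<^sup>+x. emeasure (distr M borel Y) (Pair x -` A') \<partial>distr M N X)"
    unfolding pair[symmetric] by (subst R.emeasure_pair_measure_alt) (auto simp: sets_eq)
  finally have E: "ennreal (prob ?E) = (\<integral>\<^sup>+x. emeasure (distr M borel Y) (Pair x -` A') \<partial>distr M N X)"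
    by (simp add: emeasure_eq_measure)
  have cut: "emeasure (distr M borel Y) (Pair x -` A')
      = ennreal (measure (distr M borel Y) (Pair x -` A)) * indicator Z x" for x
    by (cases "x \<in> Z") (auto simp: A'_def R.emeasure_eq_measure intro!: arg_cong[where f = "measure _"])
  have c_int: "(\<integral>\<^sup>+x. ennreal c * indicator Z x \<partial>distr M N X) = ennreal (c * prob {\<omega> \<in> space M. X \<omega> \<in> Z})"
    if "0 \<le> c"
  proof -
    have "(\<integral>\<^sup>+x. ennreal c * indicator Z x \<partial>distr M N X) = ennreal c * emeasure (distr M N X) Z"
      using Z by (subst nn_integral_cmult_indicator) auto
    also have "emeasure (distr M N X) Z = ennreal (prob {\<omega> \<in> space M. X \<omega> \<in> Z})"
      using Z by (subst emeasure_distr) (auto simp: emeasure_eq_measure intro!: arg_cong[where f = prob])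
    finally show ?thesis using that by (simp add: ennreal_mult)
  qed
  {
    assume c: "0 \<le> c" and *: "\<And>x. x \<in> Z \<Longrightarrow> measure (distr M borel Y) (Pair x -` A) \<le> c"
    have "ennreal (prob ?E) \<le> (\<integral>\<^sup>+x. ennreal c * indicator Z x \<partial>distr M N X)"
      unfolding E cut using * by (intro nn_integral_mono) (auto simp: indicator_def intro!: ennreal_leI)
    then show "prob ?E \<le> c * prob {\<omega> \<in> space M. X \<omega> \<in> Z}"
      unfolding c_int[OF c] using c by (subst (asm) ennreal_le_iff) auto
  next
    assume c: "0 \<le> c" and *: "\<And>x. x \<in> Z \<Longrightarrow> c \<le> measure (distr M borel Y) (Pair x -` A)"
    have "(\<integral>\<^sup>+x. ennreal c * indicator Z x \<partial>distr M N X) \<le> ennreal (prob ?E)"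
      unfolding E cut using * by (intro nn_integral_mono) (auto simp: indicator_def intro!: ennreal_leI)
    then show "c * prob {\<omega> \<in> space M. X \<omega> \<in> Z} \<le> prob ?E"
      unfolding c_int[OF c] by (subst (asm) ennreal_le_iff) auto
  }
qed

text \<open>For \<open>u \<ge> 0\<close> this rests on \<open>(1 - u) * exp u \<le> 1\<close>, for
  \<open>u < 0\<close> on \<open>(1 + u + u\<^sup>2) * (1 - u) = 1 - u ^ 3 \<ge> 1\<close>. The
  factor \<open>exp w\<close> touches only the quadratic term, so that the linear one integrates to
  the truncated mean.\<close>

lemma exp_le_quadratic:
  fixes u w :: real
  assumes "\<bar>u\<bar> \<le> w"
  shows "exp u \<le> 1 + u + u\<^sup>2 * exp w"
proof (cases "0 \<le> u")
  case True
  have "exp u * (1 - u\<^sup>2) \<le> 1 + u"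
  proof (cases "u \<le> 1")
    case True
    have "(1 - u) * exp u \<le> exp (- u) * exp u"
      using exp_ge_add_one_self[of "- u"] by (intro mult_right_mono) auto
    also have "\<dots> = 1" by (simp flip: exp_add)
    finally have "(1 + u) * ((1 - u) * exp u) \<le> (1 + u) * 1"
      using \<open>0 \<le> u\<close> by (intro mult_left_mono) auto
    then show ?thesis by (simp add: algebra_simps power2_eq_square)
  next
    case False
    then have "1 \<le> u\<^sup>2" by simp
    then have "exp u * (1 - u\<^sup>2) \<le> 0" by (intro mult_nonneg_nonpos) auto
    then show ?thesis using \<open>0 \<le> u\<close> by linarith
  qed
  moreover have "u\<^sup>2 * exp u \<le> u\<^sup>2 * exp w" using assms by (intro mult_left_mono) auto
  ultimately show ?thesis by (simp add: algebra_simps)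
next
  case False
  have "exp u * (1 - u) \<le> exp u * exp (- u)"
    using exp_ge_add_one_self[of "- u"] by (intro mult_left_mono) auto
  also have "\<dots> = 1" by (simp flip: exp_add)
  also have "1 \<le> 1 - u ^ 3" using False by (simp add: power3_eq_cube mult_nonneg_nonpos zero_le_mult_iff mult_le_0_iff)
  also have "\<dots> = (1 + u + u\<^sup>2) * (1 - u)" by (simp add: algebra_simps power2_eq_square power3_eq_cube)
  finally have "exp u \<le> 1 + u + u\<^sup>2" by (rule mult_right_le_imp_le) (use False in simp)
  moreover have "u\<^sup>2 * 1 \<le> u\<^sup>2 * exp w" using assms by (intro mult_left_mono) auto
  ultimately show ?thesis by linarith
qed

lemma square_le_exp:
  fixes w :: real
  assumes "0 \<le> w"
  shows "w\<^sup>2 \<le> 4 * exp w"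
  using power_le_exp[OF assms, of 2] by (simp add: power_divide)

context real_distribution
begin

text \<open>The truncation is one-sided, yet two-sided moments suffice: for \<open>x < - y\<close>
  the exponential is at most 1 and is covered by the constant term.\<close>

lemma truncated_exponential_moment:
  assumes h: "0 \<le> h" and y: "0 < y"
  shows "integrable M (\<lambda>x. indicator {..y} x * exp (h * x))" (is ?int)
    and "(LINT x|M. indicator {..y} x * exp (h * x))
      \<le> 1 + (h * trunc_mean M y + h\<^sup>2 * exp (h * y) * trunc_second_moment M y)" (is ?le)
proof -
  have "h * x \<le> h * y" if "x \<le> y" for x using that h by (rule mult_left_mono)
  then show int: ?int
    by (intro integrable_const_bound[where B = "exp (h * y)"]) (auto simp: indicator_def)
  have "(LINT x|M. indicator {..y} x * exp (h * x))
      \<le> (LINT x|M. 1 + (h * (indicator {x. \<bar>x\<bar> \<le> y} x * x)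
          + h\<^sup>2 * exp (h * y) * (indicator {x. \<bar>x\<bar> \<le> y} x * x\<^sup>2)))"
  proof (rule integral_mono[OF int])
    show "integrable M (\<lambda>x. 1 + (h * (indicator {x. \<bar>x\<bar> \<le> y} x * x)
          + h\<^sup>2 * exp (h * y) * (indicator {x. \<bar>x\<bar> \<le> y} x * x\<^sup>2)))"
      by (intro Bochner_Integration.integrable_add integrable_mult_right integrable_trunc_id
          integrable_trunc_square) simp
    fix x
    show "indicator {..y} x * exp (h * x) \<le> 1 + (h * (indicator {x. \<bar>x\<bar> \<le> y} x * x)
          + h\<^sup>2 * exp (h * y) * (indicator {x. \<bar>x\<bar> \<le> y} x * x\<^sup>2))"
    proof (cases "\<bar>x\<bar> \<le> y")
      case True
      then have "\<bar>h * x\<bar> \<le> h * y" using h by (simp add: abs_mult mult_left_mono)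
      from exp_le_quadratic[OF this] show ?thesis using True by (simp add: power_mult_distrib mult_ac)
    next
      case False
      then have "x \<le> y \<Longrightarrow> h * x \<le> 0" using h y by (intro mult_nonneg_nonpos) auto
      then show ?thesis using False by (auto simp: indicator_def)
    qed
  qed
  also have "\<dots> = 1 + (h * trunc_mean M y + h\<^sup>2 * exp (h * y) * trunc_second_moment M y)"
    using prob_space
    by (simp add: trunc_mean_eq trunc_second_moment_eq integrable_trunc_id integrable_trunc_square)
  finally show ?le .
qed

end

section \<open>The random walk: independence of blocks, moments and exponential bounds\<close>

locale iid_walk = prob_space M + F: balanced_tails F K x0
  for M :: "'a measure" and F :: "real measure" and K x0 :: real +
  fixes \<xi> :: "nat \<Rightarrow> 'a \<Rightarrow> real"
  assumes indep: "indep_vars (\<lambda>_. borel) \<xi> {1..}"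
    and law: "1 \<le> i \<Longrightarrow> distr M borel (\<xi> i) = F"
begin

lemma step_measurable: "1 \<le> i \<Longrightarrow> \<xi> i \<in> borel_measurable M"
  using indep by (auto simp: indep_vars_def)

lemma sum_measurable: "J \<subseteq> {1..} \<Longrightarrow> (\<lambda>\<omega>. \<Sum>j\<in>J. \<xi> j \<omega>) \<in> borel_measurable M"
  by (intro borel_measurable_sum step_measurable) auto

lemma prob_step:
  assumes "1 \<le> i" "B \<in> sets borel"
  shows "prob {\<omega> \<in> space M. \<xi> i \<omega> \<in> B} = measure F B"
proof -
  have "measure (distr M borel (\<xi> i)) B = prob (\<xi> i -` B \<inter> space M)"
    using assms step_measurable by (intro measure_distr) auto
  then show ?thesis using law[OF assms(1)] by (simp add: vimage_def Int_def conj_commute)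
qed

lemma expectation_step:
  assumes "1 \<le> i" "f \<in> borel_measurable borel"
  shows "expectation (\<lambda>\<omega>. f (\<xi> i \<omega>)) = (LINT x|F. f x :: real)"
  using integral_distr[OF step_measurable[OF assms(1)] assms(2)] law[OF assms(1)] by simp

text \<open>Disjoint blocks are independent and the sum over \<open>J\<close> is a measurable image
  of its block. The vector of the steps in \<open>I\<close> is kept whole, so that conditions on it
  may involve single steps as well as their sum.\<close>

lemma distr_steps_sum:
  assumes "I \<inter> J = {}" "I \<subseteq> {1..}" "J \<subseteq> {1..}"
  defines "X \<equiv> \<lambda>\<omega>. \<lambda>i\<in>I. \<xi> i \<omega>" and "S \<equiv> \<lambda>\<omega>. \<Sum>j\<in>J. \<xi> j \<omega>"
  shows "distr M (PiM I (\<lambda>_. borel)) X \<Otimes>\<^sub>M distr M borel S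
    = distr M (PiM I (\<lambda>_. borel) \<Otimes>\<^sub>M borel) (\<lambda>\<omega>. (X \<omega>, S \<omega>))"
proof -
  let ?P = "\<lambda>I. PiM I (\<lambda>_. borel :: real measure)" and ?Y = "\<lambda>\<omega>. \<lambda>j\<in>J. \<xi> j \<omega>" and ?s = "\<lambda>f. \<Sum>j\<in>J. f j :: real"
  have ind: "indep_var (?P I) X (?P J) ?Y"
    unfolding X_def by (rule indep_var_restrict[OF indep assms(1-3)])
  then have [measurable]: "X \<in> measurable M (?P I)" and Y [measurable]: "?Y \<in> measurable M (?P J)"
    and pair: "distr M (?P I) X \<Otimes>\<^sub>M distr M (?P J) ?Y = distr M (?P I \<Otimes>\<^sub>M ?P J) (\<lambda>\<omega>. (X \<omega>, ?Y \<omega>))"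
    using indep_var_distribution_eq by blast+
  have S: "S = ?s \<circ> ?Y" by (simp add: S_def comp_def)
  have s [measurable]: "?s \<in> borel_measurable (?P J)"
    by (intro borel_measurable_sum measurable_component_singleton)
  interpret Y: prob_space "distr M (?P J) ?Y" by (rule prob_space_distr[OF Y])
  interpret S: prob_space "distr (distr M (?P J) ?Y) borel ?s" by (rule Y.prob_space_distr) simp
  have "distr M (?P I) X \<Otimes>\<^sub>M distr M borel S
      = distr (distr M (?P I) X) (?P I) (\<lambda>x. x) \<Otimes>\<^sub>M distr (distr M (?P J) ?Y) borel ?s"
    by (simp add: S distr_distr distr_id2)
  also have "\<dots> = distr (distr M (?P I) X \<Otimes>\<^sub>M distr M (?P J) ?Y) (?P I \<Otimes>\<^sub>M borel) (\<lambda>(x, y). (x, ?s y))"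
    by (rule pair_measure_distr) (auto intro: S.sigma_finite_measure_axioms)
  also have "\<dots> = distr M (?P I \<Otimes>\<^sub>M borel) (\<lambda>\<omega>. (X \<omega>, S \<omega>))"
    unfolding pair by (subst distr_distr) (auto simp: comp_def S)
  finally show ?thesis .
qed

lemma truncated_sum_moments:
  assumes "finite J" "J \<subseteq> {1..}" and y: "0 \<le> y"
  defines "S \<equiv> \<lambda>\<omega>. \<Sum>j\<in>J. indicator {x. \<bar>x\<bar> \<le> y} (\<xi> j \<omega>) * \<xi> j \<omega>"
  shows "integrable M (\<lambda>\<omega>. (S \<omega>)\<^sup>2)"
    and "expectation (\<lambda>\<omega>. (S \<omega>)\<^sup>2) \<le>
      real (card J) * trunc_second_moment F y + (real (card J) * trunc_mean F y)\<^sup>2"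
proof -
  define \<eta> where "\<eta> i \<omega> = indicator {x. \<bar>x\<bar> \<le> y} (\<xi> i \<omega>) * \<xi> i \<omega>" for i \<omega>
  have \<eta>_meas: "\<eta> i \<in> borel_measurable M" if "1 \<le> i" for i
    using step_measurable[OF that] unfolding \<eta>_def by measurable
  have \<eta>_bound: "\<bar>\<eta> i \<omega>\<bar> \<le> y" for i \<omega> using y by (auto simp: \<eta>_def indicator_def)
  have \<eta>_indep: "indep_vars (\<lambda>_. borel) \<eta> I" if "I \<subseteq> {1..}" for I
    unfolding \<eta>_def[abs_def]
    by (rule indep_vars_compose2[OF indep_vars_subset[OF indep that]]) measurable
  have \<eta>_mean: "expectation (\<eta> i) = trunc_mean F y" if "1 \<le> i" for i
    unfolding \<eta>_def F.trunc_mean_eq using that by (intro expectation_step) auto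
  have \<eta>_square: "expectation (\<lambda>\<omega>. (\<eta> i \<omega>)\<^sup>2) = trunc_second_moment F y" if "1 \<le> i" for i
  proof -
    have "expectation (\<lambda>\<omega>. (\<eta> i \<omega>)\<^sup>2) = expectation (\<lambda>\<omega>. indicator {x. \<bar>x\<bar> \<le> y} (\<xi> i \<omega>) * (\<xi> i \<omega>)\<^sup>2)"
      by (intro Bochner_Integration.integral_cong) (auto simp: \<eta>_def indicator_def)
    also have "\<dots> = trunc_second_moment F y"
      unfolding F.trunc_second_moment_eq using that by (intro expectation_step) auto
    finally show ?thesis .
  qed
  let ?S = "\<lambda>(I :: nat set) \<omega>. \<Sum>i\<in>I. \<eta> i \<omega>"
  have S_meas: "?S I \<in> borel_measurable M" if "I \<subseteq> {1..}" for I
    using that by (intro borel_measurable_sum \<eta>_meas) auto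
  have S_bound: "\<bar>?S I \<omega>\<bar> \<le> real (card I) * y" for I \<omega>
    using sum_abs[of "\<lambda>i. \<eta> i \<omega>" I] sum_bounded_above[of I "\<lambda>i. \<bar>\<eta> i \<omega>\<bar>" y] \<eta>_bound
    by (meson order_trans)
  have S_int: "integrable M (?S I)" if "I \<subseteq> {1..}" for I
    using S_bound S_meas[OF that] by (intro integrable_const_bound[where B = "real (card I) * y"]) auto
  have S_square_int: "integrable M (\<lambda>\<omega>. (?S I \<omega>)\<^sup>2)" if "I \<subseteq> {1..}" for I
  proof (rule integrable_const_bound[where B = "(real (card I) * y)\<^sup>2"])
    show "AE \<omega> in M. norm ((?S I \<omega>)\<^sup>2) \<le> (real (card I) * y)\<^sup>2"
    proof (rule AE_I2)
      fix \<omega>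
      have "\<bar>?S I \<omega>\<bar>\<^sup>2 \<le> (real (card I) * y)\<^sup>2" by (rule power_mono[OF S_bound]) simp
      then show "norm ((?S I \<omega>)\<^sup>2) \<le> (real (card I) * y)\<^sup>2" by simp
    qed
  qed (use S_meas[OF that] in measurable)
  show "integrable M (\<lambda>\<omega>. (S \<omega>)\<^sup>2)"
    using S_square_int[OF assms(2)] by (simp add: S_def \<eta>_def)
  \<comment> \<open>The mean is carried through the induction because the cross term
    \<open>2 * (\<eta> i * ?S I)\<close> needs it.\<close>
  have "expectation (\<lambda>\<omega>. (?S J \<omega>)\<^sup>2) \<le>
      real (card J) * trunc_second_moment F y + (real (card J) * trunc_mean F y)\<^sup>2
      \<and> expectation (?S J) = real (card J) * trunc_mean F y"
    using assms(1,2)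
  proof (induction J rule: finite_induct)
    case (insert i I)
    then have i: "1 \<le> i" and I: "I \<subseteq> {1..}" by auto
    have ind: "indep_var borel (\<eta> i) borel (?S I)"
      using insert.hyps insert.prems by (intro indep_vars_sum \<eta>_indep) auto
    have \<eta>_int: "integrable M (\<eta> i)"
      using \<eta>_bound \<eta>_meas[OF i] by (intro integrable_const_bound[where B = y]) auto
    have \<eta>_square_int: "integrable M (\<lambda>\<omega>. (\<eta> i \<omega>)\<^sup>2)"
      using S_square_int[of "{i}"] i by simp
    have cross: "integrable M (\<lambda>\<omega>. \<eta> i \<omega> * ?S I \<omega>)"
      "expectation (\<lambda>\<omega>. \<eta> i \<omega> * ?S I \<omega>) = expectation (\<eta> i) * expectation (?S I)"
      using ind \<eta>_int S_int[OF I] by (auto intro: indep_var_integrable indep_var_lebesgue_integral)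
    have "expectation (\<lambda>\<omega>. (?S (insert i I) \<omega>)\<^sup>2)
        = expectation (\<lambda>\<omega>. (\<eta> i \<omega>)\<^sup>2 + (2 * (\<eta> i \<omega> * ?S I \<omega>) + (?S I \<omega>)\<^sup>2))"
      using insert.hyps by (simp add: power2_sum algebra_simps)
    also have "\<dots> = expectation (\<lambda>\<omega>. (\<eta> i \<omega>)\<^sup>2)
        + (2 * (expectation (\<eta> i) * expectation (?S I)) + expectation (\<lambda>\<omega>. (?S I \<omega>)\<^sup>2))"
      using \<eta>_square_int cross S_square_int[OF I] by simp
    also have "\<dots> \<le> trunc_second_moment F y + (2 * (trunc_mean F y * (real (card I) * trunc_mean F y))
        + (real (card I) * trunc_second_moment F y + (real (card I) * trunc_mean F y)\<^sup>2))"
      using insert.IH[OF I] \<eta>_mean[OF i] \<eta>_square[OF i] by simp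
    also have "\<dots> \<le> real (card (insert i I)) * trunc_second_moment F y
        + (real (card (insert i I)) * trunc_mean F y)\<^sup>2"
      using insert.hyps by (simp add: power2_eq_square algebra_simps)
    finally have "expectation (\<lambda>\<omega>. (?S (insert i I) \<omega>)\<^sup>2) \<le>
        real (card (insert i I)) * trunc_second_moment F y + (real (card (insert i I)) * trunc_mean F y)\<^sup>2" .
    moreover have "expectation (?S (insert i I)) = real (card (insert i I)) * trunc_mean F y"
      using insert.hyps insert.IH[OF I] \<eta>_mean[OF i] \<eta>_int S_int[OF I] by (simp add: algebra_simps)
    ultimately show ?case by simp
  qed simp
  then show "expectation (\<lambda>\<omega>. (S \<omega>)\<^sup>2) \<le>
      real (card J) * trunc_second_moment F y + (real (card J) * trunc_mean F y)\<^sup>2"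
    by (simp add: S_def \<eta>_def)
qed

lemma prob_some_step_in:
  assumes "finite J" "J \<subseteq> {1..}" "card J \<le> n" "B \<in> sets borel"
  shows "prob {\<omega> \<in> space M. \<exists>j\<in>J. \<xi> j \<omega> \<in> B} \<le> real n * measure F B"
proof -
  have meas: "{\<omega> \<in> space M. \<xi> j \<omega> \<in> B} \<in> events" if "j \<in> J" for j
    using step_measurable[of j] that assms by (auto intro!: measurable_sets_Collect[of "\<xi> j" M borel])
  have "prob {\<omega> \<in> space M. \<exists>j\<in>J. \<xi> j \<omega> \<in> B} = prob (\<Union>j\<in>J. {\<omega> \<in> space M. \<xi> j \<omega> \<in> B})"
    by (intro arg_cong[where f = prob]) auto
  also have "\<dots> \<le> (\<Sum>j\<in>J. prob {\<omega> \<in> space M. \<xi> j \<omega> \<in> B})"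
    using assms(1) meas by (intro finite_measure_subadditive_finite) auto
  also have "\<dots> = real (card J) * measure F B"
    using assms(2,4) by (subst sum.cong[OF refl prob_step]) auto
  also have "\<dots> \<le> real n * measure F B" using assms(3) by (intro mult_right_mono) auto
  finally show ?thesis .
qed

text \<open>If no step exceeds \<open>y\<close> in absolute value, the sum equals the truncated one,
  to which Chebyshev's inequality applies. Its second moment is not centred, so the drift appears as
  a square; tail and second moment combine to \<open>n * Q y\<close>.\<close>

lemma prob_sum_large:
  assumes J: "finite J" "J \<subseteq> {1..}" "card J \<le> n" and y: "0 < y"
  shows "prob {\<omega> \<in> space M. y < \<bar>\<Sum>j\<in>J. \<xi> j \<omega>\<bar>}
    \<le> real n * Q_fun F y + (real n * \<bar>trunc_mean F y\<bar> / y)\<^sup>2"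
proof -
  let ?S = "\<lambda>\<omega>. \<Sum>j\<in>J. indicator {x. \<bar>x\<bar> \<le> y} (\<xi> j \<omega>) * \<xi> j \<omega>"
  let ?A = "{\<omega> \<in> space M. \<exists>j\<in>J. \<xi> j \<omega> \<in> {x. y < \<bar>x\<bar>}}" and ?B = "{\<omega> \<in> space M. y\<^sup>2 \<le> (?S \<omega>)\<^sup>2}"
  have \<xi>_meas [measurable]: "\<xi> j \<in> borel_measurable M" if "j \<in> J" for j
    using step_measurable J that by auto
  have meas: "?A \<in> events" "?B \<in> events" using J by measurable
  have "{\<omega> \<in> space M. y < \<bar>\<Sum>j\<in>J. \<xi> j \<omega>\<bar>} \<subseteq> ?A \<union> ?B"
  proof
    fix \<omega> assume \<omega>: "\<omega> \<in> {\<omega> \<in> space M. y < \<bar>\<Sum>j\<in>J. \<xi> j \<omega>\<bar>}"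
    show "\<omega> \<in> ?A \<union> ?B"
    proof (cases "\<exists>j\<in>J. y < \<bar>\<xi> j \<omega>\<bar>")
      case False
      then have "?S \<omega> = (\<Sum>j\<in>J. \<xi> j \<omega>)" by (intro sum.cong) (auto simp: not_less)
      then have "\<bar>y\<bar> \<le> \<bar>?S \<omega>\<bar>" using \<omega> y by simp
      then show ?thesis using \<omega> by (simp add: abs_le_square_iff)
    qed (use \<omega> in auto)
  qed
  then have "prob {\<omega> \<in> space M. y < \<bar>\<Sum>j\<in>J. \<xi> j \<omega>\<bar>} \<le> prob (?A \<union> ?B)"
    using meas by (intro finite_measure_mono) auto
  also have "\<dots> \<le> prob ?A + prob ?B" using meas by (intro measure_Un_le) auto
  also have "prob ?A \<le> real n * abs_tail F y"
    unfolding abs_tail_def using J by (intro prob_some_step_in) auto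
  also have "prob ?B \<le> expectation (\<lambda>\<omega>. (?S \<omega>)\<^sup>2) / y\<^sup>2"
    using y J by (intro integral_Markov_inequality_measure[where A = "{}"] truncated_sum_moments) auto
  also have "\<dots> \<le> (real n * trunc_second_moment F y + (real n * \<bar>trunc_mean F y\<bar>)\<^sup>2) / y\<^sup>2"
  proof (rule divide_right_mono)
    have "expectation (\<lambda>\<omega>. (?S \<omega>)\<^sup>2) \<le> real (card J) * trunc_second_moment F y + (real (card J) * trunc_mean F y)\<^sup>2"
      using J y by (intro truncated_sum_moments) auto
    also have "(real (card J) * trunc_mean F y)\<^sup>2 = (real (card J) * \<bar>trunc_mean F y\<bar>)\<^sup>2"
      by (simp add: power_mult_distrib)
    also have "real (card J) * trunc_second_moment F y + (real (card J) * \<bar>trunc_mean F y\<bar>)\<^sup>2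
        \<le> real n * trunc_second_moment F y + (real n * \<bar>trunc_mean F y\<bar>)\<^sup>2"
      using J F.trunc_second_moment_nonneg by (intro add_mono mult_right_mono power_mono) auto
    finally show "expectation (\<lambda>\<omega>. (?S \<omega>)\<^sup>2) \<le> real n * trunc_second_moment F y + (real n * \<bar>trunc_mean F y\<bar>)\<^sup>2" .
  qed simp
  finally show ?thesis
    by (simp add: Q_fun_def add_divide_distrib distrib_left power_divide)
qed

text \<open>A Chernoff bound of Fuk-Nagaev type. With \<open>n * Q y = exp (- 2 * w)\<close> and
  \<open>h = w / y\<close> the quadratic terms contribute at most
  \<open>w\<^sup>2 * exp (- w) \<le> 4\<close> and the drift at most \<open>w\<close>. The 1 in
  \<open>2 * p + 1\<close> compensates the latter and leaves
  \<open>exp (- 2 * p * w) = (n * Q y) ^ p\<close>.\<close>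

lemma prob_sum_exceeds_truncated:
  assumes J: "finite J" "J \<subseteq> {1..}" "card J \<le> n" and n: "1 \<le> n" and y: "0 < y"
    and Q: "real n * Q_fun F y < 1" and mean: "real n * \<bar>trunc_mean F y\<bar> \<le> y"
  shows "prob {\<omega> \<in> space M. (2 * real p + 1) * y < (\<Sum>j\<in>J. \<xi> j \<omega>) \<and> (\<forall>j\<in>J. \<xi> j \<omega> \<le> y)}
    \<le> exp 4 * (real n * Q_fun F y) ^ p"
proof -
  define q where "q = real n * Q_fun F y"
  have q: "0 < q" "q < 1" using n Q F.Q_fun_pos by (auto simp: q_def)
  define w where "w = ln (1 / q) / 2"
  have w: "0 < w" using q by (simp add: w_def)
  have q_eq: "q = exp (- 2 * w)" using q by (simp add: w_def ln_div)
  define h where "h = w / y"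
  have h: "0 < h" "h * y = w" using w y by (auto simp: h_def)
  define m where "m = (LINT x|F. indicator {..y} x * exp (h * x))"
  define b where "b = h * trunc_mean F y + h\<^sup>2 * exp (h * y) * trunc_second_moment F y"
  have m: "0 \<le> m" "m \<le> 1 + b"
    using F.truncated_exponential_moment[of h y] h y by (auto simp: m_def b_def)
  have m_exp: "m \<le> exp \<bar>b\<bar>"
    using m exp_ge_add_one_self[of b] exp_le_cancel_iff[of b "\<bar>b\<bar>"] by linarith
  have nb: "real n * \<bar>b\<bar> \<le> w + 4"
  proof -
    have "real n * (h\<^sup>2 * exp (h * y) * trunc_second_moment F y)
        \<le> real n * (h\<^sup>2 * exp (h * y) * (y\<^sup>2 * Q_fun F y))"
      using y by (intro mult_left_mono F.trunc_second_moment_le) auto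
    also have "\<dots> = (h * y)\<^sup>2 * exp (h * y) * q"
      by (simp add: q_def power_mult_distrib mult_ac)
    also have "\<dots> = w\<^sup>2 * exp (- w)"
      unfolding h(2) q_eq by (simp add: mult.assoc flip: exp_add)
    also have "\<dots> \<le> 4 * exp w * exp (- w)" using w by (intro mult_right_mono square_le_exp) auto
    also have "\<dots> = 4" by (simp add: mult.assoc flip: exp_add)
    finally have 1: "real n * (h\<^sup>2 * exp (h * y) * trunc_second_moment F y) \<le> 4" .
    have 2: "h * (real n * \<bar>trunc_mean F y\<bar>) \<le> w"
      using mult_left_mono[OF mean, of h] h by simp
    have "\<bar>b\<bar> \<le> h * \<bar>trunc_mean F y\<bar> + h\<^sup>2 * exp (h * y) * trunc_second_moment F y"
      unfolding b_def using h F.trunc_second_moment_nonneg[of y]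
      by (intro order_trans[OF abs_triangle_ineq]) (simp add: abs_mult)
    then have "real n * \<bar>b\<bar> \<le> real n * (h * \<bar>trunc_mean F y\<bar> + h\<^sup>2 * exp (h * y) * trunc_second_moment F y)"
      by (rule mult_left_mono) simp
    also have "\<dots> = h * (real n * \<bar>trunc_mean F y\<bar>) + real n * (h\<^sup>2 * exp (h * y) * trunc_second_moment F y)"
      by (simp add: distrib_left mult_ac)
    finally show ?thesis using 1 2 by linarith
  qed
  \<comment> \<open>The indicator keeps the moments finite and leaves the product unchanged on the
    event that all steps are at most \<open>y\<close>.\<close>
  define \<zeta> where "\<zeta> j \<omega> = indicator {..y} (\<xi> j \<omega>) * exp (h * \<xi> j \<omega>)" for j \<omega>
  have \<zeta>_nonneg: "0 \<le> \<zeta> j \<omega>" for j \<omega> by (simp add: \<zeta>_def)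
  have \<zeta>_meas [measurable]: "\<zeta> j \<in> borel_measurable M" if "j \<in> J" for j
    using step_measurable[of j] J that unfolding \<zeta>_def by auto
  have \<zeta>_indep: "indep_vars (\<lambda>_. borel) \<zeta> J"
    unfolding \<zeta>_def[abs_def]
    by (rule indep_vars_compose2[OF indep_vars_subset[OF indep J(2)]]) measurable
  have \<zeta>_int: "integrable M (\<zeta> j)" if "j \<in> J" for j
  proof (rule integrable_const_bound[where B = "exp (h * y)"])
    have "h * x \<le> h * y" if "x \<le> y" for x using that h by (intro mult_left_mono) auto
    then show "AE \<omega> in M. norm (\<zeta> j \<omega>) \<le> exp (h * y)" by (auto simp: \<zeta>_def indicator_def)
  qed (rule \<zeta>_meas[OF that])
  have \<zeta>_mean: "expectation (\<zeta> j) = m" if "j \<in> J" for j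
    unfolding \<zeta>_def m_def using that J by (intro expectation_step) auto
  let ?t = "(2 * real p + 1) * y"
  let ?E = "{\<omega> \<in> space M. ?t < (\<Sum>j\<in>J. \<xi> j \<omega>) \<and> (\<forall>j\<in>J. \<xi> j \<omega> \<le> y)}"
  have "prob ?E \<le> prob {\<omega> \<in> space M. exp (h * ?t) \<le> (\<Prod>j\<in>J. \<zeta> j \<omega>)}"
  proof (rule finite_measure_mono)
    show "?E \<subseteq> {\<omega> \<in> space M. exp (h * ?t) \<le> (\<Prod>j\<in>J. \<zeta> j \<omega>)}"
    proof safe
      fix \<omega> assume \<omega>: "?t < (\<Sum>j\<in>J. \<xi> j \<omega>)" "\<forall>j\<in>J. \<xi> j \<omega> \<le> y"
      have "(\<Prod>j\<in>J. \<zeta> j \<omega>) = (\<Prod>j\<in>J. exp (h * \<xi> j \<omega>))"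
        using \<omega> by (intro prod.cong) (auto simp: \<zeta>_def)
      also have "\<dots> = exp (h * (\<Sum>j\<in>J. \<xi> j \<omega>))"
        using J by (simp add: exp_sum sum_distrib_left)
      finally show "exp (h * ?t) \<le> (\<Prod>j\<in>J. \<zeta> j \<omega>)"
        using \<omega> h by (simp add: mult_left_mono)
    qed
  qed measurable
  also have "\<dots> \<le> expectation (\<lambda>\<omega>. \<Prod>j\<in>J. \<zeta> j \<omega>) / exp (h * ?t)"
    using J \<zeta>_indep \<zeta>_int
    by (intro integral_Markov_inequality_measure[where A = "{}"] indep_vars_integrable)
       (auto intro!: prod_nonneg AE_I2 \<zeta>_nonneg)
  also have "expectation (\<lambda>\<omega>. \<Prod>j\<in>J. \<zeta> j \<omega>) = m ^ card J"
    using J \<zeta>_indep \<zeta>_int by (subst indep_vars_lebesgue_integral) (auto simp: \<zeta>_mean)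
  also have "m ^ card J / exp (h * ?t) \<le> exp (w + 4) / exp (h * ?t)"
  proof (rule divide_right_mono)
    have "m ^ card J \<le> exp \<bar>b\<bar> ^ card J" using m m_exp by (intro power_mono)
    also have "\<dots> = exp (real (card J) * \<bar>b\<bar>)" by (simp add: exp_of_nat_mult)
    also have "\<dots> \<le> exp (real n * \<bar>b\<bar>)" using J by (simp add: mult_right_mono)
    also have "\<dots> \<le> exp (w + 4)" using nb by simp
    finally show "m ^ card J \<le> exp (w + 4)" .
  qed simp
  also have "h * ?t = (2 * real p + 1) * w" unfolding h(2)[symmetric] by (simp add: mult_ac)
  also have "exp (w + 4) / exp ((2 * real p + 1) * w) = exp (4 + real p * (- 2 * w))"
    by (simp add: algebra_simps flip: exp_diff)
  also have "\<dots> = exp 4 * q ^ p" unfolding q_eq exp_add by (simp only: exp_of_nat_mult)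
  finally show ?thesis unfolding q_def .
qed

lemma sum_concentration:
  assumes T: "0 < T"
  obtains C where "0 < C"
    "\<And>J n a w. finite J \<Longrightarrow> J \<subseteq> {1..} \<Longrightarrow> x0 \<le> a \<Longrightarrow> real n * Q_fun F a = 1 \<Longrightarrow> n \<le> 3 * card J
      \<Longrightarrow> measure (distr M borel (\<lambda>\<omega>. \<Sum>j\<in>J. \<xi> j \<omega>)) {y. \<bar>y - w\<bar> \<le> T} \<le> C / a"
proof -
  obtain C where C: "0 < C" "\<And>H n k a w. real_distribution H \<Longrightarrow> (\<And>t. char H t = char F t ^ k) \<Longrightarrow> x0 \<le> a
      \<Longrightarrow> real n * Q_fun F a = 1 \<Longrightarrow> n \<le> 3 * k \<Longrightarrow> measure H {y. \<bar>y - w\<bar> \<le> T} \<le> C / a"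
    using F.concentration_bound[OF T] by blast
  show ?thesis
  proof (rule that[OF C(1)])
    fix J :: "nat set" and n :: nat and a w :: real
    assume J: "finite J" "J \<subseteq> {1..}" and a: "x0 \<le> a" "real n * Q_fun F a = 1" "n \<le> 3 * card J"
    have "char (distr M borel (\<lambda>\<omega>. \<Sum>j\<in>J. \<xi> j \<omega>)) t = char F t ^ card J" for t
    proof -
      have "char (distr M borel (\<lambda>\<omega>. \<Sum>j\<in>J. \<xi> j \<omega>)) t = (\<Prod>j\<in>J. char (distr M borel (\<xi> j)) t)"
        by (rule char_distr_sum[OF indep_vars_subset[OF indep J(2)]])
      also have "\<dots> = (\<Prod>j\<in>J. char F t)" using J law by (intro prod.cong) auto
      finally show ?thesis by simp
    qed
    then show "measure (distr M borel (\<lambda>\<omega>. \<Sum>j\<in>J. \<xi> j \<omega>)) {y. \<bar>y - w\<bar> \<le> T} \<le> C / a"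
      using sum_measurable[OF J(2)] a by (intro C(2)) auto
  qed
qed

end

section \<open>Sums without a big jump\<close>

lemma (in prob_space) prob_conj_ge:
  assumes "{\<omega> \<in> space M. P \<omega>} \<in> events" "{\<omega> \<in> space M. Q \<omega>} \<in> events"
  shows "1 - prob {\<omega> \<in> space M. \<not> P \<omega>} - prob {\<omega> \<in> space M. \<not> Q \<omega>} \<le> prob {\<omega> \<in> space M. P \<omega> \<and> Q \<omega>}"
proof -
  let ?P = "{\<omega> \<in> space M. P \<omega>}" and ?Q = "{\<omega> \<in> space M. Q \<omega>}"
  have "{\<omega> \<in> space M. \<not> P \<omega>} = space M - ?P" "{\<omega> \<in> space M. \<not> Q \<omega>} = space M - ?Q"
    "{\<omega> \<in> space M. P \<omega> \<and> Q \<omega>} = ?P \<inter> ?Q"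
    by auto
  moreover have "prob (?P \<union> ?Q) = prob ?P + prob ?Q - prob (?P \<inter> ?Q)"
    using assms by (intro measure_Un3) (auto simp: fmeasurable_eq_sets)
  ultimately show ?thesis
    using assms prob_le_1[of "?P \<union> ?Q"] by (simp add: prob_compl)
qed

section \<open>Conditioning on a block; paths all of whose steps are moderate\<close>

context iid_walk
begin

text \<open>Given the steps in \<open>I\<close>, the full sum lies in \<open>D\<close> exactly if
  the sum over \<open>J\<close> lies in a translate of \<open>D\<close>. \<open>E\<close> allows a
  further restriction on the latter; it is used when \<open>J\<close> consists of one large
  step.\<close>

lemma
  assumes IJ: "I \<inter> J = {}" "I \<union> J = {1..n}" and D: "D \<in> sets borel" and E: "E \<in> sets borel"
    and P [measurable]: "Measurable.pred (PiM I (\<lambda>_. borel)) P" and c: "0 \<le> c"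
  shows prob_block_sections_le: "(\<And>x. P x \<Longrightarrow>
      measure (distr M borel (\<lambda>\<omega>. \<Sum>j\<in>J. \<xi> j \<omega>)) {y \<in> E. (\<Sum>i\<in>I. x i) + y \<in> D} \<le> c) \<Longrightarrow>
      prob {\<omega> \<in> space M. P (\<lambda>i\<in>I. \<xi> i \<omega>) \<and> (\<Sum>j\<in>J. \<xi> j \<omega>) \<in> E \<and> (\<Sum>i=1..n. \<xi> i \<omega>) \<in> D}
        \<le> c * prob {\<omega> \<in> space M. P (\<lambda>i\<in>I. \<xi> i \<omega>)}"
    and prob_block_sections_ge: "(\<And>x. P x \<Longrightarrow>
      c \<le> measure (distr M borel (\<lambda>\<omega>. \<Sum>j\<in>J. \<xi> j \<omega>)) {y \<in> E. (\<Sum>i\<in>I. x i) + y \<in> D}) \<Longrightarrow>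
      c * prob {\<omega> \<in> space M. P (\<lambda>i\<in>I. \<xi> i \<omega>)} \<le>
      prob {\<omega> \<in> space M. P (\<lambda>i\<in>I. \<xi> i \<omega>) \<and> (\<Sum>j\<in>J. \<xi> j \<omega>) \<in> E \<and> (\<Sum>i=1..n. \<xi> i \<omega>) \<in> D}"
proof -
  let ?N = "PiM I (\<lambda>_. borel :: real measure)" and ?X = "\<lambda>\<omega>. \<lambda>i\<in>I. \<xi> i \<omega>" and ?Y = "\<lambda>\<omega>. \<Sum>j\<in>J. \<xi> j \<omega>"
  have "finite (I \<union> J)" unfolding IJ(2) by simp
  then have fin: "finite I" "finite J" by auto
  have "I \<union> J \<subseteq> {1..}" using IJ by auto
  then have sub: "I \<subseteq> {1..}" "J \<subseteq> {1..}" by auto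
  have X: "?X \<in> measurable M ?N" using sub step_measurable by (intro measurable_restrict) auto
  have Y: "?Y \<in> borel_measurable M" by (rule sum_measurable[OF sub(2)])
  have pair: "distr M ?N ?X \<Otimes>\<^sub>M distr M borel ?Y = distr M (?N \<Otimes>\<^sub>M borel) (\<lambda>\<omega>. (?X \<omega>, ?Y \<omega>))"
    by (rule distr_steps_sum[OF IJ(1) sub])
  define Z where "Z = {x \<in> space ?N. P x}"
  have Z: "Z \<in> sets ?N" unfolding Z_def by measurable
  define A where "A = {p \<in> space (?N \<Otimes>\<^sub>M borel). snd p \<in> E \<and> (\<Sum>i\<in>I. fst p i) + snd p \<in> D}"
  have A: "A \<in> sets (?N \<Otimes>\<^sub>M borel)" unfolding A_def using D E by measurable
  have X_space: "?X \<omega> \<in> space ?N" if "\<omega> \<in> space M" for \<omega>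
    using measurable_space[OF X that] .
  have sum_eq: "(\<Sum>i=1..n. \<xi> i \<omega>) = (\<Sum>i\<in>I. ?X \<omega> i) + ?Y \<omega>" for \<omega>
    using sum.union_disjoint[OF fin IJ(1), of "\<lambda>i. \<xi> i \<omega>"] unfolding IJ(2) by simp
  have ev1: "{\<omega> \<in> space M. ?X \<omega> \<in> Z \<and> (?X \<omega>, ?Y \<omega>) \<in> A}
      = {\<omega> \<in> space M. P (?X \<omega>) \<and> ?Y \<omega> \<in> E \<and> (\<Sum>i=1..n. \<xi> i \<omega>) \<in> D}"
    unfolding sum_eq using X_space by (auto simp: A_def Z_def space_pair_measure)
  have ev2: "{\<omega> \<in> space M. ?X \<omega> \<in> Z} = {\<omega> \<in> space M. P (?X \<omega>)}"
    using X_space by (auto simp: Z_def)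
  have cut: "Pair x -` A = {y \<in> E. (\<Sum>i\<in>I. x i) + y \<in> D}" if "x \<in> Z" for x
    using that by (auto simp: A_def Z_def space_pair_measure)
  {
    assume *: "\<And>x. P x \<Longrightarrow> measure (distr M borel ?Y) {y \<in> E. (\<Sum>i\<in>I. x i) + y \<in> D} \<le> c"
    have "\<And>x. x \<in> Z \<Longrightarrow> measure (distr M borel ?Y) (Pair x -` A) \<le> c"
      using * by (simp add: cut) (simp add: Z_def)
    from prob_sections_le[OF X Y pair Z A c this]
    show "prob {\<omega> \<in> space M. P (?X \<omega>) \<and> ?Y \<omega> \<in> E \<and> (\<Sum>i=1..n. \<xi> i \<omega>) \<in> D} \<le> c * prob {\<omega> \<in> space M. P (?X \<omega>)}"
      unfolding ev1 ev2 .
  next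
    assume *: "\<And>x. P x \<Longrightarrow> c \<le> measure (distr M borel ?Y) {y \<in> E. (\<Sum>i\<in>I. x i) + y \<in> D}"
    have "\<And>x. x \<in> Z \<Longrightarrow> c \<le> measure (distr M borel ?Y) (Pair x -` A)"
      using * by (simp add: cut) (simp add: Z_def)
    from prob_sections_ge[OF X Y pair Z A c this]
    show "c * prob {\<omega> \<in> space M. P (?X \<omega>)} \<le> prob {\<omega> \<in> space M. P (?X \<omega>) \<and> ?Y \<omega> \<in> E \<and> (\<Sum>i=1..n. \<xi> i \<omega>) \<in> D}"
      unfolding ev1 ev2 .
  }
qed

text \<open>\<open>a\<close> stands for \<open>a\<^sub>n\<close>, described by the properties in use
  rather than by \<open>norming_seq\<close>, with \<open>n\<close> and \<open>a\<close> free so that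
  constants can be chosen before them. \<open>2 \<le> n\<close> guarantees at least
  \<open>n / 3\<close> steps in each half.\<close>

definition normed :: "real \<Rightarrow> nat \<Rightarrow> real \<Rightarrow> bool" where
  "normed L n a \<longleftrightarrow> 2 \<le> n \<and> x0 \<le> a \<and> real n * Q_fun F a = 1 \<and> real n * \<bar>trunc_mean F a\<bar> \<le> L * a"

lemma normed_pos: "normed L n a \<Longrightarrow> 0 < a"
  using F.x0_pos by (auto simp: normed_def)

text \<open>Truncating at \<open>\<delta> * x\<close> turns the threshold
  \<open>(2 * p + 1) * (\<delta> * x)\<close> into \<open>x / 2\<close>; replacing
  \<open>Q (\<delta> * x)\<close> by \<open>Q x\<close> costs the factor
  \<open>1 / \<delta>\<^sup>2\<close>.\<close>

lemma block_tail:
  fixes p :: nat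
  assumes L: "0 \<le> L"
  defines "\<delta> \<equiv> 1 / (2 * (2 * real p + 1))"
  obtains C \<rho> where "0 < C" "0 < \<rho>"
    "\<And>n a J x. normed L n a \<Longrightarrow> J \<subseteq> {1..n} \<Longrightarrow> 0 < x \<Longrightarrow> real n * Q_fun F x \<le> \<rho> \<Longrightarrow>
      prob {\<omega> \<in> space M. x / 2 < (\<Sum>j\<in>J. \<xi> j \<omega>) \<and> (\<forall>j\<in>J. \<xi> j \<omega> \<le> \<delta> * x)}
        \<le> C * (real n * Q_fun F x) ^ p"
proof -
  have \<delta>: "0 < \<delta>" "\<delta> \<le> 1" "(2 * real p + 1) * \<delta> = 1 / 2"
    by (simp_all add: \<delta>_def add_pos_nonneg)
  obtain \<rho>1 where \<rho>1: "0 < \<rho>1" "\<And>n a y. real n * Q_fun F a = 1 \<Longrightarrow> 0 < a \<Longrightarrow> real n * \<bar>trunc_mean F a\<bar> \<le> L * a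
    \<Longrightarrow> 0 < y \<Longrightarrow> real n * Q_fun F y \<le> \<rho>1 \<Longrightarrow> real n * \<bar>trunc_mean F y\<bar> \<le> 1 * y"
    using F.trunc_mean_small[OF L, of 1] by auto
  define \<rho>2 where "\<rho>2 = min \<rho>1 (1 / 2)"
  have \<rho>2: "0 < \<rho>2" "\<rho>2 \<le> \<rho>1" "\<rho>2 < 1" using \<rho>1 by (auto simp: \<rho>2_def)
  show ?thesis
  proof (rule that[of "exp 4 / \<delta>\<^sup>2 ^ p" "\<rho>2 * \<delta>\<^sup>2"])
    fix n a J x
    assume na: "normed L n a" and J: "J \<subseteq> {1..n}" and x: "0 < x"
      and q: "real n * Q_fun F x \<le> \<rho>2 * \<delta>\<^sup>2"
    have "\<delta> * x \<le> x" using \<delta> x by simp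
    have "real n * Q_fun F (\<delta> * x) \<le> real n * ((x / (\<delta> * x))\<^sup>2 * Q_fun F x)"
      using \<delta> x \<open>\<delta> * x \<le> x\<close> by (intro mult_left_mono F.Q_fun_le_scale) auto
    also have "\<dots> = real n * Q_fun F x / \<delta>\<^sup>2" using x by (simp add: power_divide)
    finally have q': "real n * Q_fun F (\<delta> * x) \<le> real n * Q_fun F x / \<delta>\<^sup>2" .
    also have "\<dots> \<le> \<rho>2" using q \<delta> by (simp add: divide_le_eq)
    finally have q1: "real n * Q_fun F (\<delta> * x) \<le> \<rho>1" "real n * Q_fun F (\<delta> * x) < 1" using \<rho>2 by auto
    have fin: "finite J" using J finite_subset by auto
    have "card J \<le> n" using card_mono[OF _ J] by simp
    have mean: "real n * \<bar>trunc_mean F (\<delta> * x)\<bar> \<le> \<delta> * x"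
      using \<rho>1(2)[of n a "\<delta> * x"] na normed_pos[OF na] q1 \<delta> x by (simp add: normed_def)
    have scale: "(2 * real p + 1) * (\<delta> * x) = x / 2" using \<delta>(3) by (metis mult.assoc times_divide_eq_left mult_1)
    then have "prob {\<omega> \<in> space M. x / 2 < (\<Sum>j\<in>J. \<xi> j \<omega>) \<and> (\<forall>j\<in>J. \<xi> j \<omega> \<le> \<delta> * x)}
        = prob {\<omega> \<in> space M. (2 * real p + 1) * (\<delta> * x) < (\<Sum>j\<in>J. \<xi> j \<omega>) \<and> (\<forall>j\<in>J. \<xi> j \<omega> \<le> \<delta> * x)}"
      by (simp only: scale)
    also have "\<dots> \<le> exp 4 * (real n * Q_fun F (\<delta> * x)) ^ p"
      using fin J \<open>card J \<le> n\<close> na \<delta> x q1 mean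
      by (intro prob_sum_exceeds_truncated) (auto simp: normed_def)
    also have "\<dots> \<le> exp 4 * (real n * Q_fun F x / \<delta>\<^sup>2) ^ p"
      using q' by (intro mult_left_mono power_mono) auto
    finally show "prob {\<omega> \<in> space M. x / 2 < (\<Sum>j\<in>J. \<xi> j \<omega>) \<and> (\<forall>j\<in>J. \<xi> j \<omega> \<le> \<delta> * x)}
        \<le> exp 4 / \<delta>\<^sup>2 ^ p * (real n * Q_fun F x) ^ p"
      by (simp add: power_divide)
  qed (use \<delta> \<rho>2 in auto)
qed

text \<open>Finite and infinite \<open>T\<close> need different proofs of this property but share
  the argument built on it. \<open>\<rho>\<close> and \<open>X\<close> precede \<open>n\<close>,
  \<open>a\<close> and \<open>x\<close>, which encodes the uniformity.\<close>

definition no_jump_negligible :: "real \<Rightarrow> ereal \<Rightarrow> real \<Rightarrow> bool" where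
  "no_jump_negligible L T \<delta> \<longleftrightarrow> 0 < \<delta> \<and> \<delta> \<le> 1 \<and> (\<forall>\<eta>>0. \<exists>\<rho>>0. \<exists>X>0. \<forall>n a x.
    normed L n a \<longrightarrow> X \<le> x \<longrightarrow> real n * Q_fun F x \<le> \<rho> \<longrightarrow>
      prob {\<omega> \<in> space M. (\<Sum>i=1..n. \<xi> i \<omega>) \<in> shifted_Delta T x \<and> (\<forall>i\<in>{1..n}. \<xi> i \<omega> \<le> \<delta> * x)}
        \<le> \<eta> * (real n * local_prob F T x))"

lemma events_conj_all:
  assumes "J \<subseteq> {1..}" "I \<subseteq> {1..}" "finite J" "D \<in> sets borel"
  shows "{\<omega> \<in> space M. (\<Sum>i\<in>I. \<xi> i \<omega>) \<in> D \<and> (\<forall>j\<in>J. \<xi> j \<omega> \<le> b)} \<in> events"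
proof -
  have [measurable]: "\<xi> j \<in> borel_measurable M" if "j \<in> I \<union> J" for j
    using that assms by (intro step_measurable) auto
  note [measurable] = assms(4)
  show ?thesis using assms(3) by measurable
qed

text \<open>Two powers of \<open>n * Q x\<close> suffice: one is comparable with
  \<open>n * tail F x\<close>, the other is small. \<open>1 / 10\<close> is the
  \<open>\<delta>\<close> of \<open>block_tail\<close> for \<open>p = 2\<close>.\<close>

lemma no_jump_negligible_infinity:
  assumes L: "0 \<le> L"
  shows "no_jump_negligible L \<infinity> (1 / 10)"
proof -
  obtain C \<rho> where C: "0 < C" and \<rho>: "0 < \<rho>" and tail:
    "\<And>n a J x. normed L n a \<Longrightarrow> J \<subseteq> {1..n} \<Longrightarrow> 0 < x \<Longrightarrow> real n * Q_fun F x \<le> \<rho> \<Longrightarrow>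
      prob {\<omega> \<in> space M. x / 2 < (\<Sum>j\<in>J. \<xi> j \<omega>) \<and> (\<forall>j\<in>J. \<xi> j \<omega> \<le> 1 / 10 * x)}
        \<le> C * (real n * Q_fun F x) ^ 2"
    using block_tail[OF L, of 2] by auto
  let ?K = "(K + 1) * K"
  have K: "0 < ?K" using F.K_ge_1 by simp
  have "\<exists>\<rho>'>0. \<exists>X>0. \<forall>n a x. normed L n a \<longrightarrow> X \<le> x \<longrightarrow> real n * Q_fun F x \<le> \<rho>' \<longrightarrow>
      prob {\<omega> \<in> space M. (\<Sum>i=1..n. \<xi> i \<omega>) \<in> shifted_Delta \<infinity> x \<and> (\<forall>i\<in>{1..n}. \<xi> i \<omega> \<le> 1 / 10 * x)}
        \<le> \<eta> * (real n * local_prob F \<infinity> x)" if \<eta>: "0 < \<eta>" for \<eta>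
  proof (intro exI conjI allI impI)
    show "0 < min \<rho> (\<eta> / (C * ?K))" using \<rho> \<eta> C K by simp
    show "0 < x0" by (rule F.x0_pos)
    fix n a x assume na: "normed L n a" and x: "x0 \<le> x" and q: "real n * Q_fun F x \<le> min \<rho> (\<eta> / (C * ?K))"
    have x': "0 < x" using x F.x0_pos by simp
    have "prob {\<omega> \<in> space M. (\<Sum>i=1..n. \<xi> i \<omega>) \<in> shifted_Delta \<infinity> x \<and> (\<forall>i\<in>{1..n}. \<xi> i \<omega> \<le> 1 / 10 * x)}
        \<le> prob {\<omega> \<in> space M. (\<Sum>i=1..n. \<xi> i \<omega>) \<in> {x / 2<..} \<and> (\<forall>i\<in>{1..n}. \<xi> i \<omega> \<le> 1 / 10 * x)}"
      using x' by (intro finite_measure_mono events_conj_all) (auto simp: shifted_Delta_infinity)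
    also have "\<dots> \<le> C * (real n * Q_fun F x) ^ 2"
      using tail[OF na order_refl x'] q by simp
    also have "\<dots> = (C * (real n * Q_fun F x)) * (real n * Q_fun F x)"
      by (simp add: power2_eq_square)
    also have "\<dots> \<le> (\<eta> / ?K) * (real n * (?K * tail F x))"
    proof (rule mult_mono)
      have "C * (real n * Q_fun F x) \<le> C * (\<eta> / (C * ?K))"
        using q C by (intro mult_left_mono) auto
      then show "C * (real n * Q_fun F x) \<le> \<eta> / ?K" using C by simp
      show "real n * Q_fun F x \<le> real n * (?K * tail F x)"
        using F.Q_fun_le_tail[OF x] by (intro mult_left_mono) auto
    qed (use \<eta> K in auto)
    also have "\<dots> = \<eta> * (real n * local_prob F \<infinity> x)"
      using F.K_ge_1 by (simp add: local_prob_infinity)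
    finally show "prob {\<omega> \<in> space M. (\<Sum>i=1..n. \<xi> i \<omega>) \<in> shifted_Delta \<infinity> x \<and> (\<forall>i\<in>{1..n}. \<xi> i \<omega> \<le> 1 / 10 * x)}
        \<le> \<eta> * (real n * local_prob F \<infinity> x)" .
  qed
  then show ?thesis unfolding no_jump_negligible_def by auto
qed

lemma no_jump_negligible_finite:
  assumes L: "0 \<le> L" and t: "0 < t" and X: "0 < X" and D: "0 < D"
    and tail_le: "\<And>x. X \<le> x \<Longrightarrow> tail F x \<le> D * x * local_prob F (ereal t) x"
  obtains \<delta> where "no_jump_negligible L (ereal t) \<delta>"
proof -
  obtain \<theta> \<gamma> where \<theta>: "0 < \<theta>" and \<gamma>: "0 < \<gamma>" and decay:
    "\<And>x y. x0 \<le> x \<Longrightarrow> x \<le> y \<Longrightarrow> Q_fun F y \<le> \<theta> * (x / y) powr \<gamma> * Q_fun F x"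
    using F.Q_fun_decay by blast
  \<comment> \<open>\<open>\<gamma> * k \<ge> 1\<close> makes the power of order \<open>k\<close> of
    the decay bound at most linear in \<open>a / x\<close>.\<close>
  define k where "k = nat \<lceil>1 / \<gamma>\<rceil>"
  have "1 / \<gamma> \<le> real k" unfolding k_def by linarith
  then have k: "1 \<le> \<gamma> * real k" using \<gamma> by (simp add: field_simps)
  define \<delta> where "\<delta> = 1 / (2 * (2 * real (k + 2) + 1))"
  have \<delta>: "0 < \<delta>" "\<delta> \<le> 1" by (simp_all add: \<delta>_def)
  obtain C \<rho> where C: "0 < C" and \<rho>: "0 < \<rho>" and tail:
    "\<And>n a J x. normed L n a \<Longrightarrow> J \<subseteq> {1..n} \<Longrightarrow> 0 < x \<Longrightarrow> real n * Q_fun F x \<le> \<rho> \<Longrightarrow>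
      prob {\<omega> \<in> space M. x / 2 < (\<Sum>j\<in>J. \<xi> j \<omega>) \<and> (\<forall>j\<in>J. \<xi> j \<omega> \<le> \<delta> * x)}
        \<le> C * (real n * Q_fun F x) ^ (k + 2)"
    unfolding \<delta>_def using block_tail[OF L, of "k + 2"] by blast
  obtain B where B: "0 < B" and conc:
    "\<And>J n a w. finite J \<Longrightarrow> J \<subseteq> {1..} \<Longrightarrow> x0 \<le> a \<Longrightarrow> real n * Q_fun F a = 1 \<Longrightarrow> n \<le> 3 * card J
      \<Longrightarrow> measure (distr M borel (\<lambda>\<omega>. \<Sum>j\<in>J. \<xi> j \<omega>)) {y. \<bar>y - w\<bar> \<le> t} \<le> B / a"
    using sum_concentration[OF t] by blast
  let ?K = "(K + 1) * K"
  have K: "0 < ?K" using F.K_ge_1 by simp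
  define c where "c = 2 * B * C * \<theta> ^ k * ?K * D"
  have c: "0 < c" using B C \<theta> K D by (simp add: c_def)
  \<comment> \<open>\<open>I\<close> carries the excess, \<open>J\<close> the concentration: given
    the steps in \<open>I\<close>, the sum over \<open>J\<close> must lie within \<open>t\<close> of
    a fixed point.\<close>
  have block: "prob {\<omega> \<in> space M. (x / 2 < (\<Sum>j\<in>I. \<xi> j \<omega>) \<and> (\<forall>j\<in>I. \<xi> j \<omega> \<le> \<delta> * x))
        \<and> (\<Sum>i=1..n. \<xi> i \<omega>) \<in> shifted_Delta (ereal t) x}
      \<le> B / a * (C * (real n * Q_fun F x) ^ (k + 2))"
    if na: "normed L n a" and x: "0 < x" and q: "real n * Q_fun F x \<le> \<rho>"
      and IJ: "I \<inter> J = {}" "I \<union> J = {1..n}" "n \<le> 3 * card J" for n a x I J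
  proof -
    have "finite (I \<union> J)" unfolding IJ(2) by simp
    then have fin: "finite I" "finite J" by auto
    have "I \<union> J \<subseteq> {1..}" using IJ by auto
    then have sub: "I \<subseteq> {1..}" "J \<subseteq> {1..}" by auto
    interpret Y: prob_space "distr M borel (\<lambda>\<omega>. \<Sum>j\<in>J. \<xi> j \<omega>)"
      by (rule prob_space_distr[OF sum_measurable[OF sub(2)]])
    have "prob {\<omega> \<in> space M. (\<lambda>f. x / 2 < (\<Sum>j\<in>I. f j) \<and> (\<forall>j\<in>I. f j \<le> \<delta> * x)) (\<lambda>i\<in>I. \<xi> i \<omega>)
        \<and> (\<Sum>j\<in>J. \<xi> j \<omega>) \<in> UNIV \<and> (\<Sum>i=1..n. \<xi> i \<omega>) \<in> shifted_Delta (ereal t) x}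
      \<le> B / a * prob {\<omega> \<in> space M. (\<lambda>f. x / 2 < (\<Sum>j\<in>I. f j) \<and> (\<forall>j\<in>I. f j \<le> \<delta> * x)) (\<lambda>i\<in>I. \<xi> i \<omega>)}"
    proof (rule prob_block_sections_le[OF IJ(1,2)])
      show "Measurable.pred (PiM I (\<lambda>_. borel)) (\<lambda>f. x / 2 < (\<Sum>j\<in>I. f j) \<and> (\<forall>j\<in>I. f j \<le> \<delta> * x))"
        using fin by measurable
      show "0 \<le> B / a" using B normed_pos[OF na] by simp
      fix f :: "nat \<Rightarrow> real"
      have "measure (distr M borel (\<lambda>\<omega>. \<Sum>j\<in>J. \<xi> j \<omega>)) {y \<in> UNIV. (\<Sum>i\<in>I. f i) + y \<in> shifted_Delta (ereal t) x}
          \<le> measure (distr M borel (\<lambda>\<omega>. \<Sum>j\<in>J. \<xi> j \<omega>)) {y. \<bar>y - (x - (\<Sum>i\<in>I. f i))\<bar> \<le> t}"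
        by (rule Y.finite_measure_mono) (auto simp: shifted_Delta_ereal)
      also have "\<dots> \<le> B / a"
        using na fin sub IJ by (intro conc) (auto simp: normed_def)
      finally show "measure (distr M borel (\<lambda>\<omega>. \<Sum>j\<in>J. \<xi> j \<omega>))
          {y \<in> UNIV. (\<Sum>i\<in>I. f i) + y \<in> shifted_Delta (ereal t) x} \<le> B / a" .
    qed auto
    also have "\<dots> \<le> B / a * (C * (real n * Q_fun F x) ^ (k + 2))"
    proof (rule mult_left_mono)
      show "prob {\<omega> \<in> space M. (\<lambda>f. x / 2 < (\<Sum>j\<in>I. f j) \<and> (\<forall>j\<in>I. f j \<le> \<delta> * x)) (\<lambda>i\<in>I. \<xi> i \<omega>)}
          \<le> C * (real n * Q_fun F x) ^ (k + 2)"
        using tail[OF na _ x q, of I] IJ by auto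
    qed (use B normed_pos[OF na] in simp)
    finally show ?thesis by simp
  qed
  have "\<exists>\<rho>'>0. \<exists>X>0. \<forall>n a x. normed L n a \<longrightarrow> X \<le> x \<longrightarrow> real n * Q_fun F x \<le> \<rho>' \<longrightarrow>
      prob {\<omega> \<in> space M. (\<Sum>i=1..n. \<xi> i \<omega>) \<in> shifted_Delta (ereal t) x \<and> (\<forall>i\<in>{1..n}. \<xi> i \<omega> \<le> \<delta> * x)}
        \<le> \<eta> * (real n * local_prob F (ereal t) x)" if \<eta>: "0 < \<eta>" for \<eta>
  proof (intro exI conjI allI impI)
    show "0 < min \<rho> (min (1 / 2) (\<eta> / c))" using \<rho> \<eta> c by simp
    show "0 < max x0 X" using X by simp
    fix n a x assume na: "normed L n a" and x: "max x0 X \<le> x"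
      and q: "real n * Q_fun F x \<le> min \<rho> (min (1 / 2) (\<eta> / c))"
    define r where "r = real n * Q_fun F x"
    have x': "0 < x" using x X by simp
    have n: "2 \<le> n" and a: "x0 \<le> a" "real n * Q_fun F a = 1" using na by (auto simp: normed_def)
    have a': "0 < a" by (rule normed_pos[OF na])
    have r: "0 < r" "r \<le> \<rho>" "r < 1" "r \<le> \<eta> / c"
      using q n F.Q_fun_pos[of x] by (auto simp: r_def)
    have ax: "a < x" using a(2) x' r(3) unfolding r_def by (rule F.norming_less)
    let ?A = "\<lambda>J. {\<omega> \<in> space M. (x / 2 < (\<Sum>j\<in>J. \<xi> j \<omega>) \<and> (\<forall>j\<in>J. \<xi> j \<omega> \<le> \<delta> * x))
        \<and> (\<Sum>i=1..n. \<xi> i \<omega>) \<in> shifted_Delta (ereal t) x}"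
    define m where "m = n div 2"
    define I J where "I = {1..m}" and "J = {m + 1..n}"
    have IJ: "I \<inter> J = {}" "I \<union> J = {1..n}" "n \<le> 3 * card J" "n \<le> 3 * card I"
      using n by (auto simp: I_def J_def m_def)
    have A_events: "?A H \<in> events" if "H \<subseteq> {1..n}" for H
    proof -
      have H: "H \<subseteq> {1..}" "finite H" using that finite_subset by auto
      have [measurable]: "\<xi> j \<in> borel_measurable M" if "j \<in> {1..n} \<union> H" for j
        using that H by (intro step_measurable) auto
      show ?thesis using H(2) by measurable
    qed
    \<comment> \<open>This is the decay of \<open>Q\<close> from \<open>a\<close> to
      \<open>x\<close>, with \<open>n * Q a = 1\<close>; as \<open>a / x < 1\<close>, the exponent
      \<open>\<gamma> * k\<close> may be lowered to 1. The \<open>a\<close> gained here cancels the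
      \<open>1 / a\<close> of the concentration bound.\<close>
    have "r ^ k \<le> \<theta> ^ k * (a / x)"
    proof -
      have "r \<le> real n * (\<theta> * (a / x) powr \<gamma> * Q_fun F a)"
        unfolding r_def using ax a by (intro mult_left_mono decay) auto
      also have "\<dots> = \<theta> * (a / x) powr \<gamma> * (real n * Q_fun F a)" by simp
      finally have "r \<le> \<theta> * (a / x) powr \<gamma>" unfolding a(2) by simp
      then have "r ^ k \<le> (\<theta> * (a / x) powr \<gamma>) ^ k" using r by (intro power_mono) auto
      also have "\<dots> = \<theta> ^ k * (a / x) powr (\<gamma> * real k)"
        using a' x' by (simp add: power_mult_distrib powr_powr flip: powr_realpow)
      also have "\<dots> \<le> \<theta> ^ k * (a / x) powr 1"
        using a' x' ax k \<theta> by (intro mult_left_mono powr_mono') auto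
      finally show ?thesis using a' x' by simp
    qed
    have "prob {\<omega> \<in> space M. (\<Sum>i=1..n. \<xi> i \<omega>) \<in> shifted_Delta (ereal t) x \<and> (\<forall>i\<in>{1..n}. \<xi> i \<omega> \<le> \<delta> * x)}
        \<le> prob (?A I \<union> ?A J)"
    proof (rule finite_measure_mono)
      show "{\<omega> \<in> space M. (\<Sum>i=1..n. \<xi> i \<omega>) \<in> shifted_Delta (ereal t) x \<and> (\<forall>i\<in>{1..n}. \<xi> i \<omega> \<le> \<delta> * x)}
          \<subseteq> ?A I \<union> ?A J"
      proof
        fix \<omega>
        assume \<omega>: "\<omega> \<in> {\<omega> \<in> space M. (\<Sum>i=1..n. \<xi> i \<omega>) \<in> shifted_Delta (ereal t) x \<and> (\<forall>i\<in>{1..n}. \<xi> i \<omega> \<le> \<delta> * x)}"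
        have "(\<Sum>i=1..n. \<xi> i \<omega>) = (\<Sum>i\<in>I. \<xi> i \<omega>) + (\<Sum>i\<in>J. \<xi> i \<omega>)"
          unfolding IJ(2)[symmetric] by (rule sum.union_disjoint) (auto simp: I_def J_def)
        moreover have "x < (\<Sum>i=1..n. \<xi> i \<omega>)" using \<omega> by (simp add: shifted_Delta_ereal)
        ultimately have "x / 2 < (\<Sum>i\<in>I. \<xi> i \<omega>) \<or> x / 2 < (\<Sum>i\<in>J. \<xi> i \<omega>)" by linarith
        moreover have "\<forall>i\<in>I. \<xi> i \<omega> \<le> \<delta> * x" "\<forall>i\<in>J. \<xi> i \<omega> \<le> \<delta> * x" using \<omega> IJ(2) by auto
        ultimately show "\<omega> \<in> ?A I \<union> ?A J" using \<omega> by blast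
      qed
      show "?A I \<union> ?A J \<in> events" using IJ(2) by (intro sets.Un A_events) auto
    qed
    also have "\<dots> \<le> prob (?A I) + prob (?A J)"
      using IJ(2) by (intro measure_Un_le A_events) auto
    also have "\<dots> \<le> B / a * (C * r ^ (k + 2)) + B / a * (C * r ^ (k + 2))"
      unfolding r_def using na x' r IJ
      by (intro add_mono block[of n a x I J] block[of n a x J I]) (auto simp: r_def Int_commute Un_commute)
    also have "\<dots> = 2 * B * C / a * r\<^sup>2 * r ^ k" by (simp add: power_add power2_eq_square)
    also have "\<dots> \<le> 2 * B * C / a * r\<^sup>2 * (\<theta> ^ k * (a / x))"
      using \<open>r ^ k \<le> \<theta> ^ k * (a / x)\<close> B C a' by (intro mult_left_mono) auto
    also have "\<dots> = 2 * B * C * \<theta> ^ k * r * (r / x)" using a' by (simp add: power2_eq_square)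
    also have "\<dots> \<le> 2 * B * C * \<theta> ^ k * r * (real n * (?K * D * local_prob F (ereal t) x))"
    proof (rule mult_left_mono)
      have "r \<le> real n * (?K * tail F x)"
        unfolding r_def using x by (intro mult_left_mono F.Q_fun_le_tail) auto
      also have "\<dots> \<le> real n * (?K * (D * x * local_prob F (ereal t) x))"
        using x K by (intro mult_left_mono tail_le) auto
      finally show "r / x \<le> real n * (?K * D * local_prob F (ereal t) x)"
        using x' by (simp add: divide_le_eq mult_ac)
    qed (use B C \<theta> r in auto)
    also have "\<dots> = c * r * (real n * local_prob F (ereal t) x)" by (simp add: c_def)
    also have "\<dots> \<le> \<eta> * (real n * local_prob F (ereal t) x)"
      using r c F.local_prob_nonneg by (intro mult_right_mono) (auto simp: field_simps)
    finally show "prob {\<omega> \<in> space M. (\<Sum>i=1..n. \<xi> i \<omega>) \<in> shifted_Delta (ereal t) x \<and> (\<forall>i\<in>{1..n}. \<xi> i \<omega> \<le> \<delta> * x)}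
        \<le> \<eta> * (real n * local_prob F (ereal t) x)" .
  qed
  then have "no_jump_negligible L (ereal t) \<delta>"
    unfolding no_jump_negligible_def using \<delta> by blast
  then show ?thesis by (rule that)
qed

end

section \<open>The big-jump asymptotics\<close>

context iid_walk
begin

text \<open>From below, the events \<open>A i\<close> single out one big step and are disjoint;
  \<open>e\<close> is lost by the displacement of the window and \<open>2 * e\<close> by the
  conditions on the rest. From above, \<open>U i\<close>, \<open>V i\<close> and \<open>W\<close>
  cover the event, and each kind adds at most \<open>e\<close> to the relative error.\<close>

lemma prob_sum_asymptotics:
  assumes L: "0 \<le> L" and irv: "intermediate_regularly_varying (local_prob F T)"
    and neg: "no_jump_negligible L T \<delta>"
    and B: "0 < B" and XB: "\<And>x w. XB \<le> x \<Longrightarrow> x \<le> w \<Longrightarrow> local_prob F T w \<le> B * local_prob F T x"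
    and \<eta>: "0 < \<eta>"
  obtains \<rho> X where "0 < \<rho>" "0 < X"
    "\<And>n a x. normed L n a \<Longrightarrow> X \<le> x \<Longrightarrow> real n * Q_fun F x \<le> \<rho> \<Longrightarrow>
      \<bar>prob {\<omega> \<in> space M. (\<Sum>i=1..n. \<xi> i \<omega>) \<in> shifted_Delta T x} / (real n * local_prob F T x) - 1\<bar> \<le> \<eta>"
proof -
  let ?g = "local_prob F T"
  define e where "e = min (\<eta> / 3) (1 / 2)"
  have e: "0 < e" "3 * e \<le> \<eta>" "e \<le> 1 / 2" using \<eta> by (auto simp: e_def)
  have \<delta>: "0 < \<delta>" "\<delta> \<le> 1" using neg by (auto simp: no_jump_negligible_def)
  obtain \<epsilon>0 X1 where \<epsilon>0: "0 < \<epsilon>0" and X1: "0 < X1" "\<And>x. X1 \<le> x \<Longrightarrow> 0 < ?g x"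
    and unif: "\<And>x z. X1 \<le> x \<Longrightarrow> \<bar>z\<bar> \<le> \<epsilon>0 * x \<Longrightarrow> (1 - e) * ?g x \<le> ?g (x - z) \<and> ?g (x - z) \<le> (1 + e) * ?g x"
    using intermediate_regularly_varying_uniform[OF irv e(1)] by metis
  obtain C X2 where C: "0 < C" and X2: "0 < X2" "\<And>x. X2 \<le> x \<Longrightarrow> ?g (\<delta> * x) \<le> C * ?g x"
    using intermediate_regularly_varying_shrink[OF irv \<delta>] by metis
  have "\<exists>\<rho>>0. \<exists>X>0. \<forall>n a x. normed L n a \<longrightarrow> X \<le> x \<longrightarrow> real n * Q_fun F x \<le> \<rho> \<longrightarrow>
      prob {\<omega> \<in> space M. (\<Sum>i=1..n. \<xi> i \<omega>) \<in> shifted_Delta T x \<and> (\<forall>i\<in>{1..n}. \<xi> i \<omega> \<le> \<delta> * x)}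
        \<le> e * (real n * ?g x)"
    using neg e(1) unfolding no_jump_negligible_def by blast
  then obtain \<rho>1 X3 where \<rho>1: "0 < \<rho>1" and no_jump: "\<forall>n a x.
    normed L n a \<longrightarrow> X3 \<le> x \<longrightarrow> real n * Q_fun F x \<le> \<rho>1 \<longrightarrow>
      prob {\<omega> \<in> space M. (\<Sum>i=1..n. \<xi> i \<omega>) \<in> shifted_Delta T x \<and> (\<forall>i\<in>{1..n}. \<xi> i \<omega> \<le> \<delta> * x)}
        \<le> e * (real n * ?g x)"
    by blast
  define \<epsilon> where "\<epsilon> = min \<epsilon>0 (1 / 2)"
  have \<epsilon>: "0 < \<epsilon>" "\<epsilon> \<le> \<epsilon>0" "\<epsilon> \<le> 1 / 2" using \<epsilon>0 by (auto simp: \<epsilon>_def)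
  \<comment> \<open>\<open>d\<close> will bound the probability of a large rest: \<open>A i\<close>
    calls for \<open>d \<le> e\<close>, and \<open>V i\<close> for
    \<open>B * C * d \<le> e\<close>.\<close>
  define d where "d = min e (e / (B * C))"
  have d: "0 < d" "d \<le> e" "B * C * d \<le> e"
  proof -
    show "0 < d" "d \<le> e" using e B C by (auto simp: d_def)
    have "B * C * d \<le> B * C * (e / (B * C))" using B C by (intro mult_left_mono) (auto simp: d_def)
    then show "B * C * d \<le> e" using B C by simp
  qed
  \<comment> \<open>Chebyshev's bound for the rest is at most
    \<open>n * Q (\<epsilon> * x) + \<kappa>\<^sup>2\<close>, and each term is kept below
    \<open>d / 2\<close>.\<close>
  define \<kappa> where "\<kappa> = min (d / 2) 1"
  have \<kappa>: "0 < \<kappa>" "\<kappa>\<^sup>2 \<le> d / 2"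
  proof -
    show "0 < \<kappa>" using d by (simp add: \<kappa>_def)
    then have "\<kappa> * \<kappa> \<le> 1 * \<kappa>" by (intro mult_right_mono) (auto simp: \<kappa>_def)
    then show "\<kappa>\<^sup>2 \<le> d / 2" by (simp add: \<kappa>_def power2_eq_square)
  qed
  obtain \<rho>2 where \<rho>2: "0 < \<rho>2" "\<And>n a y. real n * Q_fun F a = 1 \<Longrightarrow> 0 < a \<Longrightarrow> real n * \<bar>trunc_mean F a\<bar> \<le> L * a
    \<Longrightarrow> 0 < y \<Longrightarrow> real n * Q_fun F y \<le> \<rho>2 \<Longrightarrow> real n * \<bar>trunc_mean F y\<bar> \<le> \<kappa> * y"
    using F.trunc_mean_small[OF L \<kappa>(1)] by metis
  \<comment> \<open>\<open>e / 4\<close> answers \<open>Q (x / 2) \<le> 4 * Q x\<close>, and the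
    factor \<open>\<epsilon>\<^sup>2\<close> answers
    \<open>Q (\<epsilon> * x) \<le> Q x / \<epsilon>\<^sup>2\<close>.\<close>
  define \<rho> where "\<rho> = min \<rho>1 (min (e / 4) (\<epsilon>\<^sup>2 * min \<rho>2 (d / 2)))"
  have \<rho>: "0 < \<rho>" "\<rho> \<le> \<rho>1" "\<rho> \<le> e / 4" "\<rho> \<le> \<epsilon>\<^sup>2 * \<rho>2" "\<rho> \<le> \<epsilon>\<^sup>2 * (d / 2)"
  proof -
    show "0 < \<rho>" "\<rho> \<le> \<rho>1" "\<rho> \<le> e / 4" using \<rho>1 \<rho>2 e d \<epsilon> by (auto simp: \<rho>_def)
    have "\<epsilon>\<^sup>2 * min \<rho>2 (d / 2) \<le> \<epsilon>\<^sup>2 * \<rho>2" "\<epsilon>\<^sup>2 * min \<rho>2 (d / 2) \<le> \<epsilon>\<^sup>2 * (d / 2)"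
      by (intro mult_left_mono; simp)+
    moreover have "\<rho> \<le> \<epsilon>\<^sup>2 * min \<rho>2 (d / 2)" by (simp add: \<rho>_def)
    ultimately show "\<rho> \<le> \<epsilon>\<^sup>2 * \<rho>2" "\<rho> \<le> \<epsilon>\<^sup>2 * (d / 2)" by linarith+
  qed
  define X where "X = max (max X1 X2) (max X3 (XB / \<delta>))"
  show ?thesis
  proof (rule that[OF \<rho>(1)])
    show "0 < X" using X1 by (simp add: X_def)
    fix n a x assume na: "normed L n a" and x: "X \<le> x" and q: "real n * Q_fun F x \<le> \<rho>"
    have x': "X1 \<le> x" "X2 \<le> x" "X3 \<le> x" "XB / \<delta> \<le> x" using x by (auto simp: X_def)
    have x_pos: "0 < x" using x' X1 by simp
    have gx: "0 < ?g x" using x' X1 by simp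
    have n: "0 < real n" using na by (simp add: normed_def)
    let ?S = "\<lambda>\<omega>. \<Sum>i=1..n. \<xi> i \<omega>"
    define R where "R i \<omega> = (\<Sum>j\<in>{1..n} - {i}. \<xi> j \<omega>)" for i \<omega>
    define E where "E = {\<omega> \<in> space M. ?S \<omega> \<in> shifted_Delta T x}"
    have [measurable]: "\<xi> j \<in> borel_measurable M" if "j \<in> {1..n}" for j
      using that by (intro step_measurable) auto
    have R_meas [measurable]: "R i \<in> borel_measurable M" for i
      unfolding R_def by measurable
    have E_meas: "E \<in> events" unfolding E_def by measurable
    have S_eq: "?S \<omega> = R i \<omega> + \<xi> i \<omega>" if "i \<in> {1..n}" for i \<omega>
      unfolding R_def using that sum.remove[of "{1..n}" i "\<lambda>i. \<xi> i \<omega>"] by simp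
    have law_i: "distr M borel (\<lambda>\<omega>. \<Sum>j\<in>{i}. \<xi> j \<omega>) = F" if "i \<in> {1..n}" for i
      using law[of i] that by simp
    have section_eq: "measure F {y \<in> UNIV. z + y \<in> shifted_Delta T x} = ?g (x - z)" for z
      unfolding local_prob_def by (intro arg_cong[where f = "measure F"])
        (auto simp: add_mem_shifted_Delta[of _ z] add.commute[of z])
    have split: "({1..n} - {i}) \<inter> {i} = {}" "({1..n} - {i}) \<union> {i} = {1..n}" if "i \<in> {1..n}" for i
      using that by auto
    have rest: "prob {\<omega> \<in> space M. \<epsilon> * x < \<bar>R i \<omega>\<bar>} \<le> d" if "i \<in> {1..n}" for i
    proof -
      have "\<epsilon> * x \<le> x" using \<epsilon> x_pos by simp
      have "real n * Q_fun F (\<epsilon> * x) \<le> real n * ((x / (\<epsilon> * x))\<^sup>2 * Q_fun F x)"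
        using \<epsilon> x_pos \<open>\<epsilon> * x \<le> x\<close> by (intro mult_left_mono F.Q_fun_le_scale) auto
      also have "\<dots> = real n * Q_fun F x / \<epsilon>\<^sup>2" using x_pos by (simp add: power_divide)
      also have "\<dots> \<le> \<rho> / \<epsilon>\<^sup>2" using q by (intro divide_right_mono) auto
      finally have "real n * Q_fun F (\<epsilon> * x) \<le> \<rho> / \<epsilon>\<^sup>2" .
      moreover have "\<rho> / \<epsilon>\<^sup>2 \<le> \<rho>2" "\<rho> / \<epsilon>\<^sup>2 \<le> d / 2"
        using \<rho> \<epsilon> by (simp_all add: divide_le_eq mult.commute)
      ultimately have Q: "real n * Q_fun F (\<epsilon> * x) \<le> \<rho>2" "real n * Q_fun F (\<epsilon> * x) \<le> d / 2" by linarith+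
      have "real n * \<bar>trunc_mean F (\<epsilon> * x)\<bar> \<le> \<kappa> * (\<epsilon> * x)"
        using na normed_pos[OF na] \<epsilon> x_pos Q by (intro \<rho>2(2)[of n a]) (auto simp: normed_def)
      then have "real n * \<bar>trunc_mean F (\<epsilon> * x)\<bar> / (\<epsilon> * x) \<le> \<kappa>"
        using \<epsilon> x_pos by (simp add: pos_divide_le_eq)
      then have "(real n * \<bar>trunc_mean F (\<epsilon> * x)\<bar> / (\<epsilon> * x))\<^sup>2 \<le> \<kappa>\<^sup>2"
        using \<epsilon> x_pos by (intro power_mono) auto
      moreover have "prob {\<omega> \<in> space M. \<epsilon> * x < \<bar>R i \<omega>\<bar>}
          \<le> real n * Q_fun F (\<epsilon> * x) + (real n * \<bar>trunc_mean F (\<epsilon> * x)\<bar> / (\<epsilon> * x))\<^sup>2"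
        unfolding R_def using \<epsilon> x_pos that by (intro prob_sum_large) auto
      ultimately show ?thesis using Q \<kappa> by linarith
    qed
    have steps: "prob {\<omega> \<in> space M. \<not> (\<forall>j\<in>{1..n} - {i}. \<xi> j \<omega> \<le> x / 2)} \<le> e" if "i \<in> {1..n}" for i
    proof -
      have "prob {\<omega> \<in> space M. \<exists>j\<in>{1..n} - {i}. \<xi> j \<omega> \<in> {y. x / 2 < y}} \<le> real n * tail F (x / 2)"
        unfolding tail_def using that by (intro prob_some_step_in) auto
      also have "\<dots> \<le> real n * (4 * Q_fun F x)"
      proof (rule mult_left_mono)
        have "tail F (x / 2) \<le> Q_fun F (x / 2)"
          using F.tail_le_abs_tail F.abs_tail_le_Q_fun by (rule order_trans)
        also have "\<dots> \<le> (x / (x / 2))\<^sup>2 * Q_fun F x" using x_pos by (intro F.Q_fun_le_scale) auto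
        also have "\<dots> = 4 * Q_fun F x" using x_pos by simp
        finally show "tail F (x / 2) \<le> 4 * Q_fun F x" .
      qed simp
      also have "\<dots> \<le> e" using q \<rho> by simp
      finally show ?thesis by (simp add: not_le)
    qed
    define A where "A i = {\<omega> \<in> space M. (\<bar>R i \<omega>\<bar> \<le> \<epsilon> * x \<and> (\<forall>j\<in>{1..n} - {i}. \<xi> j \<omega> \<le> x / 2))
        \<and> ?S \<omega> \<in> shifted_Delta T x}" for i
    have A_meas: "A i \<in> events" if "i \<in> {1..n}" for i
      unfolding A_def by measurable
    have A_lower: "(1 - 3 * e) * ?g x \<le> prob (A i)" if i: "i \<in> {1..n}" for i
    proof -
      let ?P = "\<lambda>f. \<bar>\<Sum>j\<in>{1..n} - {i}. f j\<bar> \<le> \<epsilon> * x \<and> (\<forall>j\<in>{1..n} - {i}. f j \<le> x / 2)"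
      have "(1 - e) * ?g x * prob {\<omega> \<in> space M. ?P (\<lambda>j\<in>{1..n} - {i}. \<xi> j \<omega>)}
        \<le> prob {\<omega> \<in> space M. ?P (\<lambda>j\<in>{1..n} - {i}. \<xi> j \<omega>) \<and> (\<Sum>j\<in>{i}. \<xi> j \<omega>) \<in> UNIV \<and> ?S \<omega> \<in> shifted_Delta T x}"
      proof (rule prob_block_sections_ge[OF split[OF i]])
        show "Measurable.pred (PiM ({1..n} - {i}) (\<lambda>_. borel)) ?P" by measurable
        show "0 \<le> (1 - e) * ?g x" using e gx by simp
        fix f :: "nat \<Rightarrow> real" assume "?P f"
        then have "\<bar>\<Sum>j\<in>{1..n} - {i}. f j\<bar> \<le> \<epsilon>0 * x"
          using \<epsilon> x_pos by (meson mult_right_mono order_trans less_imp_le)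
        then show "(1 - e) * ?g x \<le> measure (distr M borel (\<lambda>\<omega>. \<Sum>j\<in>{i}. \<xi> j \<omega>))
            {y \<in> UNIV. (\<Sum>j\<in>{1..n} - {i}. f j) + y \<in> shifted_Delta T x}"
          unfolding law_i[OF i] section_eq using unif x' by blast
      qed auto
      then have "(1 - e) * ?g x * prob {\<omega> \<in> space M. \<bar>R i \<omega>\<bar> \<le> \<epsilon> * x \<and> (\<forall>j\<in>{1..n} - {i}. \<xi> j \<omega> \<le> x / 2)} \<le> prob (A i)"
        by (simp add: A_def R_def conj_assoc cong: conj_cong)
      moreover have "1 - 2 * e \<le> prob {\<omega> \<in> space M. \<bar>R i \<omega>\<bar> \<le> \<epsilon> * x \<and> (\<forall>j\<in>{1..n} - {i}. \<xi> j \<omega> \<le> x / 2)}"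
      proof -
        have "1 - prob {\<omega> \<in> space M. \<not> \<bar>R i \<omega>\<bar> \<le> \<epsilon> * x} - prob {\<omega> \<in> space M. \<not> (\<forall>j\<in>{1..n} - {i}. \<xi> j \<omega> \<le> x / 2)}
          \<le> prob {\<omega> \<in> space M. \<bar>R i \<omega>\<bar> \<le> \<epsilon> * x \<and> (\<forall>j\<in>{1..n} - {i}. \<xi> j \<omega> \<le> x / 2)}"
          by (rule prob_conj_ge) measurable
        then show ?thesis using rest[OF i] steps[OF i] d by (simp only: not_le)
      qed
      then have "(1 - e) * ?g x * (1 - 2 * e)
          \<le> (1 - e) * ?g x * prob {\<omega> \<in> space M. \<bar>R i \<omega>\<bar> \<le> \<epsilon> * x \<and> (\<forall>j\<in>{1..n} - {i}. \<xi> j \<omega> \<le> x / 2)}"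
        using e gx by (intro mult_left_mono) auto
      moreover have "(1 - 3 * e) * ?g x \<le> ((1 - e) * (1 - 2 * e)) * ?g x"
        using e gx by (intro mult_right_mono) (auto simp: algebra_simps)
      ultimately show ?thesis by (simp only: mult_ac)
    qed
    \<comment> \<open>On \<open>A k\<close> the rest is at most \<open>x / 2\<close>, so a sum above
      \<open>x\<close> forces \<open>\<xi> k > x / 2\<close>, whereas \<open>A i\<close> with
      \<open>i \<noteq> k\<close> demands \<open>\<xi> k \<le> x / 2\<close>.\<close>
    have disj: "disjoint_family_on A {1..n}"
    unfolding disjoint_family_on_def
    proof (intro ballI impI)
      fix i k assume ik: "i \<in> {1..n}" "k \<in> {1..n}" "i \<noteq> k"
      have False if "\<omega> \<in> A i" "\<omega> \<in> A k" for \<omega>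
      proof -
        have "\<xi> k \<omega> \<le> x / 2" "\<bar>R k \<omega>\<bar> \<le> \<epsilon> * x" "x < ?S \<omega>"
          using that ik by (auto simp: A_def mem_shifted_Delta)
        moreover have "\<epsilon> * x \<le> 1 / 2 * x" using \<epsilon> x_pos by (intro mult_right_mono) auto
        ultimately show False using S_eq[OF ik(2), of \<omega>] by linarith
      qed
      then show "A i \<inter> A k = {}" by blast
    qed
    have "(\<Sum>i=1..n. (1 - 3 * e) * ?g x) \<le> (\<Sum>i=1..n. prob (A i))"
      by (intro sum_mono A_lower)
    also have "\<dots> = prob (\<Union>i\<in>{1..n}. A i)"
      using A_meas disj by (intro finite_measure_finite_Union[symmetric]) auto
    also have "\<dots> \<le> prob E"
      using E_meas by (intro finite_measure_mono) (auto simp: A_def E_def)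
    finally have lower: "(1 - 3 * e) * (real n * ?g x) \<le> prob E"
      by (simp add: mult_ac)
    \<comment> \<open>Unless no step exceeds \<open>\<delta> * x\<close>, which is \<open>W\<close>,
      some step does; its rest is either small, which gives \<open>U i\<close>, or large, which
      gives \<open>V i\<close>.\<close>
    define U where "U i = {\<omega> \<in> space M. \<bar>R i \<omega>\<bar> \<le> \<epsilon> * x \<and> ?S \<omega> \<in> shifted_Delta T x}" for i
    define V where "V i = {\<omega> \<in> space M. \<epsilon> * x < \<bar>R i \<omega>\<bar> \<and> \<delta> * x < \<xi> i \<omega> \<and> ?S \<omega> \<in> shifted_Delta T x}" for i
    define W where "W = {\<omega> \<in> space M. ?S \<omega> \<in> shifted_Delta T x \<and> (\<forall>i\<in>{1..n}. \<xi> i \<omega> \<le> \<delta> * x)}"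
    have U_meas: "U i \<in> events" and V_meas: "V i \<in> events" if "i \<in> {1..n}" for i
      unfolding U_def V_def using that by measurable
    have W_meas: "W \<in> events" unfolding W_def by measurable
    have U_le: "prob (U i) \<le> (1 + e) * ?g x" if i: "i \<in> {1..n}" for i
    proof -
      let ?P = "\<lambda>f. \<bar>\<Sum>j\<in>{1..n} - {i}. f j\<bar> \<le> \<epsilon> * x"
      have "prob {\<omega> \<in> space M. ?P (\<lambda>j\<in>{1..n} - {i}. \<xi> j \<omega>) \<and> (\<Sum>j\<in>{i}. \<xi> j \<omega>) \<in> UNIV \<and> ?S \<omega> \<in> shifted_Delta T x}
        \<le> (1 + e) * ?g x * prob {\<omega> \<in> space M. ?P (\<lambda>j\<in>{1..n} - {i}. \<xi> j \<omega>)}"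
      proof (rule prob_block_sections_le[OF split[OF i]])
        show "Measurable.pred (PiM ({1..n} - {i}) (\<lambda>_. borel)) ?P" by measurable
        show "0 \<le> (1 + e) * ?g x" using e gx by simp
        fix f :: "nat \<Rightarrow> real" assume "?P f"
        then have "\<bar>\<Sum>j\<in>{1..n} - {i}. f j\<bar> \<le> \<epsilon>0 * x"
          using \<epsilon> x_pos by (meson mult_right_mono order_trans less_imp_le)
        then show "measure (distr M borel (\<lambda>\<omega>. \<Sum>j\<in>{i}. \<xi> j \<omega>))
            {y \<in> UNIV. (\<Sum>j\<in>{1..n} - {i}. f j) + y \<in> shifted_Delta T x} \<le> (1 + e) * ?g x"
          unfolding law_i[OF i] section_eq using unif x' by blast
      qed auto
      also have "\<dots> \<le> (1 + e) * ?g x * 1" using e gx by (intro mult_left_mono prob_le_1) auto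
      finally show ?thesis by (simp add: U_def R_def)
    qed
    have V_le: "prob (V i) \<le> e * ?g x" if i: "i \<in> {1..n}" for i
    proof -
      let ?P = "\<lambda>f. \<epsilon> * x < \<bar>\<Sum>j\<in>{1..n} - {i}. f j\<bar>"
      have "prob {\<omega> \<in> space M. ?P (\<lambda>j\<in>{1..n} - {i}. \<xi> j \<omega>) \<and> (\<Sum>j\<in>{i}. \<xi> j \<omega>) \<in> {\<delta> * x<..} \<and> ?S \<omega> \<in> shifted_Delta T x}
        \<le> B * C * ?g x * prob {\<omega> \<in> space M. ?P (\<lambda>j\<in>{1..n} - {i}. \<xi> j \<omega>)}"
      proof (rule prob_block_sections_le[OF split[OF i]])
        show "Measurable.pred (PiM ({1..n} - {i}) (\<lambda>_. borel)) ?P" by measurable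
        show "0 \<le> B * C * ?g x" using B C gx by simp
        fix f :: "nat \<Rightarrow> real"
        define z where "z = (\<Sum>j\<in>{1..n} - {i}. f j)"
        \<comment> \<open>The step lies beyond both \<open>x - z\<close> and
          \<open>\<delta> * x\<close>, so the window may start at their maximum. Almost monotonicity
          leads from there to \<open>\<delta> * x\<close> and \<open>X2\<close> from
          \<open>\<delta> * x\<close> to \<open>x\<close>, uniformly in \<open>z\<close>.\<close>
        have "measure F {y \<in> {\<delta> * x<..}. z + y \<in> shifted_Delta T x} \<le> ?g (max (x - z) (\<delta> * x))"
          unfolding local_prob_def
          by (rule F.finite_measure_mono)
             (auto simp: add_mem_shifted_Delta[of _ z] add.commute[of z] intro: shifted_Delta_cut)
        also have "\<dots> \<le> B * ?g (\<delta> * x)"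
          using x'(4) \<delta> by (intro XB) (auto simp: divide_le_eq mult.commute)
        also have "\<dots> \<le> B * (C * ?g x)" using X2 x' B by (intro mult_left_mono) auto
        finally show "measure (distr M borel (\<lambda>\<omega>. \<Sum>j\<in>{i}. \<xi> j \<omega>))
            {y \<in> {\<delta> * x<..}. (\<Sum>j\<in>{1..n} - {i}. f j) + y \<in> shifted_Delta T x} \<le> B * C * ?g x"
          unfolding law_i[OF i] z_def by simp
      qed auto
      also have "prob {\<omega> \<in> space M. ?P (\<lambda>j\<in>{1..n} - {i}. \<xi> j \<omega>)} = prob {\<omega> \<in> space M. \<epsilon> * x < \<bar>R i \<omega>\<bar>}"
        by (simp add: R_def)
      also have "B * C * ?g x * prob {\<omega> \<in> space M. \<epsilon> * x < \<bar>R i \<omega>\<bar>} \<le> B * C * ?g x * d"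
        using B C gx rest[OF i] by (intro mult_left_mono) auto
      also have "\<dots> = B * C * d * ?g x" by simp
      also have "\<dots> \<le> e * ?g x" using d gx by (intro mult_right_mono) auto
      finally show ?thesis by (simp add: V_def R_def)
    qed
    have "prob E \<le> prob ((\<Union>i\<in>{1..n}. U i) \<union> (\<Union>i\<in>{1..n}. V i) \<union> W)"
    proof (rule finite_measure_mono)
      show "E \<subseteq> (\<Union>i\<in>{1..n}. U i) \<union> (\<Union>i\<in>{1..n}. V i) \<union> W"
        by (auto simp: E_def U_def V_def W_def not_le not_less)
      show "(\<Union>i\<in>{1..n}. U i) \<union> (\<Union>i\<in>{1..n}. V i) \<union> W \<in> events"
        using U_meas V_meas W_meas by auto
    qed
    also have "\<dots> \<le> (prob (\<Union>i\<in>{1..n}. U i) + prob (\<Union>i\<in>{1..n}. V i)) + prob W"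
      using U_meas V_meas W_meas
      by (intro order_trans[OF measure_Un_le] add_right_mono measure_Un_le) auto
    also have "\<dots> \<le> ((\<Sum>i=1..n. prob (U i)) + (\<Sum>i=1..n. prob (V i))) + prob W"
      using U_meas V_meas by (intro add_mono order_refl finite_measure_subadditive_finite) auto
    also have "\<dots> \<le> ((\<Sum>i=1..n. (1 + e) * ?g x) + (\<Sum>i=1..n. e * ?g x)) + e * (real n * ?g x)"
      using no_jump na x'(3) q \<rho>(2) unfolding W_def
      by (intro add_mono sum_mono U_le V_le) (auto intro: order_trans)
    also have "\<dots> = (1 + 3 * e) * (real n * ?g x)" by (simp add: algebra_simps)
    finally have upper: "prob E \<le> (1 + 3 * e) * (real n * ?g x)" .
    have ng: "0 < real n * ?g x" using n gx by simp
    have "1 - 3 * e \<le> prob E / (real n * ?g x)" "prob E / (real n * ?g x) \<le> 1 + 3 * e"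
      using lower upper ng by (simp_all only: pos_le_divide_eq pos_divide_le_eq)
    then show "\<bar>prob {\<omega> \<in> space M. ?S \<omega> \<in> shifted_Delta T x} / (real n * ?g x) - 1\<bar> \<le> \<eta>"
      using e unfolding E_def by linarith
  qed
qed

end

theorem theorem9p1:
  fixes M :: "'a measure" and \<xi> :: "nat \<Rightarrow> 'a \<Rightarrow> real" and F :: "real measure"
    and T :: ereal and xs :: "nat \<Rightarrow> real"
  assumes "prob_space M"
    and "prob_space.indep_vars M (\<lambda>_. borel) \<xi> {1..}"
    and "\<And>i. i \<ge> 1 \<Longrightarrow> distr M borel (\<xi> i) = F"
    and "0 < T"
    and "abs_tail F \<in> O[at_top](\<lambda>x. trunc_second_moment F x / x\<^sup>2)"
    and "(\<lambda>x. trunc_second_moment F x / x\<^sup>2) \<in> O[at_top](abs_tail F)"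
    and "Limsup at_top (\<lambda>x. ereal (abs_tail F x / tail F x)) < \<infinity>"
    and "limsup (\<lambda>n. ereal (real n * \<bar>trunc_mean F (norming_seq F n)\<bar> / norming_seq F n)) < \<infinity>"
    and "intermediate_regularly_varying (local_prob F T)"
    and "T < \<infinity> \<Longrightarrow> upper_Matuszewska_index (local_prob F T) < -1"
    and "(\<lambda>n. real n * tail F (xs n)) \<longlonglongrightarrow> 0"
  shows "(\<lambda>n. SUP x\<in>{xs n..}.
            ereal \<bar>measure M {\<omega> \<in> space M. (\<Sum>i=1..n. \<xi> i \<omega>) \<in> shifted_Delta T x}
                    / (real n * local_prob F T x) - 1\<bar>) \<longlonglongrightarrow> 0"
proof -
  interpret prob_space M by (rule assms(1))
  have \<xi>1: "\<xi> 1 \<in> borel_measurable M" using assms(2) by (auto simp: indep_vars_def)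
  interpret F: real_distribution F
    using real_distribution_distr[OF \<xi>1] assms(3)[of 1] by simp
  let ?g = "local_prob F T"
  obtain xg where xg: "\<And>x. xg \<le> x \<Longrightarrow> 0 < ?g x"
    using assms(9) unfolding intermediate_regularly_varying_def pos_measurable_near_infinity_def by auto
  have tail_pos: "0 < tail F x" for x
  proof -
    have "0 < ?g (max x xg)" by (rule xg) simp
    also have "\<dots> \<le> tail F (max x xg)"
      unfolding local_prob_def tail_def by (rule F.finite_measure_mono) (auto simp: mem_shifted_Delta)
    also have "\<dots> \<le> tail F x" by (rule F.tail_antimono) simp
    finally show ?thesis .
  qed
  obtain c1 where c1: "\<forall>\<^sub>F x in at_top. norm (abs_tail F x) \<le> c1 * norm (trunc_second_moment F x / x\<^sup>2)"
    using landau_o.bigE[OF assms(5)] by blast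
  obtain c2 where c2: "\<forall>\<^sub>F x in at_top. norm (trunc_second_moment F x / x\<^sup>2) \<le> c2 * norm (abs_tail F x)"
    using landau_o.bigE[OF assms(6)] by blast
  obtain c3 :: nat where "Limsup at_top (\<lambda>x. ereal (abs_tail F x / tail F x)) < ereal (real c3)"
    using assms(7) less_PInf_Ex_of_nat by auto
  then have c3: "\<forall>\<^sub>F x in at_top. ereal (abs_tail F x / tail F x) < ereal (real c3)"
    by (rule Limsup_lessD)
  define K where "K = max (max c1 c2) (max (real c3) 1)"
  have "\<forall>\<^sub>F x in at_top. abs_tail F x \<le> K * (trunc_second_moment F x / x\<^sup>2)
      \<and> trunc_second_moment F x / x\<^sup>2 \<le> K * abs_tail F x \<and> abs_tail F x \<le> K * tail F x"
    using c1 c2 c3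
  proof eventually_elim
    case (elim x)
    have m: "0 \<le> trunc_second_moment F x / x\<^sup>2" and a: "0 \<le> abs_tail F x"
      using F.trunc_second_moment_nonneg F.abs_tail_nonneg by auto
    have "abs_tail F x \<le> c1 * (trunc_second_moment F x / x\<^sup>2)"
      "trunc_second_moment F x / x\<^sup>2 \<le> c2 * abs_tail F x"
      using elim m a by (simp_all only: real_norm_def abs_of_nonneg)
    moreover have "c1 * (trunc_second_moment F x / x\<^sup>2) \<le> K * (trunc_second_moment F x / x\<^sup>2)"
      using m by (intro mult_right_mono) (auto simp: K_def)
    moreover have "c2 * abs_tail F x \<le> K * abs_tail F x"
      using a by (intro mult_right_mono) (auto simp: K_def)
    moreover have "abs_tail F x \<le> real c3 * tail F x"
      using elim tail_pos[of x] by (simp add: divide_less_eq)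
    moreover have "real c3 * tail F x \<le> K * tail F x"
      using tail_pos[of x] by (intro mult_right_mono) (auto simp: K_def)
    ultimately show ?case by linarith
  qed
  then obtain x1 where x1: "\<And>x. x1 \<le> x \<Longrightarrow> abs_tail F x \<le> K * (trunc_second_moment F x / x\<^sup>2)
      \<and> trunc_second_moment F x / x\<^sup>2 \<le> K * abs_tail F x \<and> abs_tail F x \<le> K * tail F x"
    unfolding eventually_at_top_linorder by blast
  define x0 where "x0 = max x1 1"
  interpret iid_walk M F K x0 \<xi>
  proof
    show "0 < x0" "1 \<le> K" by (auto simp: x0_def K_def)
    fix x assume "x0 \<le> x"
    then have "x1 \<le> x" by (simp add: x0_def)
    then show "abs_tail F x \<le> K * (trunc_second_moment F x / x\<^sup>2)"
      "trunc_second_moment F x / x\<^sup>2 \<le> K * abs_tail F x" "abs_tail F x \<le> K * tail F x"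
      using x1 by blast+
  qed (use assms(2,3) tail_pos in auto)
  obtain l :: nat where "limsup (\<lambda>n. ereal (real n * \<bar>trunc_mean F (norming_seq F n)\<bar> / norming_seq F n)) < ereal (real l)"
    using assms(8) less_PInf_Ex_of_nat by auto
  then have l: "\<forall>\<^sub>F n in sequentially. ereal (real n * \<bar>trunc_mean F (norming_seq F n)\<bar> / norming_seq F n) < ereal (real l)"
    by (rule Limsup_lessD)
  have normed: "\<forall>\<^sub>F n in sequentially. normed (real l) n (norming_seq F n)"
    using l F.norming_seq_eventually[of x0] eventually_ge_at_top[of 2]
  proof eventually_elim
    case (elim n)
    have "0 < norming_seq F n" using elim F.x0_pos by linarith
    then have "real n * \<bar>trunc_mean F (norming_seq F n)\<bar> \<le> real l * norming_seq F n"
      using elim by (simp add: divide_less_eq)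
    then show ?case using elim by (simp add: normed_def)
  qed
  \<comment> \<open>Almost monotonicity comes from the Matuszewska index if \<open>T\<close> is
    finite; for infinite \<open>T\<close> the local probability is the tail, which decreases, so
    that \<open>B = 1\<close> will do.\<close>
  obtain B XB \<delta> where B: "0 < B" "\<And>x w. XB \<le> x \<Longrightarrow> x \<le> w \<Longrightarrow> ?g w \<le> B * ?g x"
    and neg: "no_jump_negligible (real l) T \<delta>"
  proof (cases T)
    case (real t)
    then have t: "0 < t" "T < \<infinity>" using assms(4) by auto
    obtain B X Y where BXY: "0 < B" "0 < X" "1 < Y"
      "\<And>x w. X \<le> x \<Longrightarrow> x \<le> w \<Longrightarrow> ?g w \<le> B * ?g x"
      "\<And>x. X \<le> x \<Longrightarrow> Y * ?g (Y * x) \<le> ?g x / 2"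
      using upper_Matuszewska_index_less_minus_one[OF xg assms(10)[OF t(2)]] by blast
    obtain D where D: "0 < D" "\<And>x. X \<le> x \<Longrightarrow> tail F x \<le> D * x * local_prob F (ereal t) x"
      using F.tail_le_local_prob[OF t(1) BXY[unfolded real]] by blast
    obtain \<delta> where "no_jump_negligible (real l) (ereal t) \<delta>"
      using no_jump_negligible_finite[OF of_nat_0_le_iff t(1) BXY(2) D] by blast
    then show ?thesis using that BXY(1,4) real by blast
  next
    case PInf
    have "?g w \<le> 1 * ?g x" if "x \<le> w" for x w
      using F.tail_antimono[OF that] PInf by (simp add: local_prob_infinity)
    then show ?thesis using that[of 1 0] no_jump_negligible_infinity[of "real l"] PInf by auto
  next
    case MInf
    then show ?thesis using assms(4) by simp
  qed
  let ?r = "\<lambda>n x. \<bar>prob {\<omega> \<in> space M. (\<Sum>i=1..n. \<xi> i \<omega>) \<in> shifted_Delta T x} / (real n * ?g x) - 1\<bar>"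
  \<comment> \<open>The hypothesis on \<open>xs\<close> is used twice:
    \<open>n * tail F (xs n)\<close> below the positive number \<open>tail F X'\<close> forces
    \<open>xs n\<close> beyond \<open>X'\<close>, and its smallness bounds \<open>n * Q x\<close>
    through \<open>Q \<le> (K + 1) * K * tail\<close>.\<close>
  have main: "\<forall>\<^sub>F n in sequentially. \<forall>x\<ge>xs n. ?r n x \<le> \<eta>" if \<eta>: "0 < \<eta>" for \<eta>
  proof -
    obtain \<rho> X where \<rho>: "0 < \<rho>" and X: "\<And>n a x. normed (real l) n a \<Longrightarrow> X \<le> x \<Longrightarrow> real n * Q_fun F x \<le> \<rho> \<Longrightarrow> ?r n x \<le> \<eta>"
    proof (rule prob_sum_asymptotics[OF of_nat_0_le_iff assms(9) neg B(1) _ \<eta>])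
      show "?g w \<le> B * ?g x" if "XB \<le> x" "x \<le> w" for x w using that by (rule B(2))
    next
      fix \<rho> X :: real
      assume "0 < \<rho>" and "\<And>n a x. normed (real l) n a \<Longrightarrow> X \<le> x \<Longrightarrow> real n * Q_fun F x \<le> \<rho> \<Longrightarrow> ?r n x \<le> \<eta>"
      then show thesis by (rule that)
    qed
    define X' where "X' = max X x0"
    have K: "0 < (K + 1) * K" using F.K_ge_1 by simp
    have ev1: "\<forall>\<^sub>F n in sequentially. real n * tail F (xs n) < tail F X'"
      by (rule order_tendstoD(2)[OF assms(11) tail_pos])
    have ev2: "\<forall>\<^sub>F n in sequentially. real n * tail F (xs n) < \<rho> / ((K + 1) * K)"
      using \<rho> K by (intro order_tendstoD(2)[OF assms(11)]) simp
    show ?thesis using ev1 ev2 normed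
    proof eventually_elim
      case (elim n)
      have n: "1 \<le> real n" using elim(3) by (simp add: normed_def)
      have "X' \<le> xs n"
      proof (rule ccontr)
        assume "\<not> X' \<le> xs n"
        then have "1 * tail F X' \<le> real n * tail F (xs n)"
          using n tail_pos[of X'] by (intro mult_mono F.tail_antimono) auto
        then show False using elim(1) by simp
      qed
      show ?case
      proof (intro allI impI)
        fix x assume "xs n \<le> x"
        then have x: "X \<le> x" "x0 \<le> x" using \<open>X' \<le> xs n\<close> by (auto simp: X'_def)
        have "real n * Q_fun F x \<le> real n * ((K + 1) * K * tail F x)"
          using x by (intro mult_left_mono F.Q_fun_le_tail) auto
        also have "\<dots> = (K + 1) * K * (real n * tail F x)" by simp
        also have "\<dots> \<le> (K + 1) * K * (real n * tail F (xs n))"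
          using K \<open>xs n \<le> x\<close> by (intro mult_left_mono F.tail_antimono) auto
        also have "\<dots> \<le> (K + 1) * K * (\<rho> / ((K + 1) * K))"
          using elim(2) K by (intro mult_left_mono) auto
        also have "\<dots> = \<rho>" using F.K_ge_1 by simp
        finally show "?r n x \<le> \<eta>" using X[OF elim(3) x(1)] by simp
      qed
    qed
  qed
  show ?thesis
  proof (rule order_tendstoI)
    fix y :: ereal assume y: "y < 0"
    \<comment> \<open>The point \<open>xs n\<close> itself belongs to the index set; over an empty
      set the supremum in \<open>ereal\<close> would be \<open>-\<infinity>\<close>.\<close>
    have "0 \<le> (SUP x\<in>{xs n..}. ereal (?r n x))" for n
      by (rule SUP_upper2[of "xs n"]) auto
    then show "\<forall>\<^sub>F n in sequentially. y < (SUP x\<in>{xs n..}. ereal (?r n x))"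
      using y by (intro always_eventually allI) (rule less_le_trans)
  next
    fix y :: ereal assume "0 < y"
    then obtain \<eta> where \<eta>: "0 < ereal \<eta>" "ereal \<eta> < y" using ereal_dense2 by blast
    have "\<forall>\<^sub>F n in sequentially. \<forall>x\<ge>xs n. ?r n x \<le> \<eta>" using \<eta> by (intro main) simp
    then show "\<forall>\<^sub>F n in sequentially. (SUP x\<in>{xs n..}. ereal (?r n x)) < y"
    proof eventually_elim
      case (elim n)
      have "(SUP x\<in>{xs n..}. ereal (?r n x)) \<le> ereal \<eta>"
        using elim by (intro SUP_least) auto
      then show ?case using \<eta>(2) by (rule le_less_trans)
    qed
  qed
qed

end
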